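(* Let $f:A\to B$ be an arbitrary object of $\mathcal G$, i.e. an injective $R$-homomorphism such that $A$ and $\mathrm{Cok}\,f$ are Gorenstein projective $R$-modules. If $A$ and $B$ are stable, then $f$ is horizontally linked.
   Context: $(R,\mathfrak m)$ is a commutative noetherian local ring of finite dimension; all modules are finitely generated. An $R$-module is stable if it has no non-trivial projective direct summand. A module is Gorenstein projective if it is a syzygy of an acyclic complex of finitely generated projective modules that remains acyclic after applying $\mathrm{Hom}_R(-,P)$ for every projective $P$. $\mathcal M$ is the category whose objects are $R$-homomorphisms $f:A\to B$ of finitely generated $R$-modules and whose morphisms are commutative squares; $\mathcal S$ is its full subcategory of monomorphisms; $\mathcal G$ is the full subcategory of Gorenstein projective objects of $\mathcal M$, which consists of the monomorphisms $f:A\to B$ with $A$ and $\mathrm{Cok}\,f$ Gorenstein projective. The projective objects of $\mathcal M$ are the direct sums of objects $P\xrightarrow{1}P$ and $0\to P$ with $P$ finitely generated projective. Write $(-)'=\mathrm{Hom}_R(-,R)$. Transpose in $\mathcal M$: let $\mathbf r=(R\xrightarrow{1}R)\oplus(0\to R)$, corresponding to the path algebra of the quiver $\bullet_1\to\bullet_2$ over $R$. For $f:A\to B$ in $\mathcal M$, the left module $f^*=\mathrm{Hom}_{\mathcal M}(f,\mathbf r)$ over the path algebra corresponds to the $R$-homomorphism $\mathrm{Hom}_{\mathcal M}(f,(0\to R))\to\mathrm{Hom}_{\mathcal M}(f,(R\xrightarrow{1}R))$ induced by the inclusion $(0\to R)\to(R\xrightarrow{1}R)$, i.e. to $(\mathrm{Cok}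 f)'\to B'$, regarded again as an object of the category of $R$-homomorphisms. If $f\in\mathcal S$ has minimal projective presentation $(P_1\to P_1\oplus Q_1)\to(P_0\to P_0\oplus Q_0)\to f\to0$ in $\mathcal M$, then $\mathrm{Tr}_{\mathcal M}(f)$ is the cokernel of the induced morphism $(Q_0'\to P_0'\oplus Q_0')\to(Q_1'\to P_1'\oplus Q_1')$. $\Omega^1_{\mathcal M}$ denotes the first syzygy (kernel of a projective cover) in the category of $R$-homomorphisms. An object $f\in\mathcal S$ is horizontally linked if $f\cong\lambda^2f$ in $\mathcal M$, where $\lambda=\Omega^1_{\mathcal M}\mathrm{Tr}_{\mathcal M}$. *)

theory Defs
  imports "HOL-Algebra.Module" "HOL-Algebra.Ring_Divisibility"
begin

section \<open>Rings\<close>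

definition local_ring :: "('a, 'm) ring_scheme \<Rightarrow> bool" where
  "local_ring R \<longleftrightarrow> cring R \<and> (\<exists>!I. maximalideal I R)"

definition finite_krull_dim :: "('a, 'm) ring_scheme \<Rightarrow> bool" where
  "finite_krull_dim R \<longleftrightarrow>
     (\<exists>n. \<forall>ps. (\<forall>P\<in>set ps. primeideal P R) \<and> sorted_wrt (\<subset>) ps \<longrightarrow> length ps \<le> n)"


section \<open>Modules\<close>

text \<open>
  A module record of HOL-Algebra extends a ring record; the fields for multiplication and unit play
  no role for modules and are left undefined in the constructions below.
\<close>

definition mod_hom ::
    "('a, 'm) ring_scheme \<Rightarrow> ('a, 'b) module \<Rightarrow> ('a, 'c) module \<Rightarrow> ('b \<Rightarrow> 'c) \<Rightarrow> bool" where
  "mod_hom R M N h \<longleftrightarrow> h \<in> hom (add_monoid M) (add_monoid N) \<and>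
     (\<forall>r\<in>carrier R. \<forall>x\<in>carrier M. h (r \<odot>\<^bsub>M\<^esub> x) = r \<odot>\<^bsub>N\<^esub> h x)"

definition mod_isomorphic ::
    "('a, 'm) ring_scheme \<Rightarrow> ('a, 'b) module \<Rightarrow> ('a, 'c) module \<Rightarrow> bool" where
  "mod_isomorphic R M N \<longleftrightarrow> (\<exists>h. mod_hom R M N h \<and> bij_betw h (carrier M) (carrier N))"

definition fg_module :: "('a, 'm) ring_scheme \<Rightarrow> ('a, 'b) module \<Rightarrow> bool" where
  "fg_module R M \<longleftrightarrow> module R M \<and>
     (\<exists>S\<subseteq>carrier M. finite S \<and> carrier M = \<Inter>{H. submodule H R M \<and> S \<subseteq> H})"

definition ring_mod :: "('a, 'm) ring_scheme \<Rightarrow> ('a, 'a) module" where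
  "ring_mod R = \<lparr>carrier = carrier R, mult = mult R, one = one R, zero = zero R, add = add R,
     smult = mult R\<rparr>"

definition zero_mod :: "('a, unit) module" where
  "zero_mod = \<lparr>carrier = UNIV, mult = undefined, one = undefined, zero = (),
     add = (\<lambda>_ _. ()), smult = (\<lambda>_ _. ())\<rparr>"

definition free_mod :: "('a, 'm) ring_scheme \<Rightarrow> nat \<Rightarrow> ('a, nat \<Rightarrow> 'a) module" where
  "free_mod R n = \<lparr>carrier = {..<n} \<rightarrow>\<^sub>E carrier R, mult = undefined, one = undefined,
     zero = (\<lambda>i\<in>{..<n}. \<zero>\<^bsub>R\<^esub>),
     add = (\<lambda>x y. \<lambda>i\<in>{..<n}. x i \<oplus>\<^bsub>R\<^esub> y i),
     smult = (\<lambda>r x. \<lambda>i\<in>{..<n}. r \<otimes>\<^bsub>R\<^esub> x i)\<rparr>"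

definition dsum_mod :: "('a, 'b) module \<Rightarrow> ('a, 'c) module \<Rightarrow> ('a, 'b \<times> 'c) module" where
  "dsum_mod M N = \<lparr>carrier = carrier M \<times> carrier N, mult = undefined, one = undefined,
     zero = (\<zero>\<^bsub>M\<^esub>, \<zero>\<^bsub>N\<^esub>),
     add = (\<lambda>(x, y) (x', y'). (x \<oplus>\<^bsub>M\<^esub> x', y \<oplus>\<^bsub>N\<^esub> y')),
     smult = (\<lambda>r (x, y). (r \<odot>\<^bsub>M\<^esub> x, r \<odot>\<^bsub>N\<^esub> y))\<rparr>"

definition quot_mod :: "('a, 'b) module \<Rightarrow> 'b set \<Rightarrow> ('a, 'b set) module" where
  "quot_mod M H = \<lparr>carrier = a_rcosets\<^bsub>M\<^esub> H, mult = undefined, one = undefined, zero = H,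
     add = set_add M,
     smult = (\<lambda>r X. \<Union>x\<in>X. H +>\<^bsub>M\<^esub> (r \<odot>\<^bsub>M\<^esub> x))\<rparr>"

definition cok_mod :: "('a, 'b) module \<Rightarrow> ('a, 'c) module \<Rightarrow> ('b \<Rightarrow> 'c) \<Rightarrow> ('a, 'c set) module" where
  "cok_mod M N h = quot_mod N (h ` carrier M)"

text \<open>Homomorphisms are taken extensional here, so that each has exactly one representative.\<close>

definition Hom_mod ::
    "('a, 'm) ring_scheme \<Rightarrow> ('a, 'b) module \<Rightarrow> ('a, 'c) module \<Rightarrow> ('a, 'b \<Rightarrow> 'c) module" where
  "Hom_mod R M N = \<lparr>carrier = {h \<in> extensional (carrier M). mod_hom R M N h},
     mult = undefined, one = undefined,
     zero = (\<lambda>x\<in>carrier M. \<zero>\<^bsub>N\<^esub>),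
     add = (\<lambda>g h. \<lambda>x\<in>carrier M. g x \<oplus>\<^bsub>N\<^esub> h x),
     smult = (\<lambda>r h. \<lambda>x\<in>carrier M. r \<odot>\<^bsub>N\<^esub> h x)\<rparr>"

definition direct_summand :: "'b set \<Rightarrow> ('a, 'm) ring_scheme \<Rightarrow> ('a, 'b) module \<Rightarrow> bool" where
  "direct_summand H R M \<longleftrightarrow> submodule H R M \<and>
     (\<exists>K. submodule K R M \<and> H \<inter> K = {\<zero>\<^bsub>M\<^esub>} \<and> H <+>\<^bsub>M\<^esub> K = carrier M)"

definition fg_projective :: "('a, 'm) ring_scheme \<Rightarrow> ('a, 'b) module \<Rightarrow> bool" where
  "fg_projective R P \<longleftrightarrow> module R P \<and>
     (\<exists>n H. direct_summand H R (free_mod R n) \<and>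
            mod_isomorphic R P ((free_mod R n)\<lparr>carrier := H\<rparr>))"

definition stable_mod :: "('a, 'm) ring_scheme \<Rightarrow> ('a, 'b) module \<Rightarrow> bool" where
  "stable_mod R M \<longleftrightarrow>
     (\<forall>H. direct_summand H R M \<and> fg_projective R (M\<lparr>carrier := H\<rparr>) \<longrightarrow> H = {\<zero>\<^bsub>M\<^esub>})"

definition exact_at ::
    "('a, 'b) module \<Rightarrow> ('a, 'c) module \<Rightarrow> ('a, 'd) module \<Rightarrow> ('b \<Rightarrow> 'c) \<Rightarrow> ('c \<Rightarrow> 'd) \<Rightarrow> bool" where
  "exact_at L M N g h \<longleftrightarrow> g ` carrier L = a_kernel M N h"

text \<open>
  Every finitely generated projective module is isomorphic to a submodule of some
  \<open>free_mod R n\<close>, so quantifying over modules with elements of type \<open>nat \<Rightarrow> 'a\<close> captures all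
  finitely generated projective modules up to isomorphism.  The differential \<open>d i\<close> goes from
  \<open>P i\<close> to \<open>P (i - 1)\<close>.
\<close>

definition totally_acyclic ::
    "('a, 'm) ring_scheme \<Rightarrow> (int \<Rightarrow> ('a, nat \<Rightarrow> 'a) module) \<Rightarrow>
     (int \<Rightarrow> (nat \<Rightarrow> 'a) \<Rightarrow> (nat \<Rightarrow> 'a)) \<Rightarrow> bool" where
  "totally_acyclic R P d \<longleftrightarrow>
     (\<forall>i. fg_projective R (P i)) \<and>
     (\<forall>i. mod_hom R (P i) (P (i - 1)) (d i)) \<and>
     (\<forall>i. exact_at (P (i + 1)) (P i) (P (i - 1)) (d (i + 1)) (d i)) \<and>
     (\<forall>Q :: ('a, nat \<Rightarrow> 'a) module. fg_projective R Q \<longrightarrow>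
        (\<forall>i. exact_at (Hom_mod R (P (i - 1)) Q) (Hom_mod R (P i) Q) (Hom_mod R (P (i + 1)) Q)
               (\<lambda>h. compose (carrier (P i)) h (d i))
               (\<lambda>h. compose (carrier (P (i + 1))) h (d (i + 1)))))"

definition gorenstein_projective :: "('a, 'm) ring_scheme \<Rightarrow> ('a, 'b) module \<Rightarrow> bool" where
  "gorenstein_projective R M \<longleftrightarrow> module R M \<and>
     (\<exists>P d i. totally_acyclic R P d \<and>
        mod_isomorphic R M ((P i)\<lparr>carrier := a_kernel (P i) (P (i - 1)) (d i)\<rparr>))"


section \<open>The category of homomorphisms of finitely generated modules\<close>

record ('a, 'b, 'c) mobj =
  src :: "('a, 'b) module"
  tgt :: "('a, 'c) module"
  arr :: "'b \<Rightarrow> 'c"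

definition is_mobj :: "('a, 'm) ring_scheme \<Rightarrow> ('a, 'b, 'c) mobj \<Rightarrow> bool" where
  "is_mobj R f \<longleftrightarrow> fg_module R (src f) \<and> fg_module R (tgt f) \<and> mod_hom R (src f) (tgt f) (arr f)"

definition is_mono_mobj :: "('a, 'm) ring_scheme \<Rightarrow> ('a, 'b, 'c) mobj \<Rightarrow> bool" where
  "is_mono_mobj R f \<longleftrightarrow> is_mobj R f \<and> inj_on (arr f) (carrier (src f))"

definition mobj_hom ::
    "('a, 'm) ring_scheme \<Rightarrow> ('a, 'b, 'c) mobj \<Rightarrow> ('a, 'd, 'e) mobj \<Rightarrow>
     ('b \<Rightarrow> 'd) \<times> ('c \<Rightarrow> 'e) \<Rightarrow> bool" where
  "mobj_hom R f g \<phi> \<longleftrightarrow>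
     mod_hom R (src f) (src g) (fst \<phi>) \<and> mod_hom R (tgt f) (tgt g) (snd \<phi>) \<and>
     (\<forall>x\<in>carrier (src f). snd \<phi> (arr f x) = arr g (fst \<phi> x))"

definition mobj_isomorphic ::
    "('a, 'm) ring_scheme \<Rightarrow> ('a, 'b, 'c) mobj \<Rightarrow> ('a, 'd, 'e) mobj \<Rightarrow> bool" where
  "mobj_isomorphic R f g \<longleftrightarrow> (\<exists>\<phi>. mobj_hom R f g \<phi> \<and>
     bij_betw (fst \<phi>) (carrier (src f)) (carrier (src g)) \<and>
     bij_betw (snd \<phi>) (carrier (tgt f)) (carrier (tgt g)))"

definition id_mobj :: "('a, 'b) module \<Rightarrow> ('a, 'b, 'b) mobj" where
  "id_mobj P = \<lparr>src = P, tgt = P, arr = (\<lambda>x. x)\<rparr>"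

definition from_zero_mobj :: "('a, 'b) module \<Rightarrow> ('a, unit, 'b) mobj" where
  "from_zero_mobj P = \<lparr>src = zero_mod, tgt = P, arr = (\<lambda>_. \<zero>\<^bsub>P\<^esub>)\<rparr>"

definition dsum_mobj ::
    "('a, 'b, 'c) mobj \<Rightarrow> ('a, 'd, 'e) mobj \<Rightarrow> ('a, 'b \<times> 'd, 'c \<times> 'e) mobj" where
  "dsum_mobj f g =
     \<lparr>src = dsum_mod (src f) (src g), tgt = dsum_mod (tgt f) (tgt g), arr = map_prod (arr f) (arr g)\<rparr>"

definition projective_mobj :: "('a, 'm) ring_scheme \<Rightarrow> ('a, 'b, 'c) mobj \<Rightarrow> bool" where
  "projective_mobj R p \<longleftrightarrow> is_mobj R p \<and>
     (\<exists>(P :: ('a, nat \<Rightarrow> 'a) module) (Q :: ('a, nat \<Rightarrow> 'a) module).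
        fg_projective R P \<and> fg_projective R Q \<and>
        mobj_isomorphic R p (dsum_mobj (id_mobj P) (from_zero_mobj Q)))"

definition is_sub_mobj ::
    "('a, 'm) ring_scheme \<Rightarrow> ('a, 'b, 'c) mobj \<Rightarrow> 'b set \<Rightarrow> 'c set \<Rightarrow> bool" where
  "is_sub_mobj R f H K \<longleftrightarrow>
     submodule H R (src f) \<and> submodule K R (tgt f) \<and> arr f ` H \<subseteq> K"

definition ker_mobj ::
    "('a, 'b, 'c) mobj \<Rightarrow> ('a, 'd, 'e) mobj \<Rightarrow> ('b \<Rightarrow> 'd) \<times> ('c \<Rightarrow> 'e) \<Rightarrow> ('a, 'b, 'c) mobj" where
  "ker_mobj f g \<phi> =
     \<lparr>src = (src f)\<lparr>carrier := a_kernel (src f) (src g) (fst \<phi>)\<rparr>,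
      tgt = (tgt f)\<lparr>carrier := a_kernel (tgt f) (tgt g) (snd \<phi>)\<rparr>,
      arr = arr f\<rparr>"

definition cok_mobj ::
    "('a, 'b, 'c) mobj \<Rightarrow> ('a, 'd, 'e) mobj \<Rightarrow> ('b \<Rightarrow> 'd) \<times> ('c \<Rightarrow> 'e) \<Rightarrow>
     ('a, 'd set, 'e set) mobj" where
  "cok_mobj f g \<phi> =
     \<lparr>src = cok_mod (src f) (src g) (fst \<phi>),
      tgt = cok_mod (tgt f) (tgt g) (snd \<phi>),
      arr = (\<lambda>X. \<Union>x\<in>X. (snd \<phi> ` carrier (tgt f)) +>\<^bsub>tgt g\<^esub> arr g x)\<rparr>"

text \<open>The last condition says that the kernel of the epimorphism \<open>\<pi>\<close> is superfluous in \<open>p\<close>.\<close>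

definition projective_cover ::
    "('a, 'm) ring_scheme \<Rightarrow> ('a, 'b, 'c) mobj \<Rightarrow> ('a, 'd, 'e) mobj \<Rightarrow>
     ('b \<Rightarrow> 'd) \<times> ('c \<Rightarrow> 'e) \<Rightarrow> bool" where
  "projective_cover R p f \<pi> \<longleftrightarrow> projective_mobj R p \<and> mobj_hom R p f \<pi> \<and>
     fst \<pi> ` carrier (src p) = carrier (src f) \<and> snd \<pi> ` carrier (tgt p) = carrier (tgt f) \<and>
     (\<forall>H K. is_sub_mobj R p H K \<and>
        a_kernel (src p) (src f) (fst \<pi>) <+>\<^bsub>src p\<^esub> H = carrier (src p) \<and>
        a_kernel (tgt p) (tgt f) (snd \<pi>) <+>\<^bsub>tgt p\<^esub> K = carrier (tgt p) \<longrightarrow>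
        H = carrier (src p) \<and> K = carrier (tgt p))"

text \<open>
  Here \<open>\<delta>\<close> is viewed both as an epimorphism from \<open>p1\<close> onto the kernel of \<open>\<pi>\<close> and as a morphism
  from \<open>p1\<close> to \<open>p0\<close>.
\<close>

definition minimal_presentation ::
    "('a, 'm) ring_scheme \<Rightarrow> ('a, 'b, 'c) mobj \<Rightarrow> ('a, 'd, 'e) mobj \<Rightarrow> ('a, 'f, 'g) mobj \<Rightarrow>
     ('b \<Rightarrow> 'd) \<times> ('c \<Rightarrow> 'e) \<Rightarrow> ('d \<Rightarrow> 'f) \<times> ('e \<Rightarrow> 'g) \<Rightarrow> bool" where
  "minimal_presentation R p1 p0 f \<delta> \<pi> \<longleftrightarrow>
     projective_cover R p0 f \<pi> \<and> projective_cover R p1 (ker_mobj p0 f \<pi>) \<delta>"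


section \<open>Duality, transpose and syzygy\<close>

definition Hom_mobj ::
    "('a, 'm) ring_scheme \<Rightarrow> ('a, 'b, 'c) mobj \<Rightarrow> ('a, 'd, 'e) mobj \<Rightarrow>
     ('a, ('b \<Rightarrow> 'd) \<times> ('c \<Rightarrow> 'e)) module" where
  "Hom_mobj R f g = (dsum_mod (Hom_mod R (src f) (src g)) (Hom_mod R (tgt f) (tgt g)))
     \<lparr>carrier := {\<phi> \<in> extensional (carrier (src f)) \<times> extensional (carrier (tgt f)).
                   mobj_hom R f g \<phi>}\<rparr>"

text \<open>
  \<open>star_mobj R f\<close> is the homomorphism from \<open>Hom(f, 0 \<rightarrow> R)\<close> to \<open>Hom(f, R = R)\<close> given by
  composition with the inclusion of \<open>0 \<rightarrow> R\<close> in \<open>R = R\<close>.  Sending \<open>\<phi>\<close> to its second component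
  identifies it with the homomorphism from the dual of the cokernel of \<open>f\<close> to the dual of the
  target of \<open>f\<close>.
\<close>

definition star_mobj ::
    "('a, 'm) ring_scheme \<Rightarrow> ('a, 'b, 'c) mobj \<Rightarrow>
     ('a, ('b \<Rightarrow> unit) \<times> ('c \<Rightarrow> 'a), ('b \<Rightarrow> 'a) \<times> ('c \<Rightarrow> 'a)) mobj" where
  "star_mobj R f =
     \<lparr>src = Hom_mobj R f (from_zero_mobj (ring_mod R)),
      tgt = Hom_mobj R f (id_mobj (ring_mod R)),
      arr = (\<lambda>\<phi>. (compose (carrier (src f)) (\<lambda>_. \<zero>\<^bsub>R\<^esub>) (fst \<phi>),
                  compose (carrier (tgt f)) (\<lambda>x. x) (snd \<phi>)))\<rparr>"

text \<open>
  For a morphism \<open>\<delta>\<close> from \<open>f\<close> to \<open>g\<close>, both components of the induced morphism from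
  \<open>star_mobj R g\<close> to \<open>star_mobj R f\<close> are precomposition with \<open>\<delta>\<close>.
\<close>

definition precomp ::
    "('a, 'b, 'c) mobj \<Rightarrow> ('b \<Rightarrow> 'd) \<times> ('c \<Rightarrow> 'e) \<Rightarrow>
     ('d \<Rightarrow> 'x) \<times> ('e \<Rightarrow> 'y) \<Rightarrow> ('b \<Rightarrow> 'x) \<times> ('c \<Rightarrow> 'y)" where
  "precomp f \<delta> \<phi> =
     (compose (carrier (src f)) (fst \<phi>) (fst \<delta>), compose (carrier (tgt f)) (snd \<phi>) (snd \<delta>))"

text \<open>
  The transpose and the first syzygy are defined only up to isomorphism; a minimal presentation and
  a projective cover are chosen.  As for modules, the type \<open>nat \<Rightarrow> 'a\<close> accommodates an isomorphic
  copy of every projective object.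
\<close>

definition Tr_M ::
    "('a, 'm) ring_scheme \<Rightarrow> ('a, 'b, 'c) mobj \<Rightarrow>
     ('a, (((nat \<Rightarrow> 'a) \<Rightarrow> unit) \<times> ((nat \<Rightarrow> 'a) \<Rightarrow> 'a)) set,
          (((nat \<Rightarrow> 'a) \<Rightarrow> 'a) \<times> ((nat \<Rightarrow> 'a) \<Rightarrow> 'a)) set) mobj" where
  "Tr_M R f =
     (case (SOME (p1, p0 :: ('a, nat \<Rightarrow> 'a, nat \<Rightarrow> 'a) mobj, \<delta>, \<pi>).
              minimal_presentation R p1 p0 f \<delta> \<pi>)
      of (p1, p0, \<delta>, \<pi>) \<Rightarrow>
        cok_mobj (star_mobj R p0) (star_mobj R p1) (precomp p1 \<delta>, precomp p1 \<delta>))"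

definition Omega_M ::
    "('a, 'm) ring_scheme \<Rightarrow> ('a, 'b, 'c) mobj \<Rightarrow> ('a, nat \<Rightarrow> 'a, nat \<Rightarrow> 'a) mobj" where
  "Omega_M R f =
     (case (SOME (p, \<pi>). projective_cover R p f \<pi>) of (p, \<pi>) \<Rightarrow> ker_mobj p f \<pi>)"

definition lambda_M ::
    "('a, 'm) ring_scheme \<Rightarrow> ('a, 'b, 'c) mobj \<Rightarrow> ('a, nat \<Rightarrow> 'a, nat \<Rightarrow> 'a) mobj" where
  "lambda_M R f = Omega_M R (Tr_M R f)"

definition horizontally_linked :: "('a, 'm) ring_scheme \<Rightarrow> ('a, 'b, 'c) mobj \<Rightarrow> bool" where
  "horizontally_linked R f \<longleftrightarrow>
     is_mono_mobj R f \<and> mobj_isomorphic R f (lambda_M R (lambda_M R f))"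

end

(*
  A projective object of the category is the same thing as a monomorphism with a dual basis, and
  by Nakayama's lemma an epimorphism from a projective object p is a projective cover iff the
  elements of the dual basis of p take values in the maximal ideal on its kernel.  Let p1 -> p0 -> f
  be a minimal presentation.  Minimality of the presentation says precisely that the dual p1* is a
  projective cover of Tr f, so \<lambda> f is the image of p0* -> p1*, that is, p0* modulo the functionals
  that factor through f.  Since B is stable these functionals have values in the maximal ideal,
  whence p0* is a projective cover of \<lambda> f.  Applying the description of \<lambda> to \<lambda> f and using
  p0** = p0, one finds that \<lambda> (\<lambda> f) is p0 modulo the elements killed by all functionals on f, which
  is f as soon as B is torsionless.  That holds because A and the cokernel of f embed in projective
  modules and every functional on A extends to B, as Ext^1(Cok f, R) = 0.
*)
theory Submission
  imports Defs
begin

section \<open>Modules, homomorphisms and linear combinations\<close>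

text \<open>The transpose and the syzygy are left to arbitrary choice, so nothing is known about the
  chosen presentation and cover beyond their defining properties. Every description of
  \<open>lambda_M\<close> must be independent of these choices: uniqueness of projective covers
  replaces the chosen cover of the transpose by the dual of \<open>p1\<close>, and afterwards only
  the first cover of f and its kernel occur. Objects have two components, but the target suffices
  for computing. A morphism to R = R is determined by its target component, and a morphism to 0 -> R
  is a functional on the target that kills the image of the source; so elements of duals are
  compared through \<open>snd\<close>, by evaluation at points of the target. The source half of a
  kernel is recovered from the target half because f is injective. A functional on B with a unit
  value would split off a copy of R; this is how stability puts all values of functionals on B into
  the maximal ideal, which is what Nakayama's lemma asks of the dual cover. Gorenstein projectivity
  likewise enters through functionals, as the separation of points of B.\<close>

lemma module_of_axioms:
  fixes R (structure) and M (structure)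
  assumes "cring R"
    and "\<And>x y. x \<in> carrier M \<Longrightarrow> y \<in> carrier M \<Longrightarrow> x \<oplus>\<^bsub>M\<^esub> y \<in> carrier M"
    and "\<zero>\<^bsub>M\<^esub> \<in> carrier M"
    and "\<And>x y z. x \<in> carrier M \<Longrightarrow> y \<in> carrier M \<Longrightarrow> z \<in> carrier M \<Longrightarrow>
           (x \<oplus>\<^bsub>M\<^esub> y) \<oplus>\<^bsub>M\<^esub> z = x \<oplus>\<^bsub>M\<^esub> (y \<oplus>\<^bsub>M\<^esub> z)"
    and "\<And>x y. x \<in> carrier M \<Longrightarrow> y \<in> carrier M \<Longrightarrow> x \<oplus>\<^bsub>M\<^esub> y = y \<oplus>\<^bsub>M\<^esub> x"
    and "\<And>x. x \<in> carrier M \<Longrightarrow> \<zero>\<^bsub>M\<^esub> \<oplus>\<^bsub>M\<^esub> x = x"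
    and "\<And>a x. a \<in> carrier R \<Longrightarrow> x \<in> carrier M \<Longrightarrow> a \<odot>\<^bsub>M\<^esub> x \<in> carrier M"
    and "\<And>x. x \<in> carrier M \<Longrightarrow> \<zero>\<^bsub>R\<^esub> \<odot>\<^bsub>M\<^esub> x = \<zero>\<^bsub>M\<^esub>"
    and "\<And>x. x \<in> carrier M \<Longrightarrow> \<one>\<^bsub>R\<^esub> \<odot>\<^bsub>M\<^esub> x = x"
    and "\<And>a b x. a \<in> carrier R \<Longrightarrow> b \<in> carrier R \<Longrightarrow> x \<in> carrier M \<Longrightarrow>
           (a \<oplus>\<^bsub>R\<^esub> b) \<odot>\<^bsub>M\<^esub> x = a \<odot>\<^bsub>M\<^esub> x \<oplus>\<^bsub>M\<^esub> b \<odot>\<^bsub>M\<^esub> x"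
    and "\<And>a x y. a \<in> carrier R \<Longrightarrow> x \<in> carrier M \<Longrightarrow> y \<in> carrier M \<Longrightarrow>
           a \<odot>\<^bsub>M\<^esub> (x \<oplus>\<^bsub>M\<^esub> y) = a \<odot>\<^bsub>M\<^esub> x \<oplus>\<^bsub>M\<^esub> a \<odot>\<^bsub>M\<^esub> y"
    and "\<And>a b x. a \<in> carrier R \<Longrightarrow> b \<in> carrier R \<Longrightarrow> x \<in> carrier M \<Longrightarrow>
           (a \<otimes>\<^bsub>R\<^esub> b) \<odot>\<^bsub>M\<^esub> x = a \<odot>\<^bsub>M\<^esub> (b \<odot>\<^bsub>M\<^esub> x)"
  shows "module R M"
proof -
  interpret cring R by fact
  \<comment> \<open>The axioms list no negatives; (-1) x serves as one.\<close>
  have "\<exists>y\<in>carrier M. y \<oplus>\<^bsub>M\<^esub> x = \<zero>\<^bsub>M\<^esub>" if x: "x \<in> carrier M" for x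
  proof
    have "(\<ominus>\<^bsub>R\<^esub> \<one>\<^bsub>R\<^esub>) \<odot>\<^bsub>M\<^esub> x \<oplus>\<^bsub>M\<^esub> x = (\<ominus>\<^bsub>R\<^esub> \<one>\<^bsub>R\<^esub> \<oplus>\<^bsub>R\<^esub> \<one>\<^bsub>R\<^esub>) \<odot>\<^bsub>M\<^esub> x"
      by (subst assms(10)) (simp_all add: assms x)
    then show "(\<ominus>\<^bsub>R\<^esub> \<one>\<^bsub>R\<^esub>) \<odot>\<^bsub>M\<^esub> x \<oplus>\<^bsub>M\<^esub> x = \<zero>\<^bsub>M\<^esub>"
      by (simp add: l_neg assms x)
  qed (simp add: assms x)
  then have "abelian_group M"
    using assms(2-6) by (intro abelian_groupI) metis+
  then show ?thesis
    by (intro moduleI) (simp_all add: assms)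
qed

lemma mod_homI:
  assumes "\<And>x. x \<in> carrier M \<Longrightarrow> h x \<in> carrier N"
    and "\<And>x y. x \<in> carrier M \<Longrightarrow> y \<in> carrier M \<Longrightarrow> h (x \<oplus>\<^bsub>M\<^esub> y) = h x \<oplus>\<^bsub>N\<^esub> h y"
    and "\<And>r x. r \<in> carrier R \<Longrightarrow> x \<in> carrier M \<Longrightarrow> h (r \<odot>\<^bsub>M\<^esub> x) = r \<odot>\<^bsub>N\<^esub> h x"
  shows "mod_hom R M N h"
  using assms by (auto simp: mod_hom_def hom_def)

lemma mod_hom_closed: "mod_hom R M N h \<Longrightarrow> x \<in> carrier M \<Longrightarrow> h x \<in> carrier N"
  by (auto simp: mod_hom_def hom_def)

lemma mod_hom_add:
  "mod_hom R M N h \<Longrightarrow> x \<in> carrier M \<Longrightarrow> y \<in> carrier M \<Longrightarrow> h (x \<oplus>\<^bsub>M\<^esub> y) = h x \<oplus>\<^bsub>N\<^esub> h y"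
  by (auto simp: mod_hom_def hom_def)

lemma mod_hom_smult:
  "mod_hom R M N h \<Longrightarrow> r \<in> carrier R \<Longrightarrow> x \<in> carrier M \<Longrightarrow> h (r \<odot>\<^bsub>M\<^esub> x) = r \<odot>\<^bsub>N\<^esub> h x"
  by (auto simp: mod_hom_def)

lemma mod_hom_zero:
  assumes "module R M" "module R N" "mod_hom R M N h"
  shows "h \<zero>\<^bsub>M\<^esub> = \<zero>\<^bsub>N\<^esub>"
proof -
  interpret M: module R M by fact
  interpret N: module R N by fact
  have "h (\<zero>\<^bsub>R\<^esub> \<odot>\<^bsub>M\<^esub> \<zero>\<^bsub>M\<^esub>) = \<zero>\<^bsub>R\<^esub> \<odot>\<^bsub>N\<^esub> h \<zero>\<^bsub>M\<^esub>"
    by (rule mod_hom_smult[OF assms(3)]) simp_all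
  then show ?thesis
    using mod_hom_closed[OF assms(3)] by simp
qed

lemma mod_hom_minus:
  assumes "module R M" "module R N" "mod_hom R M N h" "x \<in> carrier M"
  shows "h (\<ominus>\<^bsub>M\<^esub> x) = \<ominus>\<^bsub>N\<^esub> h x"
proof -
  interpret M: module R M by fact
  interpret N: module R N by fact
  have "h (\<ominus>\<^bsub>M\<^esub> x) \<oplus>\<^bsub>N\<^esub> h x = \<zero>\<^bsub>N\<^esub>"
    using assms(4) mod_hom_zero[OF assms(1-3)]
    by (simp add: mod_hom_add[OF assms(3), symmetric] M.M.l_neg)
  then show ?thesis
    using assms(4) mod_hom_closed[OF assms(3)] by (simp add: N.M.minus_equality)
qed

lemma mod_hom_diff:
  assumes "module R M" "module R N" "mod_hom R M N h" "x \<in> carrier M" "y \<in> carrier M"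
  shows "h (x \<ominus>\<^bsub>M\<^esub> y) = h x \<ominus>\<^bsub>N\<^esub> h y"
proof -
  interpret M: module R M by fact
  interpret N: module R N by fact
  show ?thesis
    using assms by (simp add: a_minus_def mod_hom_add mod_hom_minus)
qed

lemma mod_hom_comp:
  "mod_hom R L M g \<Longrightarrow> mod_hom R M N h \<Longrightarrow> mod_hom R L N (\<lambda>x. h (g x))"
  by (intro mod_homI) (simp_all add: mod_hom_closed mod_hom_add mod_hom_smult)

lemma mod_hom_id: "mod_hom R M M (\<lambda>x. x)"
  by (intro mod_homI) simp_all

lemma mod_hom_cong:
  assumes "module R M" "mod_hom R M N h" "\<And>x. x \<in> carrier M \<Longrightarrow> h x = g x"
  shows "mod_hom R M N g"
proof -
  interpret M: module R M by fact
  show ?thesis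
  proof (intro mod_homI)
    fix x assume x: "x \<in> carrier M"
    show "g x \<in> carrier N"
      using assms(3)[OF x] mod_hom_closed[OF assms(2) x] by simp
    fix y assume y: "y \<in> carrier M"
    show "g (x \<oplus>\<^bsub>M\<^esub> y) = g x \<oplus>\<^bsub>N\<^esub> g y"
      using mod_hom_add[OF assms(2) x y] assms(3) x y by simp
  next
    fix r x assume "r \<in> carrier R" "x \<in> carrier M"
    then show "g (r \<odot>\<^bsub>M\<^esub> x) = r \<odot>\<^bsub>N\<^esub> g x"
      using mod_hom_smult[OF assms(2)] assms(3) by (metis M.smult_closed)
  qed
qed

lemma mod_hom_inv:
  assumes "module R M" "mod_hom R M N h" "bij_betw h (carrier M) (carrier N)"
  shows "mod_hom R N M (the_inv_into (carrier M) h)"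
proof -
  interpret M: module R M by fact
  have inj: "inj_on h (carrier M)" and im: "h ` carrier M = carrier N"
    using assms(3) by (auto simp: bij_betw_def)
  have *: "the_inv_into (carrier M) h (h x) = x" if "x \<in> carrier M" for x
    using the_inv_into_f_f[OF inj that] .
  show ?thesis
  proof (intro mod_homI)
    fix y assume "y \<in> carrier N"
    then obtain x where x: "x \<in> carrier M" "y = h x"
      using im by blast
    then show "the_inv_into (carrier M) h y \<in> carrier M"
      by (simp add: *)
    fix y' assume "y' \<in> carrier N"
    then obtain x' where x': "x' \<in> carrier M" "y' = h x'"
      using im by blast
    show "the_inv_into (carrier M) h (y \<oplus>\<^bsub>N\<^esub> y') =
        the_inv_into (carrier M) h y \<oplus>\<^bsub>M\<^esub> the_inv_into (carrier M) h y'"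
      using x x' by (simp add: mod_hom_add[OF assms(2), symmetric] *)
  next
    fix r y assume r: "r \<in> carrier R" and "y \<in> carrier N"
    then obtain x where x: "x \<in> carrier M" "y = h x"
      using im by blast
    show "the_inv_into (carrier M) h (r \<odot>\<^bsub>N\<^esub> y) = r \<odot>\<^bsub>M\<^esub> the_inv_into (carrier M) h y"
      using x r by (simp add: mod_hom_smult[OF assms(2), symmetric] *)
  qed
qed

lemma diff_eq_zeroD:
  assumes "module R M" "x \<in> carrier M" "y \<in> carrier M" "x \<ominus>\<^bsub>M\<^esub> y = \<zero>\<^bsub>M\<^esub>"
  shows "x = y"
proof -
  interpret M: module R M by fact
  have "x = (x \<oplus>\<^bsub>M\<^esub> \<ominus>\<^bsub>M\<^esub> y) \<oplus>\<^bsub>M\<^esub> y"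
    using assms(2,3) by (simp add: M.M.a_assoc M.M.l_neg)
  also have "\<dots> = y"
    using assms(3,4) by (simp add: a_minus_def)
  finally show ?thesis .
qed

lemma diff_add_cancel:
  assumes "module R M" "x \<in> carrier M" "y \<in> carrier M"
  shows "y \<oplus>\<^bsub>M\<^esub> (x \<ominus>\<^bsub>M\<^esub> y) = x"
proof -
  interpret M: module R M by fact
  have "y \<oplus>\<^bsub>M\<^esub> (x \<oplus>\<^bsub>M\<^esub> \<ominus>\<^bsub>M\<^esub> y) = x \<oplus>\<^bsub>M\<^esub> (y \<oplus>\<^bsub>M\<^esub> \<ominus>\<^bsub>M\<^esub> y)"
    using assms(2,3) by (intro M.M.a_lcomm) auto
  also have "\<dots> = x"
    using assms(2,3) by (simp add: M.M.r_neg)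
  finally show ?thesis
    by (simp add: a_minus_def)
qed

lemma diff_self:
  assumes "module R M" "x \<in> carrier M"
  shows "x \<ominus>\<^bsub>M\<^esub> x = \<zero>\<^bsub>M\<^esub>"
proof -
  interpret M: module R M by fact
  show ?thesis
    using assms(2) by (simp add: a_minus_def M.M.r_neg)
qed

section \<open>Kernels, images, sums and supplements of submodules\<close>

lemma mem_a_kernel: "x \<in> a_kernel M N h \<longleftrightarrow> x \<in> carrier M \<and> h x = \<zero>\<^bsub>N\<^esub>"
  by (simp add: a_kernel_def')

lemma submodule_kernel:
  assumes "module R M" "module R N" "mod_hom R M N h"
  shows "submodule (a_kernel M N h) R M"
proof -
  interpret M: module R M by fact
  interpret N: module R N by fact
  show ?thesis
    using mod_hom_zero[OF assms] mod_hom_minus[OF assms] mod_hom_add[OF assms(3)]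
      mod_hom_smult[OF assms(3)]
    by (intro M.submoduleI) (auto simp: mem_a_kernel)
qed

lemma submodule_image:
  assumes "module R M" "module R N" "mod_hom R M N h"
  shows "submodule (h ` carrier M) R N"
proof -
  interpret M: module R M by fact
  interpret N: module R N by fact
  show ?thesis
  proof (intro N.submoduleI)
    show "h ` carrier M \<subseteq> carrier N"
      using mod_hom_closed[OF assms(3)] by auto
    show "\<zero>\<^bsub>N\<^esub> \<in> h ` carrier M"
      using mod_hom_zero[OF assms] by (metis M.M.zero_closed imageI)
    show "\<ominus>\<^bsub>N\<^esub> a \<in> h ` carrier M" if "a \<in> h ` carrier M" for a
      using that mod_hom_minus[OF assms] by (metis (no_types, lifting) M.M.a_inv_closed image_iff)
    show "a \<oplus>\<^bsub>N\<^esub> b \<in> h ` carrier M" if "a \<in> h ` carrier M" "b \<in> h ` carrier M" for a b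
      using that mod_hom_add[OF assms(3)] by (metis (no_types, lifting) M.M.a_closed image_iff)
    show "a \<odot>\<^bsub>N\<^esub> x \<in> h ` carrier M" if "a \<in> carrier R" "x \<in> h ` carrier M" for a x
      using that mod_hom_smult[OF assms(3)]
      by (metis (no_types, lifting) M.smult_closed image_iff)
  qed
qed

lemma submodule_subset: "submodule H R M \<Longrightarrow> H \<subseteq> carrier M"
  using submodule.axioms(1)[of H R M] subgroup.subset[of H "add_monoid M"] by auto

lemma submodule_zero: "submodule H R M \<Longrightarrow> \<zero>\<^bsub>M\<^esub> \<in> H"
  using submodule.axioms(1)[of H R M] subgroup.one_closed[of H "add_monoid M"] by auto

lemma submodule_add: "submodule H R M \<Longrightarrow> x \<in> H \<Longrightarrow> y \<in> H \<Longrightarrow> x \<oplus>\<^bsub>M\<^esub> y \<in> H"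
  using submodule.axioms(1)[of H R M] subgroup.m_closed[of H "add_monoid M"] by auto

lemma submodule_smult: "submodule H R M \<Longrightarrow> r \<in> carrier R \<Longrightarrow> x \<in> H \<Longrightarrow> r \<odot>\<^bsub>M\<^esub> x \<in> H"
  using submodule.smult_closed by metis

lemma submodule_diff:
  assumes "module R M" "submodule H R M" "x \<in> H" "y \<in> H"
  shows "x \<ominus>\<^bsub>M\<^esub> y \<in> H"
  using module.submoduleE(3,5)[OF assms(1,2)] assms(3,4) by (simp add: a_minus_def)

lemma module_restrict: "module R M \<Longrightarrow> submodule H R M \<Longrightarrow> module R (M\<lparr>carrier := H\<rparr>)"
  by (rule submodule.submodule_is_module)

lemma mem_set_add: "x \<in> H <+>\<^bsub>M\<^esub> K \<longleftrightarrow> (\<exists>h\<in>H. \<exists>k\<in>K. x = h \<oplus>\<^bsub>M\<^esub> k)"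
  by (auto simp: set_add_def')

text \<open>Negation is multiplication by -1, so closure under scalars covers it.\<close>

lemma submodule_criterion:
  assumes "module R M" "H \<subseteq> carrier M" "\<zero>\<^bsub>M\<^esub> \<in> H"
    and "\<And>x y. x \<in> H \<Longrightarrow> y \<in> H \<Longrightarrow> x \<oplus>\<^bsub>M\<^esub> y \<in> H"
    and "\<And>r x. r \<in> carrier R \<Longrightarrow> x \<in> H \<Longrightarrow> r \<odot>\<^bsub>M\<^esub> x \<in> H"
  shows "submodule H R M"
proof -
  interpret M: module R M by fact
  have "\<ominus>\<^bsub>M\<^esub> x \<in> H" if "x \<in> H" for x
  proof -
    have x: "x \<in> carrier M"
      using that assms(2) by blast
    have "\<ominus>\<^bsub>M\<^esub> x = (\<ominus>\<^bsub>R\<^esub> \<one>\<^bsub>R\<^esub>) \<odot>\<^bsub>M\<^esub> x"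
      using M.smult_l_minus[OF M.R.one_closed x] x by simp
    then show ?thesis
      using assms(5)[OF _ that] by simp
  qed
  then show ?thesis
    using assms(2-5) by (intro M.submoduleI) auto
qed

lemma submodule_singleton_zero: "module R M \<Longrightarrow> submodule {\<zero>\<^bsub>M\<^esub>} R M"
proof -
  assume "module R M"
  then interpret M: module R M .
  show ?thesis
    by (rule M.submoduleI) auto
qed

lemma submodule_set_add:
  assumes "module R M" "submodule H R M" "submodule K R M"
  shows "submodule (H <+>\<^bsub>M\<^esub> K) R M"
proof -
  interpret M: module R M by fact
  have Hc: "h \<in> carrier M" if "h \<in> H" for h
    using submodule_subset[OF assms(2)] that by blast
  have Kc: "h \<in> carrier M" if "h \<in> K" for h
    using submodule_subset[OF assms(3)] that by blast
  note mI = M.submoduleE[OF assms(2)] and mJ = M.submoduleE[OF assms(3)]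
  show ?thesis
  proof (rule M.submoduleI)
    show "H <+>\<^bsub>M\<^esub> K \<subseteq> carrier M"
      using Hc Kc by (auto simp: mem_set_add)
    show "\<zero>\<^bsub>M\<^esub> \<in> H <+>\<^bsub>M\<^esub> K"
      unfolding mem_set_add using submodule_zero[OF assms(2)] submodule_zero[OF assms(3)]
      by (metis M.M.l_zero M.M.zero_closed)
    show "\<ominus>\<^bsub>M\<^esub> a \<in> H <+>\<^bsub>M\<^esub> K" if a: "a \<in> H <+>\<^bsub>M\<^esub> K" for a
    proof -
      obtain h k where "h \<in> H" "k \<in> K" "a = h \<oplus>\<^bsub>M\<^esub> k"
        using a by (auto simp: mem_set_add)
      then show ?thesis
        unfolding mem_set_add using mI(3) mJ(3) Hc Kc
        by (intro bexI[of _ "\<ominus>\<^bsub>M\<^esub> h"] bexI[of _ "\<ominus>\<^bsub>M\<^esub> k"]) (simp_all add: M.M.minus_add)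
    qed
    show "a \<oplus>\<^bsub>M\<^esub> b \<in> H <+>\<^bsub>M\<^esub> K" if a: "a \<in> H <+>\<^bsub>M\<^esub> K" and b: "b \<in> H <+>\<^bsub>M\<^esub> K" for a b
    proof -
      obtain h k where hk: "h \<in> H" "k \<in> K" "a = h \<oplus>\<^bsub>M\<^esub> k"
        using a by (auto simp: mem_set_add)
      obtain h' k' where hk': "h' \<in> H" "k' \<in> K" "b = h' \<oplus>\<^bsub>M\<^esub> k'"
        using b by (auto simp: mem_set_add)
      have "a \<oplus>\<^bsub>M\<^esub> b = (h \<oplus>\<^bsub>M\<^esub> h') \<oplus>\<^bsub>M\<^esub> (k \<oplus>\<^bsub>M\<^esub> k')"
        using hk hk' Hc Kc by (simp add: M.M.a_ac)
      then show ?thesis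
        unfolding mem_set_add using mI(5)[OF hk(1) hk'(1)] mJ(5)[OF hk(2) hk'(2)] by blast
    qed
    show "r \<odot>\<^bsub>M\<^esub> a \<in> H <+>\<^bsub>M\<^esub> K" if r: "r \<in> carrier R" and a: "a \<in> H <+>\<^bsub>M\<^esub> K" for r a
    proof -
      obtain h k where hk: "h \<in> H" "k \<in> K" "a = h \<oplus>\<^bsub>M\<^esub> k"
        using a by (auto simp: mem_set_add)
      then have "r \<odot>\<^bsub>M\<^esub> a = r \<odot>\<^bsub>M\<^esub> h \<oplus>\<^bsub>M\<^esub> r \<odot>\<^bsub>M\<^esub> k"
        using r Hc Kc by (simp add: M.smult_r_distr)
      then show ?thesis
        unfolding mem_set_add using mI(4)[OF r hk(1)] mJ(4)[OF r hk(2)] by blast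
    qed
  qed
qed

lemma set_add_carrier:
  assumes "module R M" "submodule N R M"
  shows "N <+>\<^bsub>M\<^esub> carrier M = carrier M"
proof -
  interpret M: module R M by fact
  show ?thesis
  proof (intro subset_antisym subsetI)
    fix x assume "x \<in> N <+>\<^bsub>M\<^esub> carrier M"
    then show "x \<in> carrier M"
      using submodule_subset[OF assms(2)] by (auto simp: mem_set_add)
  next
    fix x assume x: "x \<in> carrier M"
    then show "x \<in> N <+>\<^bsub>M\<^esub> carrier M"
      unfolding mem_set_add using submodule_zero[OF assms(2)] M.M.l_zero by metis
  qed
qed

text \<open>If \<open>u z\<close> and \<open>x\<close> have the same image under \<open>h\<close>,
  they differ by a kernel element. A map that reaches all values of \<open>h\<close> thus yields a
  supplement of its kernel, the situation in which superfluity of the kernel can be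
  exploited.\<close>

lemma kernel_plus_image:
  assumes "module R L" "module R M" "module R N" "mod_hom R M N h" "mod_hom R L M u"
    and "\<And>x. x \<in> carrier M \<Longrightarrow> \<exists>z\<in>carrier L. h (u z) = h x"
  shows "a_kernel M N h <+>\<^bsub>M\<^esub> u ` carrier L = carrier M"
proof -
  interpret M: module R M by fact
  show ?thesis
  proof (intro subset_antisym subsetI)
    fix x assume "x \<in> a_kernel M N h <+>\<^bsub>M\<^esub> u ` carrier L"
    then show "x \<in> carrier M"
      using mod_hom_closed[OF assms(5)] by (auto simp: mem_set_add mem_a_kernel)
  next
    fix x assume x: "x \<in> carrier M"
    then obtain z where z: "z \<in> carrier L" "h (u z) = h x"
      using assms(6) by blast
    have uz: "u z \<in> carrier M"
      by (rule mod_hom_closed[OF assms(5) z(1)])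
    have "h (x \<ominus>\<^bsub>M\<^esub> u z) = \<zero>\<^bsub>N\<^esub>"
      using mod_hom_diff[OF assms(2-4) x uz] diff_self[OF assms(3) mod_hom_closed[OF assms(4) x]]
      by (simp add: z(2))
    then have "x \<ominus>\<^bsub>M\<^esub> u z \<in> a_kernel M N h"
      using x uz by (simp add: mem_a_kernel)
    moreover have "x = (x \<ominus>\<^bsub>M\<^esub> u z) \<oplus>\<^bsub>M\<^esub> u z"
      using diff_add_cancel[OF assms(2) x uz] x uz by (simp add: M.M.a_comm)
    ultimately show "x \<in> a_kernel M N h <+>\<^bsub>M\<^esub> u ` carrier L"
      unfolding mem_set_add using z(1) by blast
  qed
qed

section \<open>Finite linear combinations\<close>

text \<open>Families are functions on the naturals of which only the values below \<open>n\<close>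
  count. This permits induction on \<open>n\<close> and concatenation of families without an index
  type.\<close>

definition lincomb ::
    "('a, 'b) module \<Rightarrow> nat \<Rightarrow> (nat \<Rightarrow> 'a) \<Rightarrow> (nat \<Rightarrow> 'b) \<Rightarrow> 'b" where
  "lincomb M n r e = (\<Oplus>\<^bsub>M\<^esub>i\<in>{..<n}. r i \<odot>\<^bsub>M\<^esub> e i)"

abbreviation coeffs :: "('a, 'm) ring_scheme \<Rightarrow> nat \<Rightarrow> (nat \<Rightarrow> 'a) set" where
  "coeffs R n \<equiv> {..<n} \<rightarrow> carrier R"

abbreviation family :: "('a, 'b) module \<Rightarrow> nat \<Rightarrow> (nat \<Rightarrow> 'b) set" where
  "family M n \<equiv> {..<n} \<rightarrow> carrier M"

lemma lincomb_0: "module R M \<Longrightarrow> lincomb M 0 r e = \<zero>\<^bsub>M\<^esub>"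
proof -
  assume "module R M"
  then interpret M: module R M .
  show ?thesis by (simp add: lincomb_def)
qed

lemma lincomb_Suc:
  assumes "module R M" "r \<in> coeffs R (Suc n)" "e \<in> family M (Suc n)"
  shows "lincomb M (Suc n) r e = r n \<odot>\<^bsub>M\<^esub> e n \<oplus>\<^bsub>M\<^esub> lincomb M n r e"
proof -
  interpret M: module R M by fact
  have "(\<Oplus>\<^bsub>M\<^esub>i\<in>insert n {..<n}. r i \<odot>\<^bsub>M\<^esub> e i) =
      r n \<odot>\<^bsub>M\<^esub> e n \<oplus>\<^bsub>M\<^esub> (\<Oplus>\<^bsub>M\<^esub>i\<in>{..<n}. r i \<odot>\<^bsub>M\<^esub> e i)"
    using assms(2,3) by (intro M.M.finsum_insert) (auto simp: Pi_iff)
  then show ?thesis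
    by (simp add: lincomb_def lessThan_Suc)
qed

lemma lincomb_closed:
  assumes "module R M" "r \<in> coeffs R n" "e \<in> family M n"
  shows "lincomb M n r e \<in> carrier M"
proof -
  interpret M: module R M by fact
  show ?thesis
    using assms(2,3) unfolding lincomb_def by (intro M.M.finsum_closed) (auto simp: Pi_iff)
qed

lemma lincomb_cong:
  assumes "module R M" "r \<in> coeffs R n" "e \<in> family M n"
    and "\<And>i. i < n \<Longrightarrow> r i = r' i" "\<And>i. i < n \<Longrightarrow> e i = e' i"
  shows "lincomb M n r e = lincomb M n r' e'"
proof -
  interpret M: module R M by fact
  show ?thesis
    unfolding lincomb_def
    by (intro M.M.finsum_cong') (use assms(2-5) in \<open>auto simp: Pi_iff\<close>)
qed

lemma coeffs_SucD: "r \<in> {..<Suc n} \<rightarrow> X \<Longrightarrow> r \<in> {..<n} \<rightarrow> X"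
  by (auto simp: Pi_iff)

lemma lincomb_hom:
  assumes "module R M" "module R N" "mod_hom R M N h" "r \<in> coeffs R n" "e \<in> family M n"
  shows "h (lincomb M n r e) = lincomb N n r (\<lambda>i. h (e i))"
  using assms(4,5)
proof (induction n)
  case 0
  show ?case
    using mod_hom_zero[OF assms(1-3)] by (simp add: lincomb_0[OF assms(1)] lincomb_0[OF assms(2)])
next
  case (Suc n)
  interpret M: module R M by fact
  have "r n \<in> carrier R" "e n \<in> carrier M"
    using Suc.prems by auto
  moreover have "(\<lambda>i. h (e i)) \<in> family N (Suc n)"
    using Suc.prems mod_hom_closed[OF assms(3)] by auto
  ultimately show ?case
    using Suc.IH[OF Suc.prems[THEN coeffs_SucD]] lincomb_closed[OF assms(1) Suc.prems[THEN coeffs_SucD]]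
      Suc.prems
    by (simp add: lincomb_Suc[OF assms(1)] lincomb_Suc[OF assms(2)] mod_hom_add[OF assms(3)]
        mod_hom_smult[OF assms(3)])
qed

lemma lincomb_add:
  assumes "module R M" "r \<in> coeffs R n" "s \<in> coeffs R n" "e \<in> family M n"
  shows "lincomb M n (\<lambda>i. r i \<oplus>\<^bsub>R\<^esub> s i) e = lincomb M n r e \<oplus>\<^bsub>M\<^esub> lincomb M n s e"
proof -
  interpret M: module R M by fact
  have "lincomb M n (\<lambda>i. r i \<oplus>\<^bsub>R\<^esub> s i) e =
      (\<Oplus>\<^bsub>M\<^esub>i\<in>{..<n}. r i \<odot>\<^bsub>M\<^esub> e i \<oplus>\<^bsub>M\<^esub> s i \<odot>\<^bsub>M\<^esub> e i)"
    unfolding lincomb_def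
    by (intro M.M.finsum_cong') (use assms(2-4) in \<open>auto simp: Pi_iff M.smult_l_distr\<close>)
  also have "\<dots> = lincomb M n r e \<oplus>\<^bsub>M\<^esub> lincomb M n s e"
    unfolding lincomb_def
    by (intro M.M.finsum_addf) (use assms(2-4) in \<open>auto simp: Pi_iff\<close>)
  finally show ?thesis .
qed

lemma lincomb_smult:
  assumes "module R M" "t \<in> carrier R" "r \<in> coeffs R n" "e \<in> family M n"
  shows "lincomb M n (\<lambda>i. t \<otimes>\<^bsub>R\<^esub> r i) e = t \<odot>\<^bsub>M\<^esub> lincomb M n r e"
proof -
  interpret M: module R M by fact
  have "t \<odot>\<^bsub>M\<^esub> lincomb M n r e = (\<Oplus>\<^bsub>M\<^esub>i\<in>{..<n}. t \<odot>\<^bsub>M\<^esub> (r i \<odot>\<^bsub>M\<^esub> e i))"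
    unfolding lincomb_def
    by (intro M.finsum_smult_ldistr) (use assms(2-4) in \<open>auto simp: Pi_iff\<close>)
  also have "\<dots> = lincomb M n (\<lambda>i. t \<otimes>\<^bsub>R\<^esub> r i) e"
    unfolding lincomb_def
    by (intro M.M.finsum_cong') (use assms(2-4) in \<open>auto simp: Pi_iff M.smult_assoc1\<close>)
  finally show ?thesis ..
qed

lemma lincomb_zero:
  assumes "module R M" "e \<in> family M n"
  shows "lincomb M n (\<lambda>i. \<zero>\<^bsub>R\<^esub>) e = \<zero>\<^bsub>M\<^esub>"
proof -
  interpret M: module R M by fact
  show ?thesis
    using lincomb_smult[OF assms(1) M.R.zero_closed _ assms(2), of "\<lambda>i. \<zero>\<^bsub>R\<^esub>"]
      lincomb_closed[OF assms(1) _ assms(2), of "\<lambda>i. \<zero>\<^bsub>R\<^esub>"]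
    by simp
qed

lemma lincomb_single:
  assumes "module R M" "e \<in> family M n" "k < n" "c \<in> carrier R"
  shows "lincomb M n (\<lambda>i. if i = k then c else \<zero>\<^bsub>R\<^esub>) e = c \<odot>\<^bsub>M\<^esub> e k"
  using assms(2,3)
proof (induction n)
  case (Suc n)
  interpret M: module R M by fact
  have r: "(\<lambda>i. if i = k then c else \<zero>\<^bsub>R\<^esub>) \<in> coeffs R (Suc n)"
    using assms(4) by auto
  have en: "e n \<in> carrier M"
    using Suc.prems by auto
  show ?case
  proof (cases "k = n")
    case True
    have "lincomb M n (\<lambda>i. if i = k then c else \<zero>\<^bsub>R\<^esub>) e = lincomb M n (\<lambda>i. \<zero>\<^bsub>R\<^esub>) e"
      by (intro lincomb_cong[OF assms(1)]) (use True Suc.prems r in \<open>auto dest: coeffs_SucD\<close>)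
    then show ?thesis
      unfolding lincomb_Suc[OF assms(1) r Suc.prems(1)]
      using True en assms(4) lincomb_zero[OF assms(1) Suc.prems(1)[THEN coeffs_SucD]] by simp
  next
    case False
    moreover have "e k \<in> carrier M"
      using Suc.prems by auto
    ultimately show ?thesis
      using en assms(4) Suc.IH[OF Suc.prems(1)[THEN coeffs_SucD]] Suc.prems(2)
      by (simp add: lincomb_Suc[OF assms(1) r Suc.prems(1)])
  qed
qed simp

lemma lincomb_in_submodule:
  assumes "module R M" "submodule H R M" "r \<in> coeffs R n" "e \<in> {..<n} \<rightarrow> H"
  shows "lincomb M n r e \<in> H"
  using assms(3,4)
proof (induction n)
  case 0
  then show ?case
    using lincomb_0[OF assms(1), of r e] submodule_zero[OF assms(2)] by simp
next
  case (Suc n)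
  have "e \<in> family M (Suc n)"
    using Suc.prems submodule_subset[OF assms(2)] by auto
  moreover have "r n \<in> carrier R" "e n \<in> H"
    using Suc.prems by auto
  ultimately show ?case
    using Suc.IH[OF Suc.prems[THEN coeffs_SucD]] Suc.prems(1)
    by (simp add: lincomb_Suc[OF assms(1)] submodule_add[OF assms(2)] submodule_smult[OF assms(2)])
qed

lemma mod_hom_incl:
  assumes "submodule H R M"
  shows "mod_hom R (M\<lparr>carrier := H\<rparr>) M (\<lambda>x. x)"
  using submodule_subset[OF assms] by (intro mod_homI) auto

lemma lincomb_restrict:
  assumes "module R M" "submodule H R M" "r \<in> coeffs R n" "e \<in> {..<n} \<rightarrow> H"
  shows "lincomb (M\<lparr>carrier := H\<rparr>) n r e = lincomb M n r e"
  using lincomb_hom[OF module_restrict[OF assms(1,2)] assms(1) mod_hom_incl[OF assms(2)], of r n e]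
    assms(3,4) by simp

text \<open>Merges the families belonging to R = R and to 0 -> R into one family for the target of
  an object.\<close>

lemma lincomb_append:
  assumes "module R M" "r \<in> coeffs R n" "e \<in> family M n" "s \<in> coeffs R m" "d \<in> family M m"
  shows "lincomb M (n + m) (\<lambda>i. if i < n then r i else s (i - n))
           (\<lambda>i. if i < n then e i else d (i - n)) = lincomb M n r e \<oplus>\<^bsub>M\<^esub> lincomb M m s d"
  using assms(4,5)
proof (induction m)
  case 0
  interpret M: module R M by fact
  have "lincomb M n (\<lambda>i. if i < n then r i else s (i - n)) (\<lambda>i. if i < n then e i else d (i - n)) =
      lincomb M n r e"
    using assms(2,3) by (intro lincomb_cong[OF assms(1)]) auto
  then show ?case
    using lincomb_closed[OF assms(1-3)] by (simp add: lincomb_0[OF assms(1)])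
next
  case (Suc m)
  interpret M: module R M by fact
  let ?r = "\<lambda>i. if i < n then r i else s (i - n)" and ?e = "\<lambda>i. if i < n then e i else d (i - n)"
  have c: "?r \<in> coeffs R (Suc (n + m))" "?e \<in> family M (Suc (n + m))"
    using Suc.prems assms(2,3) by (auto simp: Pi_iff)
  have m: "s m \<in> carrier R" "d m \<in> carrier M"
    using Suc.prems by auto
  note IH = Suc.IH[OF Suc.prems[THEN coeffs_SucD]]
  have "lincomb M (n + Suc m) ?r ?e = s m \<odot>\<^bsub>M\<^esub> d m \<oplus>\<^bsub>M\<^esub> (lincomb M n r e \<oplus>\<^bsub>M\<^esub> lincomb M m s d)"
    unfolding add_Suc_right lincomb_Suc[OF assms(1) c] IH by simp
  also have "\<dots> = lincomb M n r e \<oplus>\<^bsub>M\<^esub> lincomb M (Suc m) s d"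
    using lincomb_closed[OF assms(1-3)] lincomb_closed[OF assms(1) Suc.prems[THEN coeffs_SucD]] m
    unfolding lincomb_Suc[OF assms(1) Suc.prems] by (simp add: M.M.a_ac)
  finally show ?case .
qed


section \<open>Functionals\<close>

lemma ring_mod_simps [simp]:
  "carrier (ring_mod R) = carrier R" "\<zero>\<^bsub>ring_mod R\<^esub> = \<zero>\<^bsub>R\<^esub>"
  "x \<oplus>\<^bsub>ring_mod R\<^esub> y = x \<oplus>\<^bsub>R\<^esub> y" "x \<odot>\<^bsub>ring_mod R\<^esub> y = x \<otimes>\<^bsub>R\<^esub> y"
  by (simp_all add: ring_mod_def)

lemma module_ring_mod:
  assumes "cring R" shows "module R (ring_mod R)"
proof -
  interpret cring R by fact
  show ?thesis
    by (rule module_of_axioms[OF assms]) (simp_all add: a_ac m_ac l_distr r_distr)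
qed

abbreviation functional :: "('a, 'm) ring_scheme \<Rightarrow> ('a, 'b) module \<Rightarrow> ('b \<Rightarrow> 'a) \<Rightarrow> bool" where
  "functional R M \<equiv> mod_hom R M (ring_mod R)"

lemma functional_closed: "functional R M h \<Longrightarrow> x \<in> carrier M \<Longrightarrow> h x \<in> carrier R"
  using mod_hom_closed[of R M "ring_mod R" h x] by simp

text \<open>Many later homomorphisms have this form: functionals read off coordinates, which are
  assembled against a chosen family. Retractions, lifts of projectives and covers are
  instances.\<close>

lemma mod_hom_lincomb:
  assumes "module R N" "\<And>i. i < n \<Longrightarrow> functional R M (\<phi> i)" "e \<in> family N n"
  shows "mod_hom R M N (\<lambda>x. lincomb N n (\<lambda>i. \<phi> i x) e)"
proof -
  have c: "(\<lambda>i. \<phi> i x) \<in> coeffs R n" if "x \<in> carrier M" for x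
    using assms(2) functional_closed that by fastforce
  interpret N: module R N by fact
  show ?thesis
  proof (intro mod_homI)
    fix x assume x: "x \<in> carrier M"
    show "lincomb N n (\<lambda>i. \<phi> i x) e \<in> carrier N"
      by (rule lincomb_closed[OF assms(1) c[OF x] assms(3)])
    fix y assume y: "y \<in> carrier M"
    have "lincomb N n (\<lambda>i. \<phi> i x \<oplus>\<^bsub>R\<^esub> \<phi> i y) e = lincomb N n (\<lambda>i. \<phi> i (x \<oplus>\<^bsub>M\<^esub> y)) e"
      using c[OF x] c[OF y] mod_hom_add[OF assms(2) x y]
      by (intro lincomb_cong[OF assms(1) _ assms(3)]) auto
    then show "lincomb N n (\<lambda>i. \<phi> i (x \<oplus>\<^bsub>M\<^esub> y)) e =
      lincomb N n (\<lambda>i. \<phi> i x) e \<oplus>\<^bsub>N\<^esub> lincomb N n (\<lambda>i. \<phi> i y) e"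
      using lincomb_add[OF assms(1) c[OF x] c[OF y] assms(3)] by simp
  next
    fix r x assume r: "r \<in> carrier R" and x: "x \<in> carrier M"
    have "lincomb N n (\<lambda>i. r \<otimes>\<^bsub>R\<^esub> \<phi> i x) e = lincomb N n (\<lambda>i. \<phi> i (r \<odot>\<^bsub>M\<^esub> x)) e"
      using c[OF x] r mod_hom_smult[OF assms(2) r x]
      by (intro lincomb_cong[OF assms(1) _ assms(3)]) auto
    then show "lincomb N n (\<lambda>i. \<phi> i (r \<odot>\<^bsub>M\<^esub> x)) e = r \<odot>\<^bsub>N\<^esub> lincomb N n (\<lambda>i. \<phi> i x) e"
      using lincomb_smult[OF assms(1) r c[OF x] assms(3)] by simp
  qed
qed

text \<open>Commutativity makes the pairing of coefficients with values symmetric. This is what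
  exchanges basis vectors and functionals in the passage to duals.\<close>

lemma lincomb_ring_mod_commute:
  assumes "cring R" "r \<in> coeffs R n" "s \<in> coeffs R n"
  shows "lincomb (ring_mod R) n r s = lincomb (ring_mod R) n s r"
proof -
  interpret module R "ring_mod R"
    by (rule module_ring_mod[OF assms(1)])
  show ?thesis
    unfolding lincomb_def
    by (intro M.finsum_cong') (use assms(2,3) in \<open>auto simp: Pi_iff intro: R.m_comm\<close>)
qed


section \<open>Constructions of modules\<close>

lemma module_zero_mod: "cring R \<Longrightarrow> module R zero_mod"
  by (rule module_of_axioms) (simp_all add: zero_mod_def)

lemma free_mod_simps [simp]:
  "carrier (free_mod R n) = {..<n} \<rightarrow>\<^sub>E carrier R"
  "\<zero>\<^bsub>free_mod R n\<^esub> = (\<lambda>i\<in>{..<n}. \<zero>\<^bsub>R\<^esub>)"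
  "x \<oplus>\<^bsub>free_mod R n\<^esub> y = (\<lambda>i\<in>{..<n}. x i \<oplus>\<^bsub>R\<^esub> y i)"
  "r \<odot>\<^bsub>free_mod R n\<^esub> x = (\<lambda>i\<in>{..<n}. r \<otimes>\<^bsub>R\<^esub> x i)"
  by (simp_all add: free_mod_def)

lemma PiE_restrict_eq: "x \<in> A \<rightarrow>\<^sub>E B \<Longrightarrow> (\<And>i. i \<in> A \<Longrightarrow> y i = x i) \<Longrightarrow> restrict y A = x"
  by (auto simp: fun_eq_iff PiE_iff extensional_def restrict_def)

lemma module_free_mod:
  assumes "cring R" shows "module R (free_mod R n)"
proof -
  interpret cring R by fact
  show ?thesis
    by (rule module_of_axioms[OF assms])
      (auto simp: PiE_iff Pi_iff a_ac m_ac l_distr r_distr extensional_def cong: restrict_cong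
        intro!: PiE_restrict_eq)
qed

lemma functional_coord: "i < n \<Longrightarrow> functional R (free_mod R n) (\<lambda>x. x i)"
  by (intro mod_homI) (auto simp: PiE_iff)

lemma dsum_mod_simps [simp]:
  "carrier (dsum_mod M N) = carrier M \<times> carrier N"
  "\<zero>\<^bsub>dsum_mod M N\<^esub> = (\<zero>\<^bsub>M\<^esub>, \<zero>\<^bsub>N\<^esub>)"
  "p \<oplus>\<^bsub>dsum_mod M N\<^esub> q = (fst p \<oplus>\<^bsub>M\<^esub> fst q, snd p \<oplus>\<^bsub>N\<^esub> snd q)"
  "r \<odot>\<^bsub>dsum_mod M N\<^esub> p = (r \<odot>\<^bsub>M\<^esub> fst p, r \<odot>\<^bsub>N\<^esub> snd p)"
  by (simp_all add: dsum_mod_def case_prod_beta)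

lemma module_dsum_mod:
  assumes "module R M" "module R N" shows "module R (dsum_mod M N)"
proof -
  interpret M: module R M by fact
  interpret N: module R N by fact
  show ?thesis
    by (rule module_of_axioms)
      (auto simp: M.R.is_cring M.smult_l_distr M.smult_r_distr M.smult_assoc1 N.smult_l_distr
        N.smult_r_distr N.smult_assoc1 M.M.a_assoc N.M.a_assoc intro: M.M.a_comm N.M.a_comm)
qed

lemma Hom_mod_simps [simp]:
  "carrier (Hom_mod R M N) = {h \<in> extensional (carrier M). mod_hom R M N h}"
  "\<zero>\<^bsub>Hom_mod R M N\<^esub> = (\<lambda>x\<in>carrier M. \<zero>\<^bsub>N\<^esub>)"
  "g \<oplus>\<^bsub>Hom_mod R M N\<^esub> h = (\<lambda>x\<in>carrier M. g x \<oplus>\<^bsub>N\<^esub> h x)"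
  "r \<odot>\<^bsub>Hom_mod R M N\<^esub> h = (\<lambda>x\<in>carrier M. r \<odot>\<^bsub>N\<^esub> h x)"
  by (simp_all add: Hom_mod_def)

lemma extensional_restrict_eq:
  "x \<in> extensional A \<Longrightarrow> (\<And>i. i \<in> A \<Longrightarrow> y i = x i) \<Longrightarrow> restrict y A = x"
  by (auto simp: fun_eq_iff extensional_def restrict_def)

lemma mod_hom_zero_map:
  assumes "module R M" "module R N"
  shows "mod_hom R M N (\<lambda>x\<in>carrier M. \<zero>\<^bsub>N\<^esub>)"
proof -
  interpret M: module R M by fact
  interpret N: module R N by fact
  show ?thesis
    by (intro mod_homI) auto
qed

lemma mod_hom_sum:
  assumes "module R M" "module R N" "mod_hom R M N g" "mod_hom R M N h"
  shows "mod_hom R M N (\<lambda>x\<in>carrier M. g x \<oplus>\<^bsub>N\<^esub> h x)"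
proof -
  interpret M: module R M by fact
  interpret N: module R N by fact
  show ?thesis
    using mod_hom_closed[OF assms(3)] mod_hom_closed[OF assms(4)]
    by (intro mod_homI)
      (auto simp: mod_hom_add[OF assms(3)] mod_hom_add[OF assms(4)] mod_hom_smult[OF assms(3)]
        mod_hom_smult[OF assms(4)] N.smult_r_distr N.M.a_ac)
qed

lemma mod_hom_scale:
  assumes "module R M" "module R N" "r \<in> carrier R" "mod_hom R M N h"
  shows "mod_hom R M N (\<lambda>x\<in>carrier M. r \<odot>\<^bsub>N\<^esub> h x)"
proof -
  interpret M: module R M by fact
  interpret N: module R N by fact
  show ?thesis
    using mod_hom_closed[OF assms(4)] assms(3)
    by (intro mod_homI)
      (auto simp: mod_hom_add[OF assms(4)] mod_hom_smult[OF assms(4)] N.smult_r_distr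
        N.smult_assoc1[symmetric] M.R.m_comm)
qed

lemma module_Hom_mod:
  assumes "module R M" "module R N" shows "module R (Hom_mod R M N)"
proof -
  interpret M: module R M by fact
  interpret N: module R N by fact
  show ?thesis
    by (rule module_of_axioms)
      (auto simp: M.R.is_cring mod_hom_zero_map[OF assms] mod_hom_sum[OF assms]
        mod_hom_scale[OF assms] mod_hom_closed N.M.a_ac N.smult_l_distr
        N.smult_r_distr N.smult_assoc1
        cong: restrict_cong intro!: extensional_restrict_eq restrict_ext)
qed

text \<open>The target is not known to be a module beforehand: every axiom is pulled back along the
  surjection. This gives the module structure on quotients.\<close>

lemma module_hom_image:
  assumes "module R M" and "\<And>x. x \<in> carrier M \<Longrightarrow> h x \<in> carrier N"
    and "h ` carrier M = carrier N" and "h \<zero>\<^bsub>M\<^esub> = \<zero>\<^bsub>N\<^esub>" and "mod_hom R M N h"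
  shows "module R N"
proof -
  interpret M: module R M by fact
  note [simp] = mod_hom_add[OF assms(5), symmetric] mod_hom_smult[OF assms(5), symmetric]
    assms(4)[symmetric]
  show ?thesis
    by (rule module_of_axioms)
      (auto simp: M.R.is_cring M.M.a_ac M.smult_l_distr M.smult_r_distr M.smult_assoc1
        assms(3)[symmetric] intro!: imageI)
qed

section \<open>Quotient modules\<close>

lemma
  assumes M: "module R M" and H: "submodule H R M"
  shows mod_hom_quot: "mod_hom R M (quot_mod M H) (\<lambda>x. H +>\<^bsub>M\<^esub> x)"
    and module_quot_mod: "module R (quot_mod M H)"
    and quot_mod_onto: "(\<lambda>x. H +>\<^bsub>M\<^esub> x) ` carrier M = carrier (quot_mod M H)"
    and quot_mod_kernel: "x \<in> carrier M \<Longrightarrow> H +>\<^bsub>M\<^esub> x = \<zero>\<^bsub>quot_mod M H\<^esub> \<longleftrightarrow> x \<in> H"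
proof -
  interpret M: module R M by fact
  have sub: "additive_subgroup H M"
    using submodule.axioms(1)[OF H] by (rule additive_subgroupI)
  interpret H: abelian_subgroup H M
    by (rule abelian_subgroupI3[OF sub M.M.abelian_group_axioms])
  show onto: "(\<lambda>x. H +>\<^bsub>M\<^esub> x) ` carrier M = carrier (quot_mod M H)"
    by (auto simp: quot_mod_def A_RCOSETS_def')
  \<comment> \<open>\<open>quot_mod\<close> forms the union over all representatives. Independence
    of the representative makes it a union of equal cosets, and \<open>x\<close> itself shows that
    it is not an empty union.\<close>
  have smult: "(\<Union>y\<in>H +>\<^bsub>M\<^esub> x. H +>\<^bsub>M\<^esub> (r \<odot>\<^bsub>M\<^esub> y)) = H +>\<^bsub>M\<^esub> (r \<odot>\<^bsub>M\<^esub> x)"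
    if r: "r \<in> carrier R" and x: "x \<in> carrier M" for r x
  proof -
    have "H +>\<^bsub>M\<^esub> (r \<odot>\<^bsub>M\<^esub> y) = H +>\<^bsub>M\<^esub> (r \<odot>\<^bsub>M\<^esub> x)" if "y \<in> H +>\<^bsub>M\<^esub> x" for y
    proof -
      obtain h where h: "h \<in> H" "y = h \<oplus>\<^bsub>M\<^esub> x"
        using \<open>y \<in> H +>\<^bsub>M\<^esub> x\<close> by (auto simp: a_r_coset_def')
      then have "r \<odot>\<^bsub>M\<^esub> y = r \<odot>\<^bsub>M\<^esub> h \<oplus>\<^bsub>M\<^esub> r \<odot>\<^bsub>M\<^esub> x"
        using r x H.a_subset by (auto simp: M.smult_r_distr)
      then have "r \<odot>\<^bsub>M\<^esub> y \<in> H +>\<^bsub>M\<^esub> (r \<odot>\<^bsub>M\<^esub> x)"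
        using submodule_smult[OF H r h(1)] by (auto simp: a_r_coset_def')
      then show ?thesis
        using r x H.a_repr_independence' by auto
    qed
    moreover have "x \<in> H +>\<^bsub>M\<^esub> x"
      using x by (rule H.a_rcos_self)
    ultimately show ?thesis
      by blast
  qed
  show hom: "mod_hom R M (quot_mod M H) (\<lambda>x. H +>\<^bsub>M\<^esub> x)"
  proof (intro mod_homI)
    show "H +>\<^bsub>M\<^esub> x \<in> carrier (quot_mod M H)" if "x \<in> carrier M" for x
      using onto that by blast
  qed (simp_all add: quot_mod_def H.a_rcos_sum smult)
  show ker: "H +>\<^bsub>M\<^esub> x = \<zero>\<^bsub>quot_mod M H\<^esub> \<longleftrightarrow> x \<in> H" if x: "x \<in> carrier M" for x
  proof
    assume "H +>\<^bsub>M\<^esub> x = \<zero>\<^bsub>quot_mod M H\<^esub>"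
    then show "x \<in> H"
      using H.a_rcos_self[OF x] by (simp add: quot_mod_def)
  next
    assume "x \<in> H"
    then show "H +>\<^bsub>M\<^esub> x = \<zero>\<^bsub>quot_mod M H\<^esub>"
      by (simp add: quot_mod_def H.a_rcos_const)
  qed
  show "module R (quot_mod M H)"
  proof (rule module_hom_image[OF M _ onto _ hom])
    show "H +>\<^bsub>M\<^esub> x \<in> carrier (quot_mod M H)" if "x \<in> carrier M" for x
      using onto that by blast
    show "H +>\<^bsub>M\<^esub> \<zero>\<^bsub>M\<^esub> = \<zero>\<^bsub>quot_mod M H\<^esub>"
      by (simp add: ker submodule_zero[OF H])
  qed
qed


section \<open>Finitely generated modules\<close>

definition generates ::
    "('a, 'm) ring_scheme \<Rightarrow> ('a, 'b) module \<Rightarrow> nat \<Rightarrow> (nat \<Rightarrow> 'b) \<Rightarrow> bool" where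
  "generates R M n e \<longleftrightarrow> e \<in> family M n \<and> (\<forall>x\<in>carrier M. \<exists>r\<in>coeffs R n. x = lincomb M n r e)"

definition lincombs ::
    "('a, 'm) ring_scheme \<Rightarrow> ('a, 'b) module \<Rightarrow> nat \<Rightarrow> (nat \<Rightarrow> 'b) \<Rightarrow> 'b set" where
  "lincombs R M n e = (\<lambda>r. lincomb M n r e) ` coeffs R n"

text \<open>Restricting a coefficient function to the indices below \<open>n\<close> does not change
  the sum. Hence the span is the image of a homomorphism from a free module, which makes it a
  submodule at once.\<close>

lemma lincombs_eq_image:
  assumes "module R M" "e \<in> family M n"
  shows "lincombs R M n e = (\<lambda>r. lincomb M n r e) ` carrier (free_mod R n)"
proof -
  have "\<exists>r'\<in>{..<n} \<rightarrow>\<^sub>E carrier R. lincomb M n r e = lincomb M n r' e" if "r \<in> coeffs R n" for r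
    using that by (intro bexI[of _ "restrict r {..<n}"] lincomb_cong[OF assms(1) _ assms(2)]) auto
  then show ?thesis
    by (auto simp: lincombs_def image_iff PiE_iff)
qed

lemma mod_hom_lincomb_free:
  assumes "module R M" "e \<in> family M n"
  shows "mod_hom R (free_mod R n) M (\<lambda>r. lincomb M n r e)"
  by (rule mod_hom_lincomb[OF assms(1) _ assms(2)]) (rule functional_coord)

lemma submodule_lincombs:
  assumes "module R M" "e \<in> family M n"
  shows "submodule (lincombs R M n e) R M"
  unfolding lincombs_eq_image[OF assms]
  by (intro submodule_image mod_hom_lincomb_free module_free_mod assms module.axioms(1)[OF assms(1)])

lemma family_in_lincombs:
  assumes "module R M" "e \<in> family M n" "i < n"
  shows "e i \<in> lincombs R M n e"
proof -
  interpret M: module R M by fact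
  have "lincomb M n (\<lambda>j. if j = i then \<one>\<^bsub>R\<^esub> else \<zero>\<^bsub>R\<^esub>) e = e i"
    using assms(2,3) by (subst lincomb_single[OF assms]) (auto intro!: M.smult_one)
  then show ?thesis
    unfolding lincombs_def
    by (intro image_eqI[of _ _ "\<lambda>j. if j = i then \<one>\<^bsub>R\<^esub> else \<zero>\<^bsub>R\<^esub>"]) auto
qed

lemma lincombs_least:
  assumes "module R M" "submodule H R M" "e \<in> {..<n} \<rightarrow> H"
  shows "lincombs R M n e \<subseteq> H"
  using lincomb_in_submodule[OF assms(1,2) _ assms(3)] by (auto simp: lincombs_def)

lemma generates_iff:
  "module R M \<Longrightarrow> generates R M n e \<longleftrightarrow> e \<in> family M n \<and> lincombs R M n e = carrier M"
  using lincomb_closed[of R M _ n e] by (auto simp: generates_def lincombs_def image_iff)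

text \<open>The definition intersects all submodules containing a finite set; the span of an
  enumeration of that set is the least of them, so elements acquire explicit coordinates.\<close>

lemma fg_module_iff:
  fixes M :: "('a, 'b) module"
  shows "fg_module R M \<longleftrightarrow> module R M \<and> (\<exists>n e. generates R M n e)"
proof
  assume fg: "fg_module R M"
  then obtain S where M: "module R M" and S: "S \<subseteq> carrier M" "finite S"
      and eq: "carrier M = \<Inter>{H. submodule H R M \<and> S \<subseteq> H}"
    by (auto simp: fg_module_def)
  obtain e :: "nat \<Rightarrow> 'b" and n where e: "S = e ` {i. i < n}"
    using finite_imp_nat_seg_image_inj_on[OF S(2)] by blast
  have fam: "e \<in> family M n"
    using S(1) e by auto
  have "S \<subseteq> lincombs R M n e"
    using family_in_lincombs[OF M fam] e by auto
  then have "carrier M \<subseteq> lincombs R M n e"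
    using eq submodule_lincombs[OF M fam] by blast
  then have "generates R M n e"
    using fam submodule_subset[OF submodule_lincombs[OF M fam]] by (auto simp: generates_iff[OF M])
  then show "module R M \<and> (\<exists>n e. generates R M n e)"
    using M by blast
next
  assume "module R M \<and> (\<exists>n e. generates R M n e)"
  then obtain n e where M: "module R M" and g: "generates R M n e"
    by blast
  interpret M: module R M by fact
  have "carrier M \<subseteq> H" if "submodule H R M" "e ` {..<n} \<subseteq> H" for H
    using lincombs_least[OF M that(1), of e n] that(2) g by (auto simp: generates_iff[OF M])
  moreover have "submodule (carrier M) R M" "e ` {..<n} \<subseteq> carrier M"
    using g M.carrier_is_submodule by (auto simp: generates_def)
  ultimately have "carrier M = \<Inter>{H. submodule H R M \<and> e ` {..<n} \<subseteq> H}"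
    by blast
  then show "fg_module R M"
    using M \<open>e ` {..<n} \<subseteq> carrier M\<close> unfolding fg_module_def by blast
qed

lemma generates_hom_image:
  assumes "module R M" "module R N" "mod_hom R M N h" "h ` carrier M = carrier N" "generates R M n e"
  shows "generates R N n (\<lambda>i. h (e i))"
proof -
  have e: "e \<in> family M n"
    using assms(5) by (simp add: generates_def)
  have "\<exists>r\<in>coeffs R n. y = lincomb N n r (\<lambda>i. h (e i))" if y: "y \<in> carrier N" for y
  proof -
    obtain x where x: "x \<in> carrier M" "y = h x"
      using y assms(4) by blast
    then obtain r where "r \<in> coeffs R n" "x = lincomb M n r e"
      using assms(5) by (auto simp: generates_def)
    then show ?thesis
      using x lincomb_hom[OF assms(1-3) _ e] by auto
  qed
  then show ?thesis
    using e mod_hom_closed[OF assms(3)] by (auto simp: generates_def)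
qed

lemma fg_module_hom_image:
  assumes "fg_module R M" "module R N" "mod_hom R M N h" "h ` carrier M = carrier N"
  shows "fg_module R N"
  using assms generates_hom_image[OF _ assms(2-4)] unfolding fg_module_iff by blast

section \<open>Submodules of finitely generated modules over a noetherian ring\<close>

text \<open>The set collects the coefficients at \<open>y\<close> of elements of \<open>N\<close>,
  modulo the span of \<open>e\<close>. It corresponds to the leading coefficients in Hilbert's basis
  theorem.\<close>

lemma ideal_leading_coeffs:
  assumes "module R M" "e \<in> family M n" "y \<in> carrier M" "submodule N R M"
  shows "ideal {r \<in> carrier R. \<exists>s\<in>lincombs R M n e. r \<odot>\<^bsub>M\<^esub> y \<oplus>\<^bsub>M\<^esub> s \<in> N} R"
    (is "ideal ?I R")
proof -
  interpret M: module R M by fact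
  let ?L = "lincombs R M n e"
  have L: "submodule ?L R M"
    by (rule submodule_lincombs[OF assms(1,2)])
  have Lc: "s \<in> carrier M" if "s \<in> ?L" for s
    using submodule_subset[OF L] that by blast
  have zero: "\<zero>\<^bsub>R\<^esub> \<in> ?I"
    using submodule_zero[OF L] submodule_zero[OF assms(4)] assms(3)
    by (auto intro!: bexI[of _ "\<zero>\<^bsub>M\<^esub>"])
  have add: "r \<oplus>\<^bsub>R\<^esub> r' \<in> ?I" if "r \<in> ?I" "r' \<in> ?I" for r r'
  proof -
    obtain s s' where s: "r \<in> carrier R" "r' \<in> carrier R" "s \<in> ?L" "s' \<in> ?L"
        "r \<odot>\<^bsub>M\<^esub> y \<oplus>\<^bsub>M\<^esub> s \<in> N" "r' \<odot>\<^bsub>M\<^esub> y \<oplus>\<^bsub>M\<^esub> s' \<in> N"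
      using \<open>r \<in> ?I\<close> \<open>r' \<in> ?I\<close> by blast
    have "(r \<oplus>\<^bsub>R\<^esub> r') \<odot>\<^bsub>M\<^esub> y \<oplus>\<^bsub>M\<^esub> (s \<oplus>\<^bsub>M\<^esub> s') =
        (r \<odot>\<^bsub>M\<^esub> y \<oplus>\<^bsub>M\<^esub> s) \<oplus>\<^bsub>M\<^esub> (r' \<odot>\<^bsub>M\<^esub> y \<oplus>\<^bsub>M\<^esub> s')"
      using s(1-4) assms(3) Lc by (simp add: M.smult_l_distr M.M.a_ac)
    then show ?thesis
      using s submodule_add[OF assms(4) s(5,6)] submodule_add[OF L s(3,4)]
      by (auto intro!: bexI[of _ "s \<oplus>\<^bsub>M\<^esub> s'"])
  qed
  have mult: "t \<otimes>\<^bsub>R\<^esub> r \<in> ?I" if "r \<in> ?I" and t: "t \<in> carrier R" for r t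
  proof -
    obtain s where s: "r \<in> carrier R" "s \<in> ?L" "r \<odot>\<^bsub>M\<^esub> y \<oplus>\<^bsub>M\<^esub> s \<in> N"
      using \<open>r \<in> ?I\<close> by blast
    have "(t \<otimes>\<^bsub>R\<^esub> r) \<odot>\<^bsub>M\<^esub> y \<oplus>\<^bsub>M\<^esub> t \<odot>\<^bsub>M\<^esub> s = t \<odot>\<^bsub>M\<^esub> (r \<odot>\<^bsub>M\<^esub> y \<oplus>\<^bsub>M\<^esub> s)"
      using s(1,2) t assms(3) Lc by (simp add: M.smult_assoc1 M.smult_r_distr)
    then show ?thesis
      using s t submodule_smult[OF assms(4) t s(3)] submodule_smult[OF L t s(2)]
      by (auto intro!: bexI[of _ "t \<odot>\<^bsub>M\<^esub> s"])
  qed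
  show ?thesis
  proof (rule idealI[OF M.R.ring_axioms])
    have neg: "\<ominus>\<^bsub>R\<^esub> r \<in> ?I" if "r \<in> ?I" for r
      using mult[OF that, of "\<ominus>\<^bsub>R\<^esub> \<one>\<^bsub>R\<^esub>"] that by (simp add: M.R.l_minus)
    show "subgroup ?I (add_monoid R)"
      by (rule M.R.add.subgroupI) (use zero add neg in \<open>auto simp: a_inv_def[symmetric]\<close>)
    show "x \<otimes>\<^bsub>R\<^esub> a \<in> ?I" if "a \<in> ?I" "x \<in> carrier R" for a x
      by (rule mult[OF that])
    show "a \<otimes>\<^bsub>R\<^esub> x \<in> ?I" if "a \<in> ?I" "x \<in> carrier R" for a x
      using mult[OF that] that by (simp add: M.R.m_comm)
  qed
qed

text \<open>Induction on the number of generators: the last coefficients of elements of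
  \<open>N\<close> form a finitely generated ideal, and the part of \<open>N\<close> inside the span
  of the remaining generators falls under the induction hypothesis. Generation is stated through
  submodules containing \<open>T\<close>, which matches \<open>fg_module\<close>.\<close>

lemma noetherian_submodule_generators:
  assumes "noetherian_ring R" "module R M" "e \<in> family M n" "submodule N R M"
    and "N \<subseteq> lincombs R M n e"
  shows "\<exists>T\<subseteq>N. finite T \<and> (\<forall>H. submodule H R M \<longrightarrow> T \<subseteq> H \<longrightarrow> N \<subseteq> H)"
  using assms(3-5)
proof (induction n arbitrary: N)
  case 0
  then have "N \<subseteq> {\<zero>\<^bsub>M\<^esub>}"
    by (auto simp: lincombs_def lincomb_0[OF assms(2)])
  then show ?case
    using submodule_zero by (intro exI[of _ "{}"]) blast
next
  case (Suc n)
  interpret R: noetherian_ring R by fact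
  interpret M: module R M by fact
  let ?L = "lincombs R M n e"
  note fam = Suc.prems(1)[THEN coeffs_SucD]
  have en: "e n \<in> carrier M"
    using Suc.prems(1) by auto
  have L: "submodule ?L R M"
    by (rule submodule_lincombs[OF assms(2) fam])
  have Lc: "s \<in> carrier M" if "s \<in> ?L" for s
    using submodule_subset[OF L] that by blast
  have Nc: "x \<in> carrier M" if "x \<in> N" for x
    using submodule_subset[OF Suc.prems(2)] that by blast
  define I where "I N = {r \<in> carrier R. \<exists>s\<in>?L. r \<odot>\<^bsub>M\<^esub> e n \<oplus>\<^bsub>M\<^esub> s \<in> N}" for N
  have ideal: "ideal (I H) R" if "submodule H R M" for H
    unfolding I_def by (rule ideal_leading_coeffs[OF assms(2) fam en that])
  have inter: "submodule (H \<inter> K) R M" if "submodule H R M" "submodule K R M" for H K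
    using that M.submoduleE[OF that(1)] M.submoduleE[OF that(2)] submodule_zero[of _ R M]
    by (intro M.submoduleI) auto
  obtain T where T: "T \<subseteq> N \<inter> ?L" "finite T"
      and Tmin: "\<And>H. submodule H R M \<Longrightarrow> T \<subseteq> H \<Longrightarrow> N \<inter> ?L \<subseteq> H"
    using Suc.IH[OF fam inter[OF Suc.prems(2) L]] by auto
  obtain A where A: "A \<subseteq> carrier R" "finite A" "I N = genideal R A"
    using R.finetely_gen[OF ideal[OF Suc.prems(2)]] by blast
  have "A \<subseteq> I N"
    using A(3) R.genideal_self[OF A(1)] by simp
  then have "\<exists>s. s \<in> ?L \<and> a \<odot>\<^bsub>M\<^esub> e n \<oplus>\<^bsub>M\<^esub> s \<in> N" if "a \<in> A" for a
    using that by (auto simp: I_def)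
  then obtain g where g: "\<And>a. a \<in> A \<Longrightarrow> g a \<in> ?L \<and> a \<odot>\<^bsub>M\<^esub> e n \<oplus>\<^bsub>M\<^esub> g a \<in> N"
    by metis
  let ?T = "T \<union> (\<lambda>a. a \<odot>\<^bsub>M\<^esub> e n \<oplus>\<^bsub>M\<^esub> g a) ` A"
  have "N \<subseteq> H" if H: "submodule H R M" and TH: "?T \<subseteq> H" for H
  proof
    fix x assume x: "x \<in> N"
    then obtain r where r: "r \<in> coeffs R (Suc n)" "x = lincomb M (Suc n) r e"
      using Suc.prems(3) by (auto simp: lincombs_def)
    define s where "s = lincomb M n r e"
    have rn: "r n \<in> carrier R" and s: "s \<in> ?L" and xs: "x = r n \<odot>\<^bsub>M\<^esub> e n \<oplus>\<^bsub>M\<^esub> s"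
      using r coeffs_SucD[OF r(1)] lincomb_Suc[OF assms(2) r(1) Suc.prems(1)]
      by (auto simp: lincombs_def s_def)
    \<comment> \<open>The coefficients already realised inside \<open>H\<close> contain the
      generators \<open>A\<close> of the ideal \<open>I N\<close>, hence all of it.\<close>
    have "A \<subseteq> I (N \<inter> H)"
      using A(1) g TH unfolding I_def by blast
    then have "I N \<subseteq> I (N \<inter> H)"
      using A(3) R.genideal_minimal[OF ideal[OF inter[OF Suc.prems(2) H]]] by simp
    moreover have "r n \<in> I N"
      using rn s x xs by (auto simp: I_def)
    ultimately obtain t where t: "t \<in> ?L" "r n \<odot>\<^bsub>M\<^esub> e n \<oplus>\<^bsub>M\<^esub> t \<in> N" "r n \<odot>\<^bsub>M\<^esub> e n \<oplus>\<^bsub>M\<^esub> t \<in> H"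
      by (auto simp: I_def)
    define y where "y = r n \<odot>\<^bsub>M\<^esub> e n \<oplus>\<^bsub>M\<^esub> t"
    have yc: "y \<in> carrier M"
      using t(2) Nc by (simp add: y_def)
    \<comment> \<open>\<open>x\<close> and \<open>y\<close> have the same coefficient at
      \<open>e n\<close>, so their difference lies in the span of the earlier generators and thus,
      by the choice of \<open>T\<close>, in \<open>H\<close>.\<close>
    have "x \<ominus>\<^bsub>M\<^esub> y = s \<ominus>\<^bsub>M\<^esub> t"
      using rn en Lc[OF s] Lc[OF t(1)]
      by (simp add: xs y_def a_minus_def M.M.minus_add M.M.a_ac M.M.r_neg M.M.r_neg1 M.M.r_neg2)
    moreover have "x \<ominus>\<^bsub>M\<^esub> y \<in> N"
      using submodule_diff[OF assms(2) Suc.prems(2) x] t(2) by (simp add: y_def)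
    moreover have "s \<ominus>\<^bsub>M\<^esub> t \<in> ?L"
      by (rule submodule_diff[OF assms(2) L s t(1)])
    ultimately have "x \<ominus>\<^bsub>M\<^esub> y \<in> H"
      using Tmin[OF H] TH by auto
    then have "(x \<ominus>\<^bsub>M\<^esub> y) \<oplus>\<^bsub>M\<^esub> y \<in> H"
      using t(3) submodule_add[OF H] by (simp add: y_def)
    moreover have "(x \<ominus>\<^bsub>M\<^esub> y) \<oplus>\<^bsub>M\<^esub> y = x"
      using Nc[OF x] yc by (simp add: a_minus_def M.M.a_assoc M.M.l_neg)
    ultimately show "x \<in> H"
      by simp
  qed
  moreover have "?T \<subseteq> N" "finite ?T"
    using T A(2) g by auto
  ultimately show ?case
    by (intro exI[of _ ?T]) blast
qed

lemma fg_module_submodule: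
  assumes "noetherian_ring R" "fg_module R M" "submodule N R M"
  shows "fg_module R (M\<lparr>carrier := N\<rparr>)"
proof -
  have M: "module R M"
    using assms(2) by (simp add: fg_module_def)
  interpret M: module R M by fact
  obtain n e where e: "e \<in> family M n" "lincombs R M n e = carrier M"
    using assms(2) by (auto simp: fg_module_iff generates_iff)
  obtain T where T: "T \<subseteq> N" "finite T"
      and Tmin: "\<And>H. submodule H R M \<Longrightarrow> T \<subseteq> H \<Longrightarrow> N \<subseteq> H"
    using noetherian_submodule_generators[OF assms(1) M e(1) assms(3)] submodule_subset[OF assms(3)] e(2)
    by blast
  have N: "module R (M\<lparr>carrier := N\<rparr>)"
    by (rule module_restrict[OF M assms(3)])
  interpret N: module R "M\<lparr>carrier := N\<rparr>" by fact
  have "N \<subseteq> H" if H: "submodule H R (M\<lparr>carrier := N\<rparr>)" "T \<subseteq> H" for H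
  proof -
    have "H \<subseteq> carrier M"
      using submodule_subset[OF H(1)] submodule_subset[OF assms(3)] by auto
    moreover have "module R (M\<lparr>carrier := H\<rparr>)"
      using module_restrict[OF N H(1)] by simp
    ultimately show ?thesis
      using Tmin[OF M.module_incl_imp_submodule H(2)] by simp
  qed
  moreover have "submodule N R (M\<lparr>carrier := N\<rparr>)"
    using N.carrier_is_submodule by simp
  ultimately have "N = \<Inter>{H. submodule H R (M\<lparr>carrier := N\<rparr>) \<and> T \<subseteq> H}"
    using T(1) by blast
  then show ?thesis
    using N T by (auto simp: fg_module_def)
qed


section \<open>Local rings\<close>

locale noetherian_local = cring R + noetherian_ring R for R (structure) +
  assumes unique_maximal: "\<exists>!I. maximalideal I R"
begin

definition max_ideal :: "'a set" where
  "max_ideal = (THE I. maximalideal I R)"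

lemma maximalideal_max_ideal: "maximalideal max_ideal R"
  unfolding max_ideal_def by (rule theI'[OF unique_maximal])

sublocale max: maximalideal max_ideal R
  by (rule maximalideal_max_ideal)

lemma one_notin_max_ideal: "\<one> \<notin> max_ideal"
  using max.I_notcarr max.one_imp_carrier by blast

lemma max_ideal_closed: "x \<in> max_ideal \<Longrightarrow> x \<in> carrier R"
  using max.a_subset by blast

lemma unit_if_notin_max_ideal:
  assumes "x \<in> carrier R" "x \<notin> max_ideal"
  shows "\<exists>y\<in>carrier R. y \<otimes> x = \<one>"
proof (rule ccontr)
  assume "\<not> ?thesis"
  then have "\<one> \<notin> PIdl x"
    by (auto simp: cgenideal_def)
  \<comment> \<open>A maximal member of this family is a maximal ideal containing \<open>x\<close>.
    In a noetherian ring a non-empty chain of ideals contains its union, which supplies the upper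
    bounds for Zorn's lemma.\<close>
  let ?A = "{I. ideal I R \<and> x \<in> I \<and> \<one> \<notin> I}"
  have "\<exists>I\<in>?A. \<forall>J\<in>?A. I \<subseteq> J \<longrightarrow> J = I"
  proof (rule subset_Zorn_nonempty)
    have "PIdl x \<in> ?A"
      using cgenideal_ideal[OF assms(1)] cgenideal_self[OF assms(1)] \<open>\<one> \<notin> PIdl x\<close> by simp
    then show "?A \<noteq> {}"
      by blast
    fix C assume C: "C \<noteq> {}" "subset.chain ?A C"
    then have "subset.chain {I. ideal I R} C"
      by (auto simp: pred_on.chain_def)
    then have "\<Union>C \<in> C"
      by (rule ideal_chain_is_trivial[OF C(1)])
    then show "\<Union>C \<in> ?A"
      using C(2) unfolding pred_on.chain_def by blast
  qed
  then obtain I where I: "ideal I R" "x \<in> I" "\<one> \<notin> I"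
      and max: "\<And>J. ideal J R \<Longrightarrow> x \<in> J \<Longrightarrow> \<one> \<notin> J \<Longrightarrow> I \<subseteq> J \<Longrightarrow> J = I"
    by blast
  have "maximalideal I R"
  proof (rule maximalidealI[OF I(1)])
    show "carrier R \<noteq> I"
      using I(3) by auto
    show "J = I \<or> J = carrier R" if "ideal J R" "I \<subseteq> J" for J
      using max[OF that(1)] that I(2) ideal.one_imp_carrier[OF that(1)] by blast
  qed
  then have "I = max_ideal"
    using unique_maximal maximalideal_max_ideal by blast
  then show False
    using I(2) assms(2) by simp
qed

text \<open>The generators are removed one at a time.\<close>

lemma nakayama:
  assumes M: "module R M" and gen: "generates R M n e" and H: "submodule H R M"
    and cover: "\<And>x. x \<in> carrier M \<Longrightarrow>
      \<exists>h\<in>H. \<exists>r\<in>{..<n} \<rightarrow> max_ideal. x = h \<oplus>\<^bsub>M\<^esub> lincomb M n r e"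
  shows "H = carrier M"
proof -
  interpret M: module R M by fact
  have e: "e \<in> family M n"
    using gen by (simp add: generates_def)
  have Hc: "h \<in> carrier M" if "h \<in> H" for h
    using submodule_subset[OF H] that by blast
  have mR: "r \<in> coeffs R k" if "r \<in> {..<k} \<rightarrow> max_ideal" for r k
    using that max_ideal_closed by (auto simp: Pi_iff)
  \<comment> \<open>\<open>k\<close> counts the generators still in use; at 0 the hypothesis places
    every element in \<open>H\<close>.\<close>
  have "H = carrier M"
    if "k \<le> n" and "\<And>x. x \<in> carrier M \<Longrightarrow>
      \<exists>h\<in>H. \<exists>r\<in>{..<k} \<rightarrow> max_ideal. x = h \<oplus>\<^bsub>M\<^esub> lincomb M k r e" for k
    using that
  proof (induction k)
    case 0
    have "x \<in> H" if "x \<in> carrier M" for x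
      using "0.prems"(2)[OF that] lincomb_0[OF M] Hc by auto
    then show ?case
      using Hc by blast
  next
    case (Suc k)
    have fam: "e \<in> family M (Suc k)"
      using e Suc.prems(1) by auto
    have ek: "e k \<in> carrier M"
      using fam by auto
    obtain h r where h: "h \<in> H" and r: "r \<in> {..<Suc k} \<rightarrow> max_ideal"
        and "e k = h \<oplus>\<^bsub>M\<^esub> lincomb M (Suc k) r e"
      using Suc.prems(2)[OF ek] by blast
    then have ek_eq: "e k = h \<oplus>\<^bsub>M\<^esub> (r k \<odot>\<^bsub>M\<^esub> e k \<oplus>\<^bsub>M\<^esub> lincomb M k r e)"
      by (simp add: lincomb_Suc[OF M mR[OF r] fam])
    note r' = coeffs_SucD[OF r] and fam' = coeffs_SucD[OF fam]
    have rk: "r k \<in> max_ideal" "r k \<in> carrier R"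
      using r mR[OF r] by auto
    \<comment> \<open>In the expansion of \<open>e k\<close> its own coefficient is
      \<open>r k\<close>; brought to the left it leaves the coefficient
      \<open>\<one> \<ominus> r k\<close>, a unit, so \<open>e k\<close> can be eliminated.\<close>
    have "\<one> \<ominus> r k \<notin> max_ideal"
    proof
      assume "\<one> \<ominus> r k \<in> max_ideal"
      then have "(\<one> \<ominus> r k) \<oplus> r k \<in> max_ideal"
        using rk by simp
      then show False
        using rk one_notin_max_ideal by (simp add: a_minus_def a_assoc l_neg)
    qed
    then obtain u where u: "u \<in> carrier R" "u \<otimes> (\<one> \<ominus> r k) = \<one>"
      using unit_if_notin_max_ideal rk(2) by (metis minus_closed one_closed)
    have lc: "lincomb M k r e \<in> carrier M"
      by (rule lincomb_closed[OF M mR[OF r'] fam'])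
    have "(\<one> \<ominus> r k) \<odot>\<^bsub>M\<^esub> e k = e k \<ominus>\<^bsub>M\<^esub> r k \<odot>\<^bsub>M\<^esub> e k"
      using rk ek by (simp add: a_minus_def M.smult_l_distr M.smult_l_minus)
    also have "\<dots> = (h \<oplus>\<^bsub>M\<^esub> (r k \<odot>\<^bsub>M\<^esub> e k \<oplus>\<^bsub>M\<^esub> lincomb M k r e)) \<ominus>\<^bsub>M\<^esub> r k \<odot>\<^bsub>M\<^esub> e k"
      using ek_eq by simp
    also have "\<dots> = h \<oplus>\<^bsub>M\<^esub> lincomb M k r e"
      using Hc[OF h] lc rk ek by (simp add: a_minus_def M.M.a_ac M.M.r_neg M.M.r_neg1 M.M.r_neg2)
    finally have "u \<odot>\<^bsub>M\<^esub> ((\<one> \<ominus> r k) \<odot>\<^bsub>M\<^esub> e k) = u \<odot>\<^bsub>M\<^esub> (h \<oplus>\<^bsub>M\<^esub> lincomb M k r e)"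
      by simp
    moreover have "u \<odot>\<^bsub>M\<^esub> ((\<one> \<ominus> r k) \<odot>\<^bsub>M\<^esub> e k) = e k"
      using u rk ek by (simp add: M.smult_assoc1[symmetric])
    ultimately have ek_red: "e k = u \<odot>\<^bsub>M\<^esub> h \<oplus>\<^bsub>M\<^esub> u \<odot>\<^bsub>M\<^esub> lincomb M k r e"
      using u Hc[OF h] lc by (simp add: M.smult_r_distr)
    have "\<exists>h\<in>H. \<exists>r\<in>{..<k} \<rightarrow> max_ideal. x = h \<oplus>\<^bsub>M\<^esub> lincomb M k r e" if x: "x \<in> carrier M" for x
    proof -
      obtain g s where g: "g \<in> H" and s: "s \<in> {..<Suc k} \<rightarrow> max_ideal"
          and "x = g \<oplus>\<^bsub>M\<^esub> lincomb M (Suc k) s e"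
        using Suc.prems(2)[OF x] by blast
      then have x_eq: "x = g \<oplus>\<^bsub>M\<^esub> (s k \<odot>\<^bsub>M\<^esub> e k \<oplus>\<^bsub>M\<^esub> lincomb M k s e)"
        by (simp add: lincomb_Suc[OF M mR[OF s] fam])
      note s' = coeffs_SucD[OF s]
      \<comment> \<open>The factor with which the expansion of \<open>e k\<close> enters that of
        \<open>x\<close>. It multiplies coefficients from the maximal ideal, so the new coefficients
        stay there.\<close>
      define t where "t = s k \<otimes> u"
      have sk: "s k \<in> max_ideal" "s k \<in> carrier R" and t: "t \<in> carrier R"
        using s mR[OF s] u by (auto simp: t_def)
      have tm: "(\<lambda>i. t \<otimes> r i) \<in> {..<k} \<rightarrow> max_ideal"
        using r' t max.I_l_closed by auto
      have ls: "lincomb M k s e \<in> carrier M"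
        by (rule lincomb_closed[OF M mR[OF s'] fam'])
      have "s k \<odot>\<^bsub>M\<^esub> e k = t \<odot>\<^bsub>M\<^esub> h \<oplus>\<^bsub>M\<^esub> t \<odot>\<^bsub>M\<^esub> lincomb M k r e"
        using u sk Hc[OF h] lc by (subst ek_red) (simp add: t_def M.smult_r_distr M.smult_assoc1)
      also have "t \<odot>\<^bsub>M\<^esub> lincomb M k r e = lincomb M k (\<lambda>i. t \<otimes> r i) e"
        by (rule lincomb_smult[OF M t mR[OF r'] fam', symmetric])
      finally have "x = (g \<oplus>\<^bsub>M\<^esub> t \<odot>\<^bsub>M\<^esub> h) \<oplus>\<^bsub>M\<^esub> (lincomb M k (\<lambda>i. t \<otimes> r i) e \<oplus>\<^bsub>M\<^esub> lincomb M k s e)"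
        using x_eq Hc[OF g] Hc[OF h] t ls lincomb_closed[OF M mR[OF tm] fam'] by (simp add: M.M.a_ac)
      also have "lincomb M k (\<lambda>i. t \<otimes> r i) e \<oplus>\<^bsub>M\<^esub> lincomb M k s e =
          lincomb M k (\<lambda>i. t \<otimes> r i \<oplus> s i) e"
        by (rule lincomb_add[OF M mR[OF tm] mR[OF s'] fam', symmetric])
      finally have "x = (g \<oplus>\<^bsub>M\<^esub> t \<odot>\<^bsub>M\<^esub> h) \<oplus>\<^bsub>M\<^esub> lincomb M k (\<lambda>i. t \<otimes> r i \<oplus> s i) e" .
      moreover have "g \<oplus>\<^bsub>M\<^esub> t \<odot>\<^bsub>M\<^esub> h \<in> H"
        by (intro submodule_add[OF H g] submodule_smult[OF H t h])
      moreover have "(\<lambda>i. t \<otimes> r i \<oplus> s i) \<in> {..<k} \<rightarrow> max_ideal"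
        using tm s' by auto
      ultimately show ?thesis
        by blast
    qed
    then show ?case
      using Suc.IH Suc.prems(1) by simp
  qed
  then show ?thesis
    using cover by blast
qed

end


section \<open>Projective modules and dual bases\<close>

text \<open>The data of the dual basis lemma, which characterises finitely generated projective
  modules. No linear independence is asked, so coordinates inherited from an ambient free module
  qualify.\<close>

definition mod_dual_basis ::
    "('a, 'm) ring_scheme \<Rightarrow> ('a, 'b) module \<Rightarrow> nat \<Rightarrow> (nat \<Rightarrow> 'b) \<Rightarrow> (nat \<Rightarrow> 'b \<Rightarrow> 'a) \<Rightarrow> bool" where
  "mod_dual_basis R P n e \<phi> \<longleftrightarrow> e \<in> family P n \<and> (\<forall>i<n. functional R P (\<phi> i)) \<and>
     (\<forall>x\<in>carrier P. lincomb P n (\<lambda>i. \<phi> i x) e = x)"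

definition unit_vec :: "('a, 'm) ring_scheme \<Rightarrow> nat \<Rightarrow> nat \<Rightarrow> nat \<Rightarrow> 'a" where
  "unit_vec R n i = (\<lambda>j\<in>{..<n}. if j = i then \<one>\<^bsub>R\<^esub> else \<zero>\<^bsub>R\<^esub>)"

lemma mod_dual_basis_free_mod:
  assumes "cring R"
  shows "mod_dual_basis R (free_mod R n) n (unit_vec R n) (\<lambda>i x. x i)"
proof -
  interpret cring R by fact
  have fam: "unit_vec R n \<in> family (free_mod R n) n"
    by (auto simp: unit_vec_def)
  have "lincomb (free_mod R n) n x (unit_vec R n) = x" if x: "x \<in> carrier (free_mod R n)" for x
  proof
    fix k
    have xc: "x \<in> coeffs R n"
      using x by (auto simp: PiE_iff)
    show "lincomb (free_mod R n) n x (unit_vec R n) k = x k"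
    proof (cases "k < n")
      case True
      \<comment> \<open>The \<open>k\<close>-th coordinate is a functional and may be taken inside
        the sum, which then collapses to its \<open>k\<close>-th term.\<close>
      have "lincomb (free_mod R n) n x (unit_vec R n) k =
          lincomb (ring_mod R) n x (\<lambda>i. unit_vec R n i k)"
        by (rule lincomb_hom[OF module_free_mod[OF assms] module_ring_mod[OF assms]
              functional_coord[OF True] xc fam])
      also have "\<dots> = lincomb (ring_mod R) n (\<lambda>i. unit_vec R n i k) x"
        using xc True by (intro lincomb_ring_mod_commute[OF assms]) (auto simp: unit_vec_def)
      also have "\<dots> = lincomb (ring_mod R) n (\<lambda>i. if i = k then \<one>\<^bsub>R\<^esub> else \<zero>\<^bsub>R\<^esub>) x"
        using xc True
        by (intro lincomb_cong[OF module_ring_mod[OF assms]]) (auto simp: unit_vec_def)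
      also have "\<dots> = \<one>\<^bsub>R\<^esub> \<odot>\<^bsub>ring_mod R\<^esub> x k"
        using xc by (intro lincomb_single[OF module_ring_mod[OF assms] _ True]) auto
      finally show ?thesis
        using xc True by (simp add: Pi_iff)
    next
      case False
      have "lincomb (free_mod R n) n x (unit_vec R n) \<in> carrier (free_mod R n)"
        by (rule lincomb_closed[OF module_free_mod[OF assms] xc fam])
      then show ?thesis
        using False x by (auto simp: PiE_iff extensional_def)
    qed
  qed
  then show ?thesis
    using fam by (auto simp: mod_dual_basis_def functional_coord)
qed

lemma direct_summand_projection:
  assumes "module R M" "direct_summand H R M"
  shows "\<exists>p. mod_hom R M (M\<lparr>carrier := H\<rparr>) p \<and> (\<forall>x\<in>H. p x = x)"
proof -
  interpret M: module R M by fact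
  obtain K where H: "submodule H R M" and K: "submodule K R M"
      and int: "H \<inter> K = {\<zero>\<^bsub>M\<^esub>}" and sum: "H <+>\<^bsub>M\<^esub> K = carrier M"
    using assms(2) by (auto simp: direct_summand_def)
  have Hc: "h \<in> carrier M" if "h \<in> H" for h
    using submodule_subset[OF H] that by blast
  have Kc: "k \<in> carrier M" if "k \<in> K" for k
    using submodule_subset[OF K] that by blast
  \<comment> \<open>The difference of \<open>h\<close> and \<open>h'\<close> equals that of
    \<open>k'\<close> and \<open>k\<close>, hence lies in both summands and vanishes.\<close>
  have uniq: "h = h'" if "h \<in> H" "h' \<in> H" "k \<in> K" "k' \<in> K" "h \<oplus>\<^bsub>M\<^esub> k = h' \<oplus>\<^bsub>M\<^esub> k'" for h h' k k'
  proof -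
    have "h \<ominus>\<^bsub>M\<^esub> h' = (h \<oplus>\<^bsub>M\<^esub> k) \<ominus>\<^bsub>M\<^esub> (h' \<oplus>\<^bsub>M\<^esub> k)"
      using that(1-4) Hc Kc by (simp add: a_minus_def M.M.minus_add M.M.a_ac M.M.r_neg M.M.r_neg1 M.M.r_neg2)
    also have "\<dots> = (h' \<oplus>\<^bsub>M\<^esub> k') \<ominus>\<^bsub>M\<^esub> (h' \<oplus>\<^bsub>M\<^esub> k)"
      using that(5) by simp
    also have "\<dots> = k' \<ominus>\<^bsub>M\<^esub> k"
    proof -
      have c: "h' \<in> carrier M" "k \<in> carrier M" "k' \<in> carrier M"
        using that Hc Kc by auto
      have "(h' \<oplus>\<^bsub>M\<^esub> k') \<ominus>\<^bsub>M\<^esub> (h' \<oplus>\<^bsub>M\<^esub> k) =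
          (h' \<oplus>\<^bsub>M\<^esub> \<ominus>\<^bsub>M\<^esub> h') \<oplus>\<^bsub>M\<^esub> (k' \<oplus>\<^bsub>M\<^esub> \<ominus>\<^bsub>M\<^esub> k)"
        unfolding a_minus_def using c by (simp add: M.M.minus_add M.M.a_ac)
      then show ?thesis
        using c by (simp add: a_minus_def M.M.r_neg)
    qed
    finally have "h \<ominus>\<^bsub>M\<^esub> h' \<in> H \<inter> K"
      using submodule_diff[OF assms(1) H that(1,2)] submodule_diff[OF assms(1) K that(4,3)] by simp
    then have "h \<ominus>\<^bsub>M\<^esub> h' = \<zero>\<^bsub>M\<^esub>"
      using int by simp
    then show "h = h'"
      by (rule diff_eq_zeroD[OF assms(1) Hc[OF that(1)] Hc[OF that(2)]])
  qed
  define p where "p x = (SOME h. h \<in> H \<and> (\<exists>k\<in>K. x = h \<oplus>\<^bsub>M\<^esub> k))" for x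
  have p: "p (h \<oplus>\<^bsub>M\<^esub> k) = h" if "h \<in> H" "k \<in> K" for h k
    unfolding p_def
  proof (rule some_equality)
    show "h \<in> H \<and> (\<exists>k'\<in>K. h \<oplus>\<^bsub>M\<^esub> k = h \<oplus>\<^bsub>M\<^esub> k')"
      using that by blast
    show "h' = h" if "h' \<in> H \<and> (\<exists>k'\<in>K. h \<oplus>\<^bsub>M\<^esub> k = h' \<oplus>\<^bsub>M\<^esub> k')" for h'
      using that \<open>h \<in> H\<close> \<open>k \<in> K\<close> by (metis uniq)
  qed
  have dec: "\<exists>h\<in>H. \<exists>k\<in>K. x = h \<oplus>\<^bsub>M\<^esub> k" if "x \<in> carrier M" for x
    using sum that by (metis mem_set_add)
  have "mod_hom R M (M\<lparr>carrier := H\<rparr>) p"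
  proof (intro mod_homI)
    fix x assume "x \<in> carrier M"
    then obtain h k where x: "h \<in> H" "k \<in> K" "x = h \<oplus>\<^bsub>M\<^esub> k"
      using dec by blast
    then show "p x \<in> carrier (M\<lparr>carrier := H\<rparr>)"
      by (simp add: p)
    fix y assume "y \<in> carrier M"
    then obtain h' k' where y: "h' \<in> H" "k' \<in> K" "y = h' \<oplus>\<^bsub>M\<^esub> k'"
      using dec by blast
    have "x \<oplus>\<^bsub>M\<^esub> y = (h \<oplus>\<^bsub>M\<^esub> h') \<oplus>\<^bsub>M\<^esub> (k \<oplus>\<^bsub>M\<^esub> k')"
      using x y Hc Kc by (simp add: M.M.a_ac)
    then show "p (x \<oplus>\<^bsub>M\<^esub> y) = p x \<oplus>\<^bsub>M\<lparr>carrier := H\<rparr>\<^esub> p y"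
      using x y submodule_add[OF H x(1) y(1)] submodule_add[OF K x(2) y(2)] by (simp add: p)
  next
    fix r x assume r: "r \<in> carrier R" and "x \<in> carrier M"
    then obtain h k where x: "h \<in> H" "k \<in> K" "x = h \<oplus>\<^bsub>M\<^esub> k"
      using dec by blast
    then show "p (r \<odot>\<^bsub>M\<^esub> x) = r \<odot>\<^bsub>M\<lparr>carrier := H\<rparr>\<^esub> p x"
      using r Hc Kc submodule_smult[OF H r x(1)] submodule_smult[OF K r x(2)]
      by (simp add: p M.smult_r_distr)
  qed
  moreover have "p x = x" if "x \<in> H" for x
    using p[OF that submodule_zero[OF K]] that Hc by simp
  ultimately show ?thesis
    by blast
qed

text \<open>The standard dual basis of the free module is carried over by the two maps that exhibit
  \<open>P\<close> as a retract: coordinates are read after the embedding, and unit vectors are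
  pushed down through the projection.\<close>

lemma fg_projective_dual_basis:
  assumes "fg_projective R P"
  shows "\<exists>n e \<phi>. mod_dual_basis R P n e \<phi>"
proof -
  obtain n H h where P: "module R P" and H: "direct_summand H R (free_mod R n)"
      and h: "mod_hom R P ((free_mod R n)\<lparr>carrier := H\<rparr>) h"
      and bij: "bij_betw h (carrier P) H"
    using assms by (auto simp: fg_projective_def mod_isomorphic_def)
  let ?F = "free_mod R n" and ?H = "(free_mod R n)\<lparr>carrier := H\<rparr>"
  have R: "cring R"
    using P by (rule module.axioms)
  have F: "module R ?F"
    by (rule module_free_mod[OF R])
  have sub: "submodule H R ?F"
    using H by (simp add: direct_summand_def)
  have mH: "module R ?H"
    by (rule module_restrict[OF F sub])
  obtain p where p: "mod_hom R ?F ?H p" "\<And>x. x \<in> H \<Longrightarrow> p x = x"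
    using direct_summand_projection[OF F H] by blast
  define g where "g = the_inv_into (carrier P) h"
  have g: "mod_hom R ?H P g"
    unfolding g_def by (rule mod_hom_inv[OF P h]) (simp add: bij)
  note gp = mod_hom_comp[OF p(1) g]
  note hc = mod_hom_comp[OF h mod_hom_incl[OF sub]]
  have basis: "unit_vec R n \<in> family ?F n" "\<And>x. x \<in> carrier ?F \<Longrightarrow> lincomb ?F n x (unit_vec R n) = x"
    using mod_dual_basis_free_mod[OF R] by (auto simp: mod_dual_basis_def)
  have "lincomb P n (\<lambda>i. h x i) (\<lambda>i. g (p (unit_vec R n i))) = x" if x: "x \<in> carrier P" for x
  proof -
    have hx: "h x \<in> carrier ?F" "h x \<in> H"
      using mod_hom_closed[OF hc x] mod_hom_closed[OF h x] by auto
    then have c: "h x \<in> coeffs R n"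
      by (auto simp: PiE_iff)
    have "g (p (lincomb ?F n (h x) (unit_vec R n))) = g (p (h x))"
      using basis(2)[OF hx(1)] by simp
    also have "\<dots> = x"
      using hx p(2) x bij by (simp add: g_def bij_betw_def the_inv_into_f_f)
    finally show ?thesis
      using lincomb_hom[OF F P gp c basis(1)] by simp
  qed
  moreover have "functional R P (\<lambda>x. h x i)" if "i < n" for i
    by (rule mod_hom_comp[OF hc functional_coord[OF that]])
  moreover have "(\<lambda>i. g (p (unit_vec R n i))) \<in> family P n"
    using basis(1) mod_hom_closed[OF gp] by (auto simp: Pi_iff simp del: free_mod_simps)
  ultimately have "mod_dual_basis R P n (\<lambda>i. g (p (unit_vec R n i))) (\<lambda>i x. h x i)"
    by (simp add: mod_dual_basis_def)
  then show ?thesis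
    by blast
qed

text \<open>The coordinate map \<open>E\<close> into the free module has the left inverse
  \<open>L\<close> by the expansion property, so the image of \<open>E\<close> is a summand with the
  kernel of \<open>L\<close> as complement.\<close>

lemma fg_projectiveI:
  assumes P: "module R P" and db: "mod_dual_basis R P n e \<phi>"
  shows "fg_projective R P"
proof -
  interpret P: module R P by fact
  let ?F = "free_mod R n"
  have R: "cring R"
    using P by (rule module.axioms)
  have F: "module R ?F"
    by (rule module_free_mod[OF R])
  interpret F: module R ?F by fact
  have e: "e \<in> family P n" and \<phi>: "\<And>i. i < n \<Longrightarrow> functional R P (\<phi> i)"
      and dec: "\<And>x. x \<in> carrier P \<Longrightarrow> lincomb P n (\<lambda>i. \<phi> i x) e = x"
    using db by (auto simp: mod_dual_basis_def)
  define E where "E x = (\<lambda>i\<in>{..<n}. \<phi> i x)" for x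
  define L where "L r = lincomb P n r e" for r
  have E: "mod_hom R P ?F E"
    unfolding E_def
    by (intro mod_homI)
      (auto simp: mod_hom_add[OF \<phi>] mod_hom_smult[OF \<phi>] functional_closed[OF \<phi>] intro!: restrict_ext)
  have L: "mod_hom R ?F P L"
    unfolding L_def by (rule mod_hom_lincomb_free[OF P e])
  have LE: "L (E x) = x" if x: "x \<in> carrier P" for x
  proof -
    have "L (E x) = lincomb P n (\<lambda>i. \<phi> i x) e"
      unfolding L_def E_def using x
      by (intro lincomb_cong[OF P _ e]) (auto simp: functional_closed[OF \<phi>])
    then show ?thesis
      using dec[OF x] by simp
  qed
  let ?H = "E ` carrier P" and ?K = "a_kernel ?F P L"
  have sub: "submodule ?H R ?F" "submodule ?K R ?F"
    by (rule submodule_image[OF P F E], rule submodule_kernel[OF F P L])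
  have "r \<in> {\<zero>\<^bsub>?F\<^esub>}" if rH: "r \<in> ?H" and rK: "r \<in> ?K" for r
  proof -
    obtain x where x: "r = E x" "x \<in> carrier P"
      using rH by blast
    have "L r = \<zero>\<^bsub>P\<^esub>"
      using rK by (simp add: mem_a_kernel)
    then have "E x = E \<zero>\<^bsub>P\<^esub>"
      unfolding x(1) LE[OF x(2)] by (rule arg_cong)
    then show ?thesis
      unfolding x(1) mod_hom_zero[OF P F E] by simp
  qed
  then have "?H \<inter> ?K = {\<zero>\<^bsub>?F\<^esub>}"
    using IntI[OF submodule_zero[OF sub(1)] submodule_zero[OF sub(2)]]
    by blast
  moreover have "?H <+>\<^bsub>?F\<^esub> ?K = carrier ?F"
  proof (intro subset_antisym subsetI)
    fix r assume "r \<in> ?H <+>\<^bsub>?F\<^esub> ?K"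
    then obtain h k where "h \<in> ?H" "k \<in> ?K" "r = h \<oplus>\<^bsub>?F\<^esub> k"
      unfolding mem_set_add by (elim bexE)
    then show "r \<in> carrier ?F"
      using submodule_subset[OF sub(1)] submodule_subset[OF sub(2)] F.M.a_closed by blast
  next
    fix r assume r: "r \<in> carrier ?F"
    let ?k = "r \<ominus>\<^bsub>?F\<^esub> E (L r)"
    have c: "L r \<in> carrier P" "E (L r) \<in> carrier ?F"
      using mod_hom_closed[OF L r] mod_hom_closed[OF E] by blast+
    have k: "?k \<in> carrier ?F"
      by (rule F.M.minus_closed[OF r c(2)])
    have "L ?k = L r \<ominus>\<^bsub>P\<^esub> L (E (L r))"
      by (rule mod_hom_diff[OF F P L r c(2)])
    also have "\<dots> = \<zero>\<^bsub>P\<^esub>"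
      unfolding LE[OF c(1)] by (rule diff_self[OF P c(1)])
    finally have "?k \<in> ?K"
      using k unfolding mem_a_kernel by blast
    moreover have "r = E (L r) \<oplus>\<^bsub>?F\<^esub> ?k"
      by (rule diff_add_cancel[OF F r c(2), symmetric])
    ultimately show "r \<in> ?H <+>\<^bsub>?F\<^esub> ?K"
      unfolding mem_set_add using imageI[OF c(1), of E] by (intro bexI)
  qed
  ultimately have "direct_summand ?H R ?F"
    using sub by (auto simp: direct_summand_def)
  moreover have "mod_isomorphic R P (?F\<lparr>carrier := ?H\<rparr>)"
    unfolding mod_isomorphic_def
  proof (intro exI conjI)
    show "mod_hom R P (?F\<lparr>carrier := ?H\<rparr>) E"
      using mod_hom_add[OF E] mod_hom_smult[OF E] by (intro mod_homI) auto
    show "bij_betw E (carrier P) (carrier (?F\<lparr>carrier := ?H\<rparr>))"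
      using LE by (auto simp: bij_betw_def intro: inj_on_inverseI)
  qed
  ultimately show ?thesis
    using P unfolding fg_projective_def by (intro conjI exI[of _ n] exI[of _ ?H])
qed

text \<open>Provides copies with elements of type \<open>nat \<Rightarrow> 'a\<close>, as
  \<open>projective_mobj\<close> requires.\<close>

lemma fg_projective_copy:
  fixes R :: "('a, 'm) ring_scheme"
  assumes "fg_projective R P"
  shows "\<exists>(Q :: ('a, nat \<Rightarrow> 'a) module) h. fg_projective R Q \<and> mod_hom R P Q h \<and>
           bij_betw h (carrier P) (carrier Q)"
proof -
  obtain n H h where P: "module R P" and H: "direct_summand H R (free_mod R n)"
      and h: "mod_hom R P ((free_mod R n)\<lparr>carrier := H\<rparr>) h"
      and bij: "bij_betw h (carrier P) H"
    using assms by (auto simp: fg_projective_def mod_isomorphic_def)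
  let ?H = "(free_mod R n)\<lparr>carrier := H\<rparr>"
  have "module R ?H"
    using H by (intro module_restrict[OF module_free_mod[OF module.axioms(1)[OF P]]])
      (simp add: direct_summand_def)
  moreover have "mod_isomorphic R ?H ?H"
    unfolding mod_isomorphic_def by (intro exI[of _ "\<lambda>x. x"]) (simp add: mod_hom_id bij_betw_def)
  ultimately have "fg_projective R ?H"
    using H unfolding fg_projective_def by (intro conjI exI[of _ n] exI[of _ H])
  moreover have "bij_betw h (carrier P) (carrier ?H)"
    using bij by simp
  ultimately have "\<exists>h. fg_projective R ?H \<and> mod_hom R P ?H h \<and> bij_betw h (carrier P) (carrier ?H)"
    using h by (intro exI[of _ h] conjI)
  then show ?thesis
    by (rule exI[of _ ?H])
qed


section \<open>Projective objects in the category of homomorphisms\<close>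

text \<open>Finite generation is left out because kernels and duals do not inherit it formally,
  while most arguments use only the homomorphism.\<close>

definition wf_mobj :: "('a, 'm) ring_scheme \<Rightarrow> ('a, 'b, 'c) mobj \<Rightarrow> bool" where
  "wf_mobj R f \<longleftrightarrow> module R (src f) \<and> module R (tgt f) \<and> mod_hom R (src f) (tgt f) (arr f)"

lemma is_mobj_imp_wf: "is_mobj R f \<Longrightarrow> wf_mobj R f"
  by (simp add: is_mobj_def wf_mobj_def fg_module_def)

text \<open>
  An object is projective iff it is a monomorphism with such a dual basis: the \<open>\<phi>\<close> are
  morphisms to \<open>R = R\<close>, the \<open>\<psi>\<close> are morphisms to \<open>0 \<rightarrow> R\<close>, and the families \<open>e\<close> and \<open>d\<close> are
  morphisms from \<open>R = R\<close> and from \<open>0 \<rightarrow> R\<close>.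
\<close>

definition dual_basis ::
    "('a, 'm) ring_scheme \<Rightarrow> ('a, 'b, 'c) mobj \<Rightarrow> nat \<Rightarrow> (nat \<Rightarrow> 'b) \<Rightarrow> (nat \<Rightarrow> 'c \<Rightarrow> 'a) \<Rightarrow>
     nat \<Rightarrow> (nat \<Rightarrow> 'c) \<Rightarrow> (nat \<Rightarrow> 'c \<Rightarrow> 'a) \<Rightarrow> bool" where
  "dual_basis R p n e \<phi> m d \<psi> \<longleftrightarrow> wf_mobj R p \<and> inj_on (arr p) (carrier (src p)) \<and>
     e \<in> family (src p) n \<and> d \<in> family (tgt p) m \<and>
     (\<forall>i<n. functional R (tgt p) (\<phi> i)) \<and> (\<forall>j<m. functional R (tgt p) (\<psi> j)) \<and>
     (\<forall>j<m. \<forall>x\<in>carrier (src p). \<psi> j (arr p x) = \<zero>\<^bsub>R\<^esub>) \<and>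
     (\<forall>y\<in>carrier (tgt p). arr p (lincomb (src p) n (\<lambda>i. \<phi> i y) e) \<oplus>\<^bsub>tgt p\<^esub>
                             lincomb (tgt p) m (\<lambda>j. \<psi> j y) d = y)"

context
  fixes R :: "('a, 'm) ring_scheme" and p :: "('a, 'b, 'c) mobj" and n e \<phi> m d \<psi>
  assumes db: "dual_basis R p n e \<phi> m d \<psi>"
begin

lemma dual_basisD:
  shows "module R (src p)" "module R (tgt p)" "mod_hom R (src p) (tgt p) (arr p)"
    and "inj_on (arr p) (carrier (src p))" "e \<in> family (src p) n" "d \<in> family (tgt p) m"
    and "\<And>i. i < n \<Longrightarrow> functional R (tgt p) (\<phi> i)" "\<And>j. j < m \<Longrightarrow> functional R (tgt p) (\<psi> j)"
    and "\<And>j x. j < m \<Longrightarrow> x \<in> carrier (src p) \<Longrightarrow> \<psi> j (arr p x) = \<zero>\<^bsub>R\<^esub>"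
    and "\<And>y. y \<in> carrier (tgt p) \<Longrightarrow> arr p (lincomb (src p) n (\<lambda>i. \<phi> i y) e) \<oplus>\<^bsub>tgt p\<^esub>
           lincomb (tgt p) m (\<lambda>j. \<psi> j y) d = y"
  using db by (auto simp: dual_basis_def wf_mobj_def)

text \<open>The \<psi> vanish on the image of the source, so the expansion of \<open>arr p x\<close>
  has only its \<phi> part, and injectivity cancels \<open>arr p\<close>. Thus the \<phi> part is a
  retraction of \<open>arr p\<close>.\<close>

lemma dual_basis_arr:
  assumes x: "x \<in> carrier (src p)"
  shows "lincomb (src p) n (\<lambda>i. \<phi> i (arr p x)) e = x"
    and "lincomb (tgt p) m (\<lambda>j. \<psi> j (arr p x)) d = \<zero>\<^bsub>tgt p\<^esub>"
proof -
  interpret T: module R "tgt p"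
    by (rule dual_basisD(2))
  let ?s = "lincomb (src p) n (\<lambda>i. \<phi> i (arr p x)) e"
  have ax: "arr p x \<in> carrier (tgt p)"
    by (rule mod_hom_closed[OF dual_basisD(3) x])
  have s: "?s \<in> carrier (src p)"
    by (rule lincomb_closed[OF dual_basisD(1) _ dual_basisD(5)])
      (auto intro: functional_closed[OF dual_basisD(7)] ax)
  have "lincomb (tgt p) m (\<lambda>j. \<psi> j (arr p x)) d = lincomb (tgt p) m (\<lambda>j. \<zero>\<^bsub>R\<^esub>) d"
    by (rule lincomb_cong[OF dual_basisD(2) _ dual_basisD(6)])
      (auto intro: functional_closed[OF dual_basisD(8)] ax simp: dual_basisD(9)[OF _ x])
  then show 0: "lincomb (tgt p) m (\<lambda>j. \<psi> j (arr p x)) d = \<zero>\<^bsub>tgt p\<^esub>"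
    by (simp add: lincomb_zero[OF dual_basisD(2,6)])
  have "arr p ?s = arr p x"
    using dual_basisD(10)[OF ax] mod_hom_closed[OF dual_basisD(3) s] by (simp add: 0)
  then show "?s = x"
    using dual_basisD(4) s x by (auto simp: inj_on_def)
qed

lemma dual_basis_retraction:
  "mod_hom R (tgt p) (src p) (\<lambda>y. lincomb (src p) n (\<lambda>i. \<phi> i y) e)"
  by (rule mod_hom_lincomb[OF dual_basisD(1,7,5)])

lemma dual_basis_coretraction:
  "mod_hom R (tgt p) (tgt p) (\<lambda>y. lincomb (tgt p) m (\<lambda>j. \<psi> j y) d)"
  by (rule mod_hom_lincomb[OF dual_basisD(2,8,6)])

lemma dual_basis_generates_src: "generates R (src p) n e"
proof -
  have "\<exists>r\<in>coeffs R n. x = lincomb (src p) n r e" if "x \<in> carrier (src p)" for x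
    using dual_basis_arr(1)[OF that] functional_closed[OF dual_basisD(7)]
      mod_hom_closed[OF dual_basisD(3) that]
    by (intro bexI[of _ "\<lambda>i. \<phi> i (arr p x)"]) auto
  then show ?thesis
    using dual_basisD(5) by (auto simp: generates_def)
qed

lemma dual_basis_generates_tgt:
  "generates R (tgt p) (n + m) (\<lambda>i. if i < n then arr p (e i) else d (i - n))"
proof -
  have ae: "(\<lambda>i. arr p (e i)) \<in> family (tgt p) n"
    using dual_basisD(5) mod_hom_closed[OF dual_basisD(3)] by auto
  have "\<exists>r\<in>coeffs R (n + m). y = lincomb (tgt p) (n + m) r (\<lambda>i. if i < n then arr p (e i) else d (i - n))"
    if y: "y \<in> carrier (tgt p)" for y
  proof -
    have c: "(\<lambda>i. \<phi> i y) \<in> coeffs R n" "(\<lambda>j. \<psi> j y) \<in> coeffs R m"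
      using functional_closed[OF dual_basisD(7)] functional_closed[OF dual_basisD(8)] y by auto
    have "arr p (lincomb (src p) n (\<lambda>i. \<phi> i y) e) = lincomb (tgt p) n (\<lambda>i. \<phi> i y) (\<lambda>i. arr p (e i))"
      by (rule lincomb_hom[OF dual_basisD(1-3) c(1) dual_basisD(5)])
    then have "y = lincomb (tgt p) n (\<lambda>i. \<phi> i y) (\<lambda>i. arr p (e i)) \<oplus>\<^bsub>tgt p\<^esub>
        lincomb (tgt p) m (\<lambda>j. \<psi> j y) d"
      using dual_basisD(10)[OF y] by simp
    then show ?thesis
      using c lincomb_append[OF dual_basisD(2) c(1) ae c(2) dual_basisD(6)]
      by (intro bexI[of _ "\<lambda>i. if i < n then \<phi> i y else \<psi> (i - n) y"]) (auto simp: Pi_iff)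
  qed
  then show ?thesis
    using ae dual_basisD(6) by (auto simp: generates_def Pi_iff)
qed

lemma is_mobj_dual_basis: "is_mobj R p"
  using dual_basisD(1-3) dual_basis_generates_src dual_basis_generates_tgt
  by (auto simp: is_mobj_def fg_module_iff)

text \<open>The retraction \<open>s\<close> splits the target into the image of the source and the
  kernel of \<open>s\<close>, on which \<open>t\<close> is the identity. The \<phi> show that the
  source is projective, the \<psi> that the kernel is; these give the two summands of the standard
  form.\<close>

lemma projective_mobj_dual_basis: "projective_mobj R p"
proof -
  let ?S = "src p" and ?T = "tgt p"
  interpret S: module R ?S by (rule dual_basisD(1))
  interpret T: module R ?T by (rule dual_basisD(2))
  define s where "s y = lincomb ?S n (\<lambda>i. \<phi> i y) e" for y
  define t where "t y = lincomb ?T m (\<lambda>j. \<psi> j y) d" for y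
  note arr = dual_basisD(3)
  have s: "mod_hom R ?T ?S s" and t: "mod_hom R ?T ?T t"
    unfolding s_def t_def by (fact dual_basis_retraction, fact dual_basis_coretraction)
  have dec: "arr p (s y) \<oplus>\<^bsub>?T\<^esub> t y = y" if "y \<in> carrier ?T" for y
    using dual_basisD(10)[OF that] by (simp add: s_def t_def)
  have sarr: "s (arr p x) = x" and tarr: "t (arr p x) = \<zero>\<^bsub>?T\<^esub>" if "x \<in> carrier ?S" for x
    using dual_basis_arr[OF that] by (simp_all add: s_def t_def)
  note sc = mod_hom_closed[OF s] and tc = mod_hom_closed[OF t] and ac = mod_hom_closed[OF arr]
  \<comment> \<open>Apply \<open>s\<close> to the decomposition of \<open>y\<close> and cancel
    \<open>s y\<close>, since \<open>s\<close> retracts \<open>arr p\<close>.\<close>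
  have st: "s (t y) = \<zero>\<^bsub>?S\<^esub>" if y: "y \<in> carrier ?T" for y
  proof -
    have "s y = s (arr p (s y) \<oplus>\<^bsub>?T\<^esub> t y)"
      using dec[OF y] by simp
    also have "\<dots> = s y \<oplus>\<^bsub>?S\<^esub> s (t y)"
      using y by (simp add: mod_hom_add[OF s] ac sc tc sarr)
    finally show ?thesis
      using S.M.add.l_cancel_one'[of "s y" "s (t y)"] sc tc y by simp
  qed
  have tt: "t y = y" if "y \<in> carrier ?T" "s y = \<zero>\<^bsub>?S\<^esub>" for y
  proof -
    have "y = \<zero>\<^bsub>?T\<^esub> \<oplus>\<^bsub>?T\<^esub> t y"
      using dec[OF that(1)] unfolding that(2) mod_hom_zero[OF dual_basisD(1,2) arr] by (rule sym)
    then show ?thesis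
      unfolding T.M.l_zero[OF tc[OF that(1)]] by (rule sym)
  qed
  let ?K = "a_kernel ?T ?S s" and ?N = "?T\<lparr>carrier := a_kernel ?T ?S s\<rparr>"
  have K: "submodule ?K R ?T"
    by (rule submodule_kernel[OF dual_basisD(2,1) s])
  have N: "module R ?N"
    by (rule module_restrict[OF dual_basisD(2) K])
  have "mod_dual_basis R ?S n e (\<lambda>i x. \<phi> i (arr p x))"
    using dual_basis_arr(1) mod_hom_comp[OF arr dual_basisD(7)] dual_basisD(5)
    by (simp add: mod_dual_basis_def)
  then have fpS: "fg_projective R ?S"
    by (rule fg_projectiveI[OF dual_basisD(1)])
  \<comment> \<open>The \<open>d j\<close> need not lie in the kernel of \<open>s\<close>; their
    projections \<open>t (d j)\<close> do, and they still expand every element of that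
    kernel.\<close>
  have "lincomb ?N m (\<lambda>j. \<psi> j y) (\<lambda>j. t (d j)) = y" if y: "y \<in> ?K" for y
  proof -
    have y': "y \<in> carrier ?T" "s y = \<zero>\<^bsub>?S\<^esub>"
      using y by (auto simp: mem_a_kernel)
    have c: "(\<lambda>j. \<psi> j y) \<in> coeffs R m"
      using functional_closed[OF dual_basisD(8)] y' by auto
    have "lincomb ?N m (\<lambda>j. \<psi> j y) (\<lambda>j. t (d j)) = lincomb ?T m (\<lambda>j. \<psi> j y) (\<lambda>j. t (d j))"
      using dual_basisD(6) st tc by (intro lincomb_restrict[OF dual_basisD(2) K c]) (auto simp: mem_a_kernel Pi_iff)
    also have "\<dots> = t (t y)"
      using lincomb_hom[OF dual_basisD(2,2) t c dual_basisD(6)] by (simp add: t_def)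
    finally show ?thesis
      using tt y' by simp
  qed
  moreover have "functional R ?N (\<psi> j)" if "j < m" for j
    by (rule mod_hom_comp[OF mod_hom_incl[OF K] dual_basisD(8)[OF that]])
  moreover have "(\<lambda>j. t (d j)) \<in> family ?N m"
    using dual_basisD(6) st tc by (auto simp: mem_a_kernel Pi_iff)
  ultimately have "mod_dual_basis R ?N m (\<lambda>j. t (d j)) \<psi>"
    by (simp add: mod_dual_basis_def)
  then have fpN: "fg_projective R ?N"
    by (rule fg_projectiveI[OF N])
  obtain P :: "('a, nat \<Rightarrow> 'a) module" and g where P: "fg_projective R P" "mod_hom R ?S P g"
      and g: "bij_betw g (carrier ?S) (carrier P)"
    using fg_projective_copy[OF fpS] by blast
  obtain Q :: "('a, nat \<Rightarrow> 'a) module" and h where Q: "fg_projective R Q" "mod_hom R ?N Q h"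
      and h: "bij_betw h ?K (carrier Q)"
    using fg_projective_copy[OF fpN] by auto
  have mP: "module R P" and mQ: "module R Q"
    using P Q by (auto simp: fg_projective_def)
  have tK: "t y \<in> ?K" if "y \<in> carrier ?T" for y
    using that by (simp add: mem_a_kernel tc st)
  have tN: "mod_hom R ?T ?N t"
    using tK mod_hom_add[OF t] mod_hom_smult[OF t] by (intro mod_homI) auto
  note ht = mod_hom_comp[OF tN Q(2)] and gs = mod_hom_comp[OF s P(2)]
  \<comment> \<open>\<open>?\<beta>\<close> records the two components of \<open>y\<close>,
    transported to the copies \<open>P\<close> and \<open>Q\<close>.\<close>
  let ?\<alpha> = "\<lambda>x. (g x, ())" and ?\<beta> = "\<lambda>y. (g (s y), h (t y))"
  let ?D = "dsum_mobj (id_mobj P) (from_zero_mobj Q)"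
  have "mobj_hom R p ?D (?\<alpha>, ?\<beta>)"
    unfolding mobj_hom_def
  proof (intro conjI ballI)
    show "mod_hom R ?S (src ?D) (fst (?\<alpha>, ?\<beta>))"
      using mod_hom_closed[OF P(2)] mod_hom_add[OF P(2)] mod_hom_smult[OF P(2)]
      by (intro mod_homI)
        (simp_all add: dsum_mobj_def id_mobj_def from_zero_mobj_def zero_mod_def)
    show "mod_hom R ?T (tgt ?D) (snd (?\<alpha>, ?\<beta>))"
      using mod_hom_closed[OF ht] mod_hom_add[OF ht] mod_hom_smult[OF ht]
        mod_hom_closed[OF gs] mod_hom_add[OF gs] mod_hom_smult[OF gs]
      by (intro mod_homI) (simp_all add: dsum_mobj_def id_mobj_def from_zero_mobj_def)
    show "snd (?\<alpha>, ?\<beta>) (arr p x) = arr ?D (fst (?\<alpha>, ?\<beta>) x)" if "x \<in> carrier ?S" for x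
      using that mod_hom_zero[OF N mQ Q(2)]
      by (simp add: dsum_mobj_def id_mobj_def from_zero_mobj_def sarr tarr)
  qed
  moreover have "bij_betw ?\<alpha> (carrier ?S) (carrier (src ?D))"
  proof (rule bij_betwI')
    show "(?\<alpha> x = ?\<alpha> x') = (x = x')" if "x \<in> carrier ?S" "x' \<in> carrier ?S" for x x'
      using bij_betw_imp_inj_on[OF g] that by (simp add: inj_on_eq_iff)
    show "?\<alpha> x \<in> carrier (src ?D)" if "x \<in> carrier ?S" for x
      using mod_hom_closed[OF P(2) that]
      by (simp add: dsum_mobj_def id_mobj_def from_zero_mobj_def zero_mod_def)
    show "\<exists>x\<in>carrier ?S. z = ?\<alpha> x" if "z \<in> carrier (src ?D)" for z
      using that bij_betw_imp_surj_on[OF g]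
      by (cases z) (auto simp: dsum_mobj_def id_mobj_def from_zero_mobj_def zero_mod_def)
  qed
  moreover have "bij_betw ?\<beta> (carrier ?T) (carrier (tgt ?D))"
  proof (rule bij_betwI')
    fix y y' assume y: "y \<in> carrier ?T" and y': "y' \<in> carrier ?T"
    have "y = y'" if "g (s y) = g (s y')" "h (t y) = h (t y')"
    proof -
      have "s y = s y'" "t y = t y'"
        using inj_onD[OF bij_betw_imp_inj_on[OF g] that(1) sc[OF y] sc[OF y']]
          inj_onD[OF bij_betw_imp_inj_on[OF h] that(2) tK[OF y] tK[OF y']] by blast+
      then show ?thesis
        using dec[OF y] dec[OF y'] by metis
    qed
    then show "(?\<beta> y = ?\<beta> y') = (y = y')"
      by auto
    show "?\<beta> y \<in> carrier (tgt ?D)"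
      using y mod_hom_closed[OF ht] mod_hom_closed[OF gs]
      by (simp add: dsum_mobj_def id_mobj_def from_zero_mobj_def)
  next
    fix z assume "z \<in> carrier (tgt ?D)"
    then obtain a b where z: "z = (a, b)" "a \<in> carrier P" "b \<in> carrier Q"
      by (auto simp: dsum_mobj_def id_mobj_def from_zero_mobj_def)
    obtain x where x: "x \<in> carrier ?S" "a = g x"
      using z(2) g by (auto simp: bij_betw_def)
    have "b \<in> h ` ?K"
      using z(3) bij_betw_imp_surj_on[OF h] by simp
    then obtain y where "y \<in> ?K" "b = h y"
      by blast
    then have y: "y \<in> carrier ?T" "s y = \<zero>\<^bsub>?S\<^esub>" "b = h y"
      by (simp_all add: mem_a_kernel)
    have "s (arr p x \<oplus>\<^bsub>?T\<^esub> y) = x" "t (arr p x \<oplus>\<^bsub>?T\<^esub> y) = y"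
      using x y by (simp_all add: mod_hom_add[OF s] mod_hom_add[OF t] ac sarr tarr tt)
    then show "\<exists>w\<in>carrier ?T. z = ?\<beta> w"
      using x y z(1) ac by (intro bexI[of _ "arr p x \<oplus>\<^bsub>?T\<^esub> y"]) auto
  qed
  ultimately have "mobj_isomorphic R p ?D"
    unfolding mobj_isomorphic_def by (intro exI[of _ "(?\<alpha>, ?\<beta>)"]) auto
  then show ?thesis
    using P(1) Q(1) is_mobj_dual_basis by (auto simp: projective_mobj_def)
qed

end

text \<open>Dual bases of the two projective modules are pulled back along the isomorphism with the
  standard form; \<open>b\<close> and \<open>c\<close> are the components of its target
  half.\<close>

lemma projective_mobj_imp_dual_basis:
  fixes p :: "('a, 'b, 'c) mobj"
  assumes "projective_mobj R p"
  shows "\<exists>n e \<phi> m d \<psi>. dual_basis R p n e \<phi> m d \<psi>"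
proof -
  obtain P Q :: "('a, nat \<Rightarrow> 'a) module" and \<alpha> \<beta> where P: "fg_projective R P" and Q: "fg_projective R Q"
      and hom: "mobj_hom R p (dsum_mobj (id_mobj P) (from_zero_mobj Q)) (\<alpha>, \<beta>)"
      and b\<alpha>: "bij_betw \<alpha> (carrier (src p)) (carrier P \<times> UNIV)"
      and b\<beta>: "bij_betw \<beta> (carrier (tgt p)) (carrier P \<times> carrier Q)"
    using assms
    by (auto simp: projective_mobj_def mobj_isomorphic_def dsum_mobj_def id_mobj_def
        from_zero_mobj_def zero_mod_def)
  have wf: "wf_mobj R p"
    using assms by (auto simp: projective_mobj_def is_mobj_imp_wf)
  let ?S = "src p" and ?T = "tgt p"
  have S: "module R ?S" and T: "module R ?T" and arr: "mod_hom R ?S ?T (arr p)"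
    using wf by (auto simp: wf_mobj_def)
  have mP: "module R P" and mQ: "module R Q"
    using P Q by (auto simp: fg_projective_def)
  interpret S: module R ?S by fact
  interpret T: module R ?T by fact
  interpret P: module R P by fact
  interpret Q: module R Q by fact
  obtain n e0 \<phi>0 where eP: "mod_dual_basis R P n e0 \<phi>0"
    using fg_projective_dual_basis[OF P] by blast
  obtain m d0 \<psi>0 where dQ: "mod_dual_basis R Q m d0 \<psi>0"
    using fg_projective_dual_basis[OF Q] by blast
  define a where "a = (\<lambda>x. fst (\<alpha> x))"
  define b where "b = (\<lambda>y. fst (\<beta> y))"
  define c where "c = (\<lambda>y. snd (\<beta> y))"
  have h\<alpha>: "mod_hom R ?S (dsum_mod P zero_mod) \<alpha>" and h\<beta>: "mod_hom R ?T (dsum_mod P Q) \<beta>"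
    using hom by (auto simp: mobj_hom_def dsum_mobj_def id_mobj_def from_zero_mobj_def)
  have a: "mod_hom R ?S P a"
    using mod_hom_closed[OF h\<alpha>] mod_hom_add[OF h\<alpha>] mod_hom_smult[OF h\<alpha>]
    by (intro mod_homI) (auto simp: a_def mem_Times_iff)
  have b: "mod_hom R ?T P b" and c: "mod_hom R ?T Q c"
    using mod_hom_closed[OF h\<beta>] mod_hom_add[OF h\<beta>] mod_hom_smult[OF h\<beta>]
    by (intro mod_homI; auto simp: b_def c_def mem_Times_iff)+
  have comm: "b (arr p x) = a x" "c (arr p x) = \<zero>\<^bsub>Q\<^esub>" if "x \<in> carrier ?S" for x
  proof -
    have "\<beta> (arr p x) = map_prod (\<lambda>x. x) (\<lambda>_. \<zero>\<^bsub>Q\<^esub>) (\<alpha> x)"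
      using hom that by (auto simp: mobj_hom_def dsum_mobj_def id_mobj_def from_zero_mobj_def)
    then show "b (arr p x) = a x" "c (arr p x) = \<zero>\<^bsub>Q\<^esub>"
      by (simp_all add: a_def b_def c_def)
  qed
  have inj_a: "x = x'" if "a x = a x'" "x \<in> carrier ?S" "x' \<in> carrier ?S" for x x'
    using that b\<alpha> by (auto simp: a_def bij_betw_def inj_on_def prod_eq_iff)
  have inj_bc: "y = y'" if "b y = b y'" "c y = c y'" "y \<in> carrier ?T" "y' \<in> carrier ?T" for y y'
    using that b\<beta> by (auto simp: b_def c_def bij_betw_def inj_on_def prod_eq_iff)
  have "\<exists>x\<in>carrier ?S. a x = u" if "u \<in> carrier P" for u
  proof -
    have "(u, ()) \<in> \<alpha> ` carrier ?S"
      using that b\<alpha> by (auto simp: bij_betw_def)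
    then obtain x where "x \<in> carrier ?S" "(u, ()) = \<alpha> x"
      by blast
    then show ?thesis
      unfolding a_def by (metis fst_conv)
  qed
  then obtain a' where a': "\<And>u. u \<in> carrier P \<Longrightarrow> a' u \<in> carrier ?S \<and> a (a' u) = u"
    by metis
  \<comment> \<open>Preimages are taken with zero component in \<open>P\<close>, so that the \<psi>
    part of an expansion leaves the \<phi> part unchanged.\<close>
  have "\<exists>y\<in>carrier ?T. b y = \<zero>\<^bsub>P\<^esub> \<and> c y = v" if "v \<in> carrier Q" for v
  proof -
    have "(\<zero>\<^bsub>P\<^esub>, v) \<in> \<beta> ` carrier ?T"
      using that b\<beta> by (auto simp: bij_betw_def)
    then obtain y where "y \<in> carrier ?T" "(\<zero>\<^bsub>P\<^esub>, v) = \<beta> y"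
      by blast
    then show ?thesis
      unfolding b_def c_def by (metis fst_conv snd_conv)
  qed
  then obtain c' where c': "\<And>v. v \<in> carrier Q \<Longrightarrow> c' v \<in> carrier ?T \<and> b (c' v) = \<zero>\<^bsub>P\<^esub> \<and> c (c' v) = v"
    by metis
  have e0: "e0 \<in> family P n" and \<phi>0: "\<And>i. i < n \<Longrightarrow> functional R P (\<phi>0 i)"
      and dec0: "\<And>u. u \<in> carrier P \<Longrightarrow> lincomb P n (\<lambda>i. \<phi>0 i u) e0 = u"
    using eP by (auto simp: mod_dual_basis_def)
  have d0: "d0 \<in> family Q m" and \<psi>0: "\<And>i. i < m \<Longrightarrow> functional R Q (\<psi>0 i)"
      and dec1: "\<And>v. v \<in> carrier Q \<Longrightarrow> lincomb Q m (\<lambda>i. \<psi>0 i v) d0 = v"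
    using dQ by (auto simp: mod_dual_basis_def)
  let ?e = "\<lambda>i. a' (e0 i)" and ?d = "\<lambda>j. c' (d0 j)"
  have e: "?e \<in> family ?S n" and d: "?d \<in> family ?T m"
    using e0 d0 a' c' by auto
  have "dual_basis R p n ?e (\<lambda>i y. \<phi>0 i (b y)) m ?d (\<lambda>j y. \<psi>0 j (c y))"
    unfolding dual_basis_def
  proof (intro conjI allI impI ballI)
    show "inj_on (arr p) (carrier ?S)"
      using comm(1) inj_a by (metis inj_onI)
    show "functional R ?T (\<lambda>y. \<phi>0 i (b y))" if "i < n" for i
      by (rule mod_hom_comp[OF b \<phi>0[OF that]])
    show "functional R ?T (\<lambda>y. \<psi>0 j (c y))" if "j < m" for j
      by (rule mod_hom_comp[OF c \<psi>0[OF that]])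
    show "\<psi>0 j (c (arr p x)) = \<zero>\<^bsub>R\<^esub>" if "j < m" "x \<in> carrier ?S" for j x
      using mod_hom_zero[OF mQ module_ring_mod[OF S.R.is_cring] \<psi>0[OF that(1)]] that(2)
      by (simp add: comm)
    fix y assume y: "y \<in> carrier ?T"
    have by_c: "b y \<in> carrier P" "c y \<in> carrier Q"
      using mod_hom_closed[OF b y] mod_hom_closed[OF c y] .
    have co: "(\<lambda>i. \<phi>0 i (b y)) \<in> coeffs R n" "(\<lambda>j. \<psi>0 j (c y)) \<in> coeffs R m"
      using functional_closed[OF \<phi>0] functional_closed[OF \<psi>0] by_c by auto
    let ?u = "lincomb ?S n (\<lambda>i. \<phi>0 i (b y)) ?e" and ?v = "lincomb ?T m (\<lambda>j. \<psi>0 j (c y)) ?d"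
    have u: "?u \<in> carrier ?S" and v: "?v \<in> carrier ?T"
      by (rule lincomb_closed[OF S co(1) e], rule lincomb_closed[OF T co(2) d])
    have au: "arr p ?u \<in> carrier ?T"
      by (rule mod_hom_closed[OF arr u])
    have "a ?u = lincomb P n (\<lambda>i. \<phi>0 i (b y)) (\<lambda>i. a (?e i))"
      by (rule lincomb_hom[OF S mP a co(1) e])
    also have "\<dots> = lincomb P n (\<lambda>i. \<phi>0 i (b y)) e0"
      using e0 a' co(1) by (intro lincomb_cong[OF mP]) (auto simp: Pi_iff)
    finally have a_u: "a ?u = b y"
      using dec0[OF by_c(1)] by simp
    have "b ?v = lincomb P m (\<lambda>j. \<psi>0 j (c y)) (\<lambda>j. b (?d j))"
      by (rule lincomb_hom[OF T mP b co(2) d])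
    also have "\<dots> \<in> {\<zero>\<^bsub>P\<^esub>}"
    proof (rule lincomb_in_submodule[OF mP _ co(2)])
      show "submodule {\<zero>\<^bsub>P\<^esub>} R P"
        by (rule P.submoduleI) auto
      show "(\<lambda>j. b (?d j)) \<in> {..<m} \<rightarrow> {\<zero>\<^bsub>P\<^esub>}"
        using d0 c' by auto
    qed
    finally have b_v: "b ?v = \<zero>\<^bsub>P\<^esub>"
      by simp
    have "c ?v = lincomb Q m (\<lambda>j. \<psi>0 j (c y)) (\<lambda>j. c (?d j))"
      by (rule lincomb_hom[OF T mQ c co(2) d])
    also have "\<dots> = lincomb Q m (\<lambda>j. \<psi>0 j (c y)) d0"
      using d0 c' co(2) by (intro lincomb_cong[OF mQ]) (auto simp: Pi_iff)
    finally have c_v: "c ?v = c y"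
      using dec1[OF by_c(2)] by simp
    show "arr p ?u \<oplus>\<^bsub>?T\<^esub> ?v = y"
    proof (rule inj_bc)
      show "b (arr p ?u \<oplus>\<^bsub>?T\<^esub> ?v) = b y"
        using by_c by (simp add: mod_hom_add[OF b au v] comm u a_u b_v)
      show "c (arr p ?u \<oplus>\<^bsub>?T\<^esub> ?v) = c y"
        using by_c by (simp add: mod_hom_add[OF c au v] comm u c_v)
    qed (use au v y in auto)
  qed (use wf e d in auto)
  then show ?thesis
    by blast
qed


section \<open>Projective covers\<close>

definition mobj_onto ::
    "('a, 'b, 'c) mobj \<Rightarrow> ('a, 'd, 'e) mobj \<Rightarrow> ('b \<Rightarrow> 'd) \<times> ('c \<Rightarrow> 'e) \<Rightarrow> bool" where
  "mobj_onto f g \<pi> \<longleftrightarrow> fst \<pi> ` carrier (src f) = carrier (src g) \<and>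
     snd \<pi> ` carrier (tgt f) = carrier (tgt g)"

lemma wf_mobjD:
  assumes "wf_mobj R f"
  shows "module R (src f)" "module R (tgt f)" "mod_hom R (src f) (tgt f) (arr f)"
  using assms by (auto simp: wf_mobj_def)

lemma mobj_homD:
  assumes "mobj_hom R f g \<phi>"
  shows "mod_hom R (src f) (src g) (fst \<phi>)" "mod_hom R (tgt f) (tgt g) (snd \<phi>)"
    and "\<And>x. x \<in> carrier (src f) \<Longrightarrow> snd \<phi> (arr f x) = arr g (fst \<phi> x)"
  using assms by (auto simp: mobj_hom_def)

lemma projective_coverD:
  assumes "projective_cover R p f \<pi>"
  shows "\<exists>n e \<phi> m d \<psi>. dual_basis R p n e \<phi> m d \<psi>" "is_mobj R p" "wf_mobj R p"
    and "mobj_hom R p f \<pi>" "mobj_onto p f \<pi>"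
proof -
  have p: "projective_mobj R p"
    using assms by (simp add: projective_cover_def)
  then show "\<exists>n e \<phi> m d \<psi>. dual_basis R p n e \<phi> m d \<psi>"
    by (rule projective_mobj_imp_dual_basis)
  show "is_mobj R p"
    using p by (simp add: projective_mobj_def)
  then show "wf_mobj R p"
    by (rule is_mobj_imp_wf)
  show "mobj_hom R p f \<pi>" "mobj_onto p f \<pi>"
    using assms by (auto simp: projective_cover_def mobj_onto_def)
qed

section \<open>Lifting property and uniqueness of projective covers\<close>

text \<open>Generators of type R = R are lifted to source elements of \<open>X\<close>, those of
  type 0 -> R to target elements. Since the \<phi> are functionals on the whole target,
  \<open>s\<close> is defined on the target of \<open>p\<close>, and its composite with
  \<open>arr p\<close> is the source half of the lift.\<close>

lemma dual_basis_lift: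
  assumes db: "dual_basis R p n e \<phi> m d \<psi>" and X: "wf_mobj R X" and Y: "wf_mobj R Y"
    and \<pi>: "mobj_hom R X Y \<pi>" and onto: "mobj_onto X Y \<pi>" and g: "mobj_hom R p Y g"
  shows "\<exists>u. mobj_hom R p X u \<and> (\<forall>x\<in>carrier (src p). fst \<pi> (fst u x) = fst g x) \<and>
           (\<forall>y\<in>carrier (tgt p). snd \<pi> (snd u y) = snd g y)"
proof -
  note D = dual_basisD[OF db]
  note X' = wf_mobjD[OF X] and Y' = wf_mobjD[OF Y] and \<pi>' = mobj_homD[OF \<pi>] and g' = mobj_homD[OF g]
  interpret XT: module R "tgt X" by (rule X'(2))
  have "\<exists>a\<in>carrier (src X). fst \<pi> a = fst g (e i)" if "i < n" for i
  proof -
    have "fst g (e i) \<in> fst \<pi> ` carrier (src X)"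
      using mod_hom_closed[OF g'(1), of "e i"] D(5) that onto by (auto simp: mobj_onto_def)
    then show ?thesis
      by force
  qed
  then obtain a where a: "\<And>i. i < n \<Longrightarrow> a i \<in> carrier (src X) \<and> fst \<pi> (a i) = fst g (e i)"
    by metis
  have "\<exists>b\<in>carrier (tgt X). snd \<pi> b = snd g (d j)" if "j < m" for j
  proof -
    have "snd g (d j) \<in> snd \<pi> ` carrier (tgt X)"
      using mod_hom_closed[OF g'(2), of "d j"] D(6) that onto by (auto simp: mobj_onto_def)
    then show ?thesis
      by force
  qed
  then obtain b where b: "\<And>j. j < m \<Longrightarrow> b j \<in> carrier (tgt X) \<and> snd \<pi> (b j) = snd g (d j)"
    by metis
  have af: "a \<in> family (src X) n" and bf: "b \<in> family (tgt X) m"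
    using a b by auto
  define s where "s y = lincomb (src X) n (\<lambda>i. \<phi> i y) a" for y
  define t where "t y = lincomb (tgt X) m (\<lambda>j. \<psi> j y) b" for y
  have s: "mod_hom R (tgt p) (src X) s"
    unfolding s_def by (rule mod_hom_lincomb[OF X'(1) D(7) af])
  have t: "mod_hom R (tgt p) (tgt X) t"
    unfolding t_def by (rule mod_hom_lincomb[OF X'(2) D(8) bf])
  have c\<phi>: "(\<lambda>i. \<phi> i y) \<in> coeffs R n" and c\<psi>: "(\<lambda>j. \<psi> j y) \<in> coeffs R m" if "y \<in> carrier (tgt p)" for y
    using functional_closed[OF D(7)] functional_closed[OF D(8)] that by auto
  have \<pi>s: "fst \<pi> (s y) = fst g (lincomb (src p) n (\<lambda>i. \<phi> i y) e)" if y: "y \<in> carrier (tgt p)" for y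
  proof -
    have "fst \<pi> (s y) = lincomb (src Y) n (\<lambda>i. \<phi> i y) (\<lambda>i. fst \<pi> (a i))"
      unfolding s_def by (rule lincomb_hom[OF X'(1) Y'(1) \<pi>'(1) c\<phi>[OF y] af])
    also have "\<dots> = lincomb (src Y) n (\<lambda>i. \<phi> i y) (\<lambda>i. fst g (e i))"
      using a mod_hom_closed[OF \<pi>'(1)]
      by (intro lincomb_cong[OF Y'(1) c\<phi>[OF y]]) auto
    also have "\<dots> = fst g (lincomb (src p) n (\<lambda>i. \<phi> i y) e)"
      by (rule lincomb_hom[OF D(1) Y'(1) g'(1) c\<phi>[OF y] D(5), symmetric])
    finally show ?thesis .
  qed
  have \<pi>t: "snd \<pi> (t y) = snd g (lincomb (tgt p) m (\<lambda>j. \<psi> j y) d)" if y: "y \<in> carrier (tgt p)" for y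
  proof -
    have "snd \<pi> (t y) = lincomb (tgt Y) m (\<lambda>j. \<psi> j y) (\<lambda>j. snd \<pi> (b j))"
      unfolding t_def by (rule lincomb_hom[OF X'(2) Y'(2) \<pi>'(2) c\<psi>[OF y] bf])
    also have "\<dots> = lincomb (tgt Y) m (\<lambda>j. \<psi> j y) (\<lambda>j. snd g (d j))"
      using b mod_hom_closed[OF \<pi>'(2)]
      by (intro lincomb_cong[OF Y'(2) c\<psi>[OF y]]) auto
    also have "\<dots> = snd g (lincomb (tgt p) m (\<lambda>j. \<psi> j y) d)"
      by (rule lincomb_hom[OF D(2) Y'(2) g'(2) c\<psi>[OF y] D(6), symmetric])
    finally show ?thesis .
  qed
  note Dc = mod_hom_closed[OF D(3)]
  let ?u1 = "\<lambda>x. s (arr p x)" and ?u2 = "\<lambda>y. arr X (s y) \<oplus>\<^bsub>tgt X\<^esub> t y"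
  \<comment> \<open>On the image of the source the \<psi> part disappears, which makes the two
    halves of the lift compatible.\<close>
  have tarr: "t (arr p x) = \<zero>\<^bsub>tgt X\<^esub>" if x: "x \<in> carrier (src p)" for x
  proof -
    have "t (arr p x) = lincomb (tgt X) m (\<lambda>j. \<zero>\<^bsub>R\<^esub>) b"
      unfolding t_def by (rule lincomb_cong[OF X'(2) c\<psi>[OF Dc[OF x]] bf]) (simp_all add: D(9) x)
    then show ?thesis
      by (simp add: lincomb_zero[OF X'(2) bf])
  qed
  have u1: "mod_hom R (src p) (src X) ?u1"
    by (rule mod_hom_comp[OF D(3) s])
  have u2: "mod_hom R (tgt p) (tgt X) ?u2"
  proof (rule mod_hom_cong[OF D(2)])
    show "mod_hom R (tgt p) (tgt X) (\<lambda>y\<in>carrier (tgt p). arr X (s y) \<oplus>\<^bsub>tgt X\<^esub> t y)"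
      by (rule mod_hom_sum[OF D(2) X'(2) mod_hom_comp[OF s X'(3)] t])
  qed simp
  note sc = mod_hom_closed[OF s] and tc = mod_hom_closed[OF t] and aXc = mod_hom_closed[OF X'(3)]
  have "mobj_hom R p X (?u1, ?u2)"
    using u1 u2 tarr Dc sc aXc by (simp add: mobj_hom_def)
  moreover have "fst \<pi> (?u1 x) = fst g x" if x: "x \<in> carrier (src p)" for x
    using \<pi>s[OF Dc[OF x]] dual_basis_arr(1)[OF db x] by simp
  moreover have "snd \<pi> (?u2 y) = snd g y" if y: "y \<in> carrier (tgt p)" for y
  proof -
    let ?l = "lincomb (src p) n (\<lambda>i. \<phi> i y) e"
    have l: "?l \<in> carrier (src p)"
      by (rule lincomb_closed[OF D(1) c\<phi>[OF y] D(5)])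
    have "snd \<pi> (?u2 y) = snd \<pi> (arr X (s y)) \<oplus>\<^bsub>tgt Y\<^esub> snd \<pi> (t y)"
      by (rule mod_hom_add[OF \<pi>'(2) aXc[OF sc[OF y]] tc[OF y]])
    also have "snd \<pi> (arr X (s y)) = snd g (arr p ?l)"
      using \<pi>'(3)[OF sc[OF y]] \<pi>s[OF y] g'(3)[OF l] by simp
    also have "snd g (arr p ?l) \<oplus>\<^bsub>tgt Y\<^esub> snd \<pi> (t y) = snd g y"
      unfolding \<pi>t[OF y] using D(10)[OF y]
        mod_hom_add[OF g'(2) Dc[OF l] lincomb_closed[OF D(2) c\<psi>[OF y] D(6)]] by simp
    finally show ?thesis .
  qed
  ultimately show ?thesis
    by (intro exI[of _ "(?u1, ?u2)"]) simp
qed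

text \<open>The image of \<open>u\<close> is a subobject that meets every fibre of \<rho>, hence
  supplements its kernel; superfluity of that kernel leaves only the whole of
  \<open>q\<close>.\<close>

lemma projective_cover_hom_onto:
  assumes cov: "projective_cover R q X \<rho>" and X: "wf_mobj R X" and p: "wf_mobj R p"
    and onto: "mobj_onto p X \<pi>" and u: "mobj_hom R p q u"
    and comm: "\<And>x. x \<in> carrier (src p) \<Longrightarrow> fst \<rho> (fst u x) = fst \<pi> x"
      "\<And>y. y \<in> carrier (tgt p) \<Longrightarrow> snd \<rho> (snd u y) = snd \<pi> y"
  shows "mobj_onto p q u"
proof -
  note X' = wf_mobjD[OF X] and p' = wf_mobjD[OF p] and q' = wf_mobjD[OF projective_coverD(3)[OF cov]]
  note \<rho> = mobj_homD[OF projective_coverD(4)[OF cov]] and u' = mobj_homD[OF u]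
  let ?H = "fst u ` carrier (src p)" and ?K = "snd u ` carrier (tgt p)"
  have "arr q ` ?H \<subseteq> ?K"
    using u'(3) mod_hom_closed[OF p'(3)] by (auto simp flip: u'(3))
  then have "is_sub_mobj R q ?H ?K"
    using submodule_image[OF p'(1) q'(1) u'(1)] submodule_image[OF p'(2) q'(2) u'(2)]
    by (simp add: is_sub_mobj_def)
  moreover have "a_kernel (src q) (src X) (fst \<rho>) <+>\<^bsub>src q\<^esub> ?H = carrier (src q)"
  proof (rule kernel_plus_image[OF p'(1) q'(1) X'(1) \<rho>(1) u'(1)])
    fix x assume "x \<in> carrier (src q)"
    then have "fst \<rho> x \<in> fst \<pi> ` carrier (src p)"
      using mod_hom_closed[OF \<rho>(1)] onto by (simp add: mobj_onto_def)
    then show "\<exists>z\<in>carrier (src p). fst \<rho> (fst u z) = fst \<rho> x"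
      using comm(1) by auto
  qed
  moreover have "a_kernel (tgt q) (tgt X) (snd \<rho>) <+>\<^bsub>tgt q\<^esub> ?K = carrier (tgt q)"
  proof (rule kernel_plus_image[OF p'(2) q'(2) X'(2) \<rho>(2) u'(2)])
    fix x assume "x \<in> carrier (tgt q)"
    then have "snd \<rho> x \<in> snd \<pi> ` carrier (tgt p)"
      using mod_hom_closed[OF \<rho>(2)] onto by (simp add: mobj_onto_def)
    then show "\<exists>z\<in>carrier (tgt p). snd \<rho> (snd u z) = snd \<rho> x"
      using comm(2) by auto
  qed
  ultimately show ?thesis
    using cov unfolding projective_cover_def mobj_onto_def by blast
qed

lemma mobj_hom_id: "mobj_hom R p p (\<lambda>x. x, \<lambda>y. y)"
  by (simp add: mobj_hom_def mod_hom_id)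

text \<open>A lift \<open>u\<close> is onto by superfluity. Lifting the identity through
  \<open>u\<close> gives a section \<open>v\<close>, which is again compatible with the covers and
  so onto for the same reason; a surjective section forces \<open>u\<close> to be injective.\<close>

lemma projective_cover_unique:
  assumes cp: "projective_cover R p X \<pi>" and cq: "projective_cover R q X \<rho>" and X: "wf_mobj R X"
  shows "\<exists>u. mobj_hom R p q u \<and> bij_betw (fst u) (carrier (src p)) (carrier (src q)) \<and>
           bij_betw (snd u) (carrier (tgt p)) (carrier (tgt q)) \<and>
           (\<forall>x\<in>carrier (src p). fst \<rho> (fst u x) = fst \<pi> x) \<and>
           (\<forall>y\<in>carrier (tgt p). snd \<rho> (snd u y) = snd \<pi> y)"
proof -
  note P = projective_coverD[OF cp] and Q = projective_coverD[OF cq]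
  obtain n e \<phi> m d \<psi> where dbp: "dual_basis R p n e \<phi> m d \<psi>"
    using P(1) by blast
  obtain n' e' \<phi>' m' d' \<psi>' where dbq: "dual_basis R q n' e' \<phi>' m' d' \<psi>'"
    using Q(1) by blast
  obtain u where u: "mobj_hom R p q u" and
    u1: "\<forall>x\<in>carrier (src p). fst \<rho> (fst u x) = fst \<pi> x" and
    u2: "\<forall>y\<in>carrier (tgt p). snd \<rho> (snd u y) = snd \<pi> y"
    using dual_basis_lift[OF dbp Q(3) X Q(4,5) P(4)] by blast
  have uo: "mobj_onto p q u"
    by (rule projective_cover_hom_onto[OF cq X P(3,5) u]) (use u1 u2 in auto)
  obtain v where v: "mobj_hom R q p v" and
    v1: "\<forall>x\<in>carrier (src q). fst u (fst v x) = x" and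
    v2: "\<forall>y\<in>carrier (tgt q). snd u (snd v y) = y"
    using dual_basis_lift[OF dbq P(3) Q(3) u uo mobj_hom_id] by auto
  note v' = mobj_homD[OF v]
  have vo: "mobj_onto q p v"
  proof (rule projective_cover_hom_onto[OF cp X Q(3,5) v])
    show "fst \<pi> (fst v x) = fst \<rho> x" if "x \<in> carrier (src q)" for x
      using u1 v1 that mod_hom_closed[OF v'(1) that] by fastforce
    show "snd \<pi> (snd v x) = snd \<rho> x" if "x \<in> carrier (tgt q)" for x
      using u2 v2 that mod_hom_closed[OF v'(2) that] by fastforce
  qed
  have "inj_on (fst u) (carrier (src p))"
    using v1 vo unfolding mobj_onto_def by (metis (no_types, lifting) imageE inj_onI)
  moreover have "inj_on (snd u) (carrier (tgt p))"
    using v2 vo unfolding mobj_onto_def by (metis (no_types, lifting) imageE inj_onI)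
  ultimately show ?thesis
    using u u1 u2 uo unfolding bij_betw_def mobj_onto_def by (intro exI[of _ u]) simp
qed

lemma wf_ker_mobj:
  assumes "wf_mobj R p" "wf_mobj R X" "mobj_hom R p X \<pi>"
  shows "wf_mobj R (ker_mobj p X \<pi>)"
proof -
  note p = wf_mobjD[OF assms(1)] and X = wf_mobjD[OF assms(2)] and \<pi> = mobj_homD[OF assms(3)]
  have "arr p x \<in> a_kernel (tgt p) (tgt X) (snd \<pi>)" if "x \<in> a_kernel (src p) (src X) (fst \<pi>)" for x
    using that mod_hom_closed[OF p(3)] mod_hom_zero[OF X(1,2,3)] by (auto simp: mem_a_kernel \<pi>(3))
  then have "mod_hom R (src p\<lparr>carrier := a_kernel (src p) (src X) (fst \<pi>)\<rparr>)
      (tgt p\<lparr>carrier := a_kernel (tgt p) (tgt X) (snd \<pi>)\<rparr>) (arr p)"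
    using mod_hom_add[OF p(3)] mod_hom_smult[OF p(3)] by (intro mod_homI) (auto simp: mem_a_kernel)
  then show ?thesis
    using module_restrict[OF p(1) submodule_kernel[OF p(1) X(1) \<pi>(1)]]
      module_restrict[OF p(2) submodule_kernel[OF p(2) X(2) \<pi>(2)]]
    by (simp add: wf_mobj_def ker_mobj_def)
qed

section \<open>Radicals of projective covers over a local ring\<close>

context noetherian_local
begin

text \<open>A unit value \<open>h x\<close> allows every element to be corrected by a multiple of
  \<open>x\<close> to a kernel element. This serves for covers, and again for splitting off a free
  summand.\<close>

lemma set_add_kernel_functional:
  assumes M: "module R M" and h: "functional R M h" and N: "submodule N R M"
    and x: "x \<in> N" "h x \<notin> max_ideal"
  shows "N <+>\<^bsub>M\<^esub> a_kernel M (ring_mod R) h = carrier M"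
proof -
  interpret M: module R M by fact
  have xM: "x \<in> carrier M"
    using submodule_subset[OF N] x(1) by blast
  have hx: "h x \<in> carrier R"
    by (rule functional_closed[OF h xM])
  obtain u where u: "u \<in> carrier R" "u \<otimes>\<^bsub>R\<^esub> h x = \<one>\<^bsub>R\<^esub>"
    using unit_if_notin_max_ideal[OF hx x(2)] by blast
  show ?thesis
  proof (intro subset_antisym subsetI)
    fix z assume "z \<in> N <+>\<^bsub>M\<^esub> a_kernel M (ring_mod R) h"
    then show "z \<in> carrier M"
      using submodule_subset[OF N] by (auto simp: mem_set_add mem_a_kernel)
  next
    fix z assume z: "z \<in> carrier M"
    have hz: "h z \<in> carrier R"
      by (rule functional_closed[OF h z])
    let ?y = "(h z \<otimes>\<^bsub>R\<^esub> u) \<odot>\<^bsub>M\<^esub> x"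
    have y: "?y \<in> N" "?y \<in> carrier M"
      using submodule_smult[OF N _ x(1)] hz u xM by auto
    have "h ?y = h z"
      using mod_hom_smult[OF h _ xM] hz u hx by (simp add: m_assoc)
    then have "h (z \<ominus>\<^bsub>M\<^esub> ?y) = \<zero>\<^bsub>ring_mod R\<^esub>"
      using mod_hom_diff[OF M module_ring_mod[OF is_cring] h z y(2)]
        diff_self[OF module_ring_mod[OF is_cring], of "h z"] hz by simp
    then have "z \<ominus>\<^bsub>M\<^esub> ?y \<in> a_kernel M (ring_mod R) h"
      using z y(2) by (simp add: mem_a_kernel)
    moreover have "z = ?y \<oplus>\<^bsub>M\<^esub> (z \<ominus>\<^bsub>M\<^esub> ?y)"
      using diff_add_cancel[OF M z y(2)] by simp
    ultimately show "z \<in> N <+>\<^bsub>M\<^esub> a_kernel M (ring_mod R) h"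
      unfolding mem_set_add using y(1) by blast
  qed
qed

text \<open>Otherwise the kernel of the functional on the source, together with the whole target,
  would be a subobject supplementing the kernel of the cover; by superfluity the functional would
  vanish on the source.\<close>

lemma projective_cover_kernel_src:
  assumes cov: "projective_cover R p X \<pi>" and X: "wf_mobj R X" and \<phi>: "functional R (tgt p) \<phi>"
    and x: "x \<in> carrier (src p)" "fst \<pi> x = \<zero>\<^bsub>src X\<^esub>"
  shows "\<phi> (arr p x) \<in> max_ideal"
proof (rule ccontr)
  assume no: "\<phi> (arr p x) \<notin> max_ideal"
  note p = wf_mobjD[OF projective_coverD(3)[OF cov]] and \<pi> = mobj_homD[OF projective_coverD(4)[OF cov]]
  interpret pT: module R "tgt p" by (rule p(2))
  note X' = wf_mobjD[OF X]
  have f: "functional R (src p) (\<lambda>x. \<phi> (arr p x))"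
    by (rule mod_hom_comp[OF p(3) \<phi>])
  let ?H = "a_kernel (src p) (ring_mod R) (\<lambda>x. \<phi> (arr p x))"
  have "is_sub_mobj R p ?H (carrier (tgt p))"
    using submodule_kernel[OF p(1) module_ring_mod[OF is_cring] f] pT.carrier_is_submodule
      mod_hom_closed[OF p(3)] by (auto simp: is_sub_mobj_def mem_a_kernel)
  moreover have "a_kernel (src p) (src X) (fst \<pi>) <+>\<^bsub>src p\<^esub> ?H = carrier (src p)"
    using x no by (intro set_add_kernel_functional[OF p(1) f submodule_kernel[OF p(1) X'(1) \<pi>(1)]])
      (auto simp: mem_a_kernel)
  moreover have "a_kernel (tgt p) (tgt X) (snd \<pi>) <+>\<^bsub>tgt p\<^esub> carrier (tgt p) = carrier (tgt p)"
    by (rule set_add_carrier[OF p(2) submodule_kernel[OF p(2) X'(2) \<pi>(2)]])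
  ultimately have "?H = carrier (src p)"
    using cov unfolding projective_cover_def by blast
  then have "\<phi> (arr p x) = \<zero>"
    using x(1) by (metis mem_a_kernel ring_mod_simps(2))
  then show False
    using no max.zero_closed by simp
qed

text \<open>The supplement is now the whole source with the kernel of \<psi>. This pair is a
  subobject only if \<psi> vanishes on the image of the source, whence the hypothesis
  \<open>kill\<close>.\<close>

lemma projective_cover_kernel_tgt:
  assumes cov: "projective_cover R p X \<pi>" and X: "wf_mobj R X" and \<psi>: "functional R (tgt p) \<psi>"
    and kill: "\<And>x. x \<in> carrier (src p) \<Longrightarrow> \<psi> (arr p x) = \<zero>"
    and y: "y \<in> carrier (tgt p)" "snd \<pi> y = \<zero>\<^bsub>tgt X\<^esub>"
  shows "\<psi> y \<in> max_ideal"
proof (rule ccontr)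
  assume no: "\<psi> y \<notin> max_ideal"
  note p = wf_mobjD[OF projective_coverD(3)[OF cov]] and \<pi> = mobj_homD[OF projective_coverD(4)[OF cov]]
  interpret pS: module R "src p" by (rule p(1))
  note X' = wf_mobjD[OF X]
  let ?K = "a_kernel (tgt p) (ring_mod R) \<psi>"
  have "is_sub_mobj R p (carrier (src p)) ?K"
    using submodule_kernel[OF p(2) module_ring_mod[OF is_cring] \<psi>] pS.carrier_is_submodule
      mod_hom_closed[OF p(3)] kill by (auto simp: is_sub_mobj_def mem_a_kernel)
  moreover have "a_kernel (tgt p) (tgt X) (snd \<pi>) <+>\<^bsub>tgt p\<^esub> ?K = carrier (tgt p)"
    using y no by (intro set_add_kernel_functional[OF p(2) \<psi> submodule_kernel[OF p(2) X'(2) \<pi>(2)]])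
      (auto simp: mem_a_kernel)
  moreover have "a_kernel (src p) (src X) (fst \<pi>) <+>\<^bsub>src p\<^esub> carrier (src p) = carrier (src p)"
    by (rule set_add_carrier[OF p(1) submodule_kernel[OF p(1) X'(1) \<pi>(1)]])
  ultimately have "?K = carrier (tgt p)"
    using cov unfolding projective_cover_def by blast
  then have "\<psi> y = \<zero>"
    using y(1) by (metis mem_a_kernel ring_mod_simps(2))
  then show False
    using no max.zero_closed by simp
qed

text \<open>The radical of \<open>p\<close> is described by its dual basis, so Nakayama's lemma applies.\<close>

lemma projective_coverI:
  assumes db: "dual_basis R p n e \<phi> m d \<psi>" and X: "wf_mobj R X" and \<pi>: "mobj_hom R p X \<pi>"
    and onto: "mobj_onto p X \<pi>"
    and ker\<phi>: "\<And>i x. i < n \<Longrightarrow> x \<in> carrier (src p) \<Longrightarrow> fst \<pi> x = \<zero>\<^bsub>src X\<^esub> \<Longrightarrow> \<phi> i (arr p x) \<in> max_ideal"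
    and ker\<psi>: "\<And>j y. j < m \<Longrightarrow> y \<in> carrier (tgt p) \<Longrightarrow> snd \<pi> y = \<zero>\<^bsub>tgt X\<^esub> \<Longrightarrow> \<psi> j y \<in> max_ideal"
  shows "projective_cover R p X \<pi>"
proof -
  note D = dual_basisD[OF db]
  interpret S: module R "src p" by (rule D(1))
  interpret T: module R "tgt p" by (rule D(2))
  have "H = carrier (src p) \<and> K = carrier (tgt p)"
    if sub: "is_sub_mobj R p H K"
      and sum1: "a_kernel (src p) (src X) (fst \<pi>) <+>\<^bsub>src p\<^esub> H = carrier (src p)"
      and sum2: "a_kernel (tgt p) (tgt X) (snd \<pi>) <+>\<^bsub>tgt p\<^esub> K = carrier (tgt p)" for H K
  proof -
    have H: "submodule H R (src p)" and K: "submodule K R (tgt p)" and HK: "arr p ` H \<subseteq> K"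
      using sub by (auto simp: is_sub_mobj_def)
    have "H = carrier (src p)"
    proof (rule nakayama[OF D(1) dual_basis_generates_src[OF db] H])
      fix x assume "x \<in> carrier (src p)"
      with sum1 have "x \<in> a_kernel (src p) (src X) (fst \<pi>) <+>\<^bsub>src p\<^esub> H"
        by simp
      then obtain k h where k: "k \<in> carrier (src p)" "fst \<pi> k = \<zero>\<^bsub>src X\<^esub>" and h: "h \<in> H"
          and x: "x = k \<oplus>\<^bsub>src p\<^esub> h"
        by (auto simp: mem_set_add mem_a_kernel)
      have "x = h \<oplus>\<^bsub>src p\<^esub> lincomb (src p) n (\<lambda>i. \<phi> i (arr p k)) e"
        using x k(1) submodule_subset[OF H] h unfolding dual_basis_arr(1)[OF db k(1)]
        by (auto intro: S.M.a_comm)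
      moreover have "(\<lambda>i. \<phi> i (arr p k)) \<in> {..<n} \<rightarrow> max_ideal"
        using ker\<phi> k by auto
      ultimately show "\<exists>h\<in>H. \<exists>r\<in>{..<n} \<rightarrow> max_ideal. x = h \<oplus>\<^bsub>src p\<^esub> lincomb (src p) n r e"
        using h by blast
    qed
    moreover have "K = carrier (tgt p)"
    proof (rule nakayama[OF D(2) dual_basis_generates_tgt[OF db] K])
      fix x assume "x \<in> carrier (tgt p)"
      with sum2 have "x \<in> a_kernel (tgt p) (tgt X) (snd \<pi>) <+>\<^bsub>tgt p\<^esub> K"
        by simp
      then obtain k h where k: "k \<in> carrier (tgt p)" "snd \<pi> k = \<zero>\<^bsub>tgt X\<^esub>" and h: "h \<in> K"
          and x: "x = k \<oplus>\<^bsub>tgt p\<^esub> h"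
        by (auto simp: mem_set_add mem_a_kernel)
      let ?s = "lincomb (src p) n (\<lambda>i. \<phi> i k) e" and ?t = "lincomb (tgt p) m (\<lambda>j. \<psi> j k) d"
      let ?g = "\<lambda>i. if i < n then arr p (e i) else d (i - n)"
      \<comment> \<open>The \<phi> part of \<open>k\<close> comes from the source, which already
        equals \<open>H\<close>, so it lies in \<open>K\<close> and its coefficients may be set to
        zero. Only the \<psi> coefficients are left for Nakayama's lemma.\<close>
      let ?r = "\<lambda>i. if i < n then \<zero> else \<psi> (i - n) k"
      have c\<psi>: "(\<lambda>j. \<psi> j k) \<in> coeffs R m"
        using functional_closed[OF D(8)] k(1) by auto
      have s: "?s \<in> carrier (src p)" and t: "?t \<in> carrier (tgt p)"
        by (rule mod_hom_closed[OF dual_basis_retraction[OF db] k(1)],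
            rule mod_hom_closed[OF dual_basis_coretraction[OF db] k(1)])
      have ae: "(\<lambda>i. arr p (e i)) \<in> family (tgt p) n"
        using D(5) mod_hom_closed[OF D(3)] by auto
      have "lincomb (tgt p) (n + m) ?r ?g =
          lincomb (tgt p) n (\<lambda>i. \<zero>) (\<lambda>i. arr p (e i)) \<oplus>\<^bsub>tgt p\<^esub> ?t"
        by (rule lincomb_append[OF D(2) _ ae c\<psi> D(6)]) auto
      then have l: "lincomb (tgt p) (n + m) ?r ?g = ?t"
        using t by (simp add: lincomb_zero[OF D(2) ae])
      have as: "arr p ?s \<in> K"
        using s HK \<open>H = carrier (src p)\<close> by blast
      have hc: "h \<in> carrier (tgt p)" "arr p ?s \<in> carrier (tgt p)"
        using submodule_subset[OF K] h as by auto
      have "x = (arr p ?s \<oplus>\<^bsub>tgt p\<^esub> ?t) \<oplus>\<^bsub>tgt p\<^esub> h"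
        using x D(10)[OF k(1)] by simp
      also have "\<dots> = (h \<oplus>\<^bsub>tgt p\<^esub> arr p ?s) \<oplus>\<^bsub>tgt p\<^esub> ?t"
        using hc t by (simp add: T.M.a_ac)
      finally have "x = (h \<oplus>\<^bsub>tgt p\<^esub> arr p ?s) \<oplus>\<^bsub>tgt p\<^esub> lincomb (tgt p) (n + m) ?r ?g"
        unfolding l .
      moreover have "h \<oplus>\<^bsub>tgt p\<^esub> arr p ?s \<in> K"
        by (rule submodule_add[OF K h as])
      moreover have "?r \<in> {..<n + m} \<rightarrow> max_ideal"
        using ker\<psi> k max.zero_closed by auto
      ultimately show "\<exists>h\<in>K. \<exists>r\<in>{..<n + m} \<rightarrow> max_ideal. x = h \<oplus>\<^bsub>tgt p\<^esub> lincomb (tgt p) (n + m) r ?g"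
        by blast
    qed
    ultimately show ?thesis
      by blast
  qed
  then show ?thesis
    using projective_mobj_dual_basis[OF db] \<pi> onto
    unfolding projective_cover_def mobj_onto_def by blast
qed

section \<open>Minimal generators and the existence of covers\<close>

text \<open>Choose a generating set modulo \<open>N\<close> of least cardinality: a relation with a
  unit coefficient would express one generator by the others. In the construction of covers
  \<open>N\<close> is zero for the source of an object and the image of the source for its
  target.\<close>

lemma minimal_generators:
  fixes M :: "('a, 'c) module"
  assumes fg: "fg_module R M" and N: "submodule N R M"
  shows "\<exists>n e. e \<in> family M n \<and> (\<forall>y\<in>carrier M. \<exists>a\<in>N. \<exists>r\<in>coeffs R n. y = a \<oplus>\<^bsub>M\<^esub> lincomb M n r e) \<and>
           (\<forall>r\<in>coeffs R n. lincomb M n r e \<in> N \<longrightarrow> (\<forall>i<n. r i \<in> max_ideal))"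
proof -
  have M: "module R M"
    using fg by (simp add: fg_module_def)
  interpret M: module R M by (rule M)
  define gen where "gen S \<longleftrightarrow> finite S \<and> S \<subseteq> carrier M \<and>
      (\<forall>H. submodule H R M \<and> N \<subseteq> H \<and> S \<subseteq> H \<longrightarrow> H = carrier M)" for S
  obtain S0 where "S0 \<subseteq> carrier M" "finite S0" "carrier M = \<Inter>{H. submodule H R M \<and> S0 \<subseteq> H}"
    using fg by (auto simp: fg_module_def)
  then have "gen S0"
    using submodule_subset unfolding gen_def by blast
  then obtain S where S: "gen S" and min: "\<And>S'. gen S' \<Longrightarrow> card S \<le> card S'"
    using ex_has_least_nat[of gen S0 card] by blast
  obtain e where e: "bij_betw e {0..<card S} S"
    using ex_bij_betw_nat_finite[of S] S by (auto simp: gen_def)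
  let ?n = "card S"
  have im: "e ` {..<?n} = S" and inj: "inj_on e {..<?n}"
    using e by (auto simp: bij_betw_def lessThan_atLeast0)
  have fam: "e \<in> family M ?n"
    using im S by (auto simp: gen_def)
  note L = submodule_lincombs[OF M fam]
  have "N <+>\<^bsub>M\<^esub> lincombs R M ?n e = carrier M"
  proof -
    have "N \<subseteq> N <+>\<^bsub>M\<^esub> lincombs R M ?n e"
    proof
      fix x assume x: "x \<in> N"
      then have "x = x \<oplus>\<^bsub>M\<^esub> \<zero>\<^bsub>M\<^esub>"
        using submodule_subset[OF N] by auto
      then show "x \<in> N <+>\<^bsub>M\<^esub> lincombs R M ?n e"
        unfolding mem_set_add using x submodule_zero[OF L] by blast
    qed
    moreover have "S \<subseteq> N <+>\<^bsub>M\<^esub> lincombs R M ?n e"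
    proof
      fix x assume x: "x \<in> S"
      then obtain i where "i < ?n" "x = e i"
        using im by blast
      then have "x \<in> lincombs R M ?n e"
        using family_in_lincombs[OF M fam] by simp
      moreover have "x = \<zero>\<^bsub>M\<^esub> \<oplus>\<^bsub>M\<^esub> x"
        using x S by (auto simp: gen_def)
      ultimately show "x \<in> N <+>\<^bsub>M\<^esub> lincombs R M ?n e"
        unfolding mem_set_add using submodule_zero[OF N] by blast
    qed
    ultimately show ?thesis
      using S submodule_set_add[OF M N L] unfolding gen_def by blast
  qed
  then have "\<exists>a\<in>N. \<exists>r\<in>coeffs R ?n. y = a \<oplus>\<^bsub>M\<^esub> lincomb M ?n r e" if "y \<in> carrier M" for y
    using that mem_set_add[of y M N "lincombs R M ?n e"] unfolding lincombs_def by blast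
  moreover have "r i \<in> max_ideal"
    if r: "r \<in> coeffs R ?n" and rN: "lincomb M ?n r e \<in> N" and i: "i < ?n" for r i
  proof (rule ccontr)
    assume no: "r i \<notin> max_ideal"
    have ri: "r i \<in> carrier R"
      using r i by auto
    obtain u where u: "u \<in> carrier R" "u \<otimes> r i = \<one>"
      using unit_if_notin_max_ideal[OF ri no] by blast
    have ei: "e i \<in> S" "e i \<in> carrier M"
      using im i fam by auto
    have "H = carrier M" if H: "submodule H R M" "N \<subseteq> H" "S - {e i} \<subseteq> H" for H
    proof -
      \<comment> \<open>The \<open>i\<close>-th term is split off. Setting \<open>e' i\<close> to
        zero keeps the rest of the sum visibly inside \<open>H\<close>, where \<open>e i\<close> is
        not yet known to lie.\<close>
      define r' where "r' k = (if k = i then \<zero> else r k)" for k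
      define e' where "e' k = (if k = i then \<zero>\<^bsub>M\<^esub> else e k)" for k
      let ?s = "\<lambda>k. if k = i then r i else \<zero>"
      have r': "r' \<in> coeffs R ?n" and s: "?s \<in> coeffs R ?n"
        using r ri by (auto simp: r'_def)
      have e': "e' \<in> {..<?n} \<rightarrow> H"
        using im inj i H(3) submodule_zero[OF H(1)] by (force simp: e'_def inj_on_def)
      have "lincomb M ?n r e = lincomb M ?n (\<lambda>k. r' k \<oplus> ?s k) e"
        using r ri by (intro lincomb_cong[OF M r fam]) (auto simp: r'_def Pi_iff)
      also have "\<dots> = lincomb M ?n r' e \<oplus>\<^bsub>M\<^esub> r i \<odot>\<^bsub>M\<^esub> e i"
        by (simp add: lincomb_add[OF M r' s fam] lincomb_single[OF M fam i ri])
      finally have eq: "lincomb M ?n r e = lincomb M ?n r' e \<oplus>\<^bsub>M\<^esub> r i \<odot>\<^bsub>M\<^esub> e i" .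
      have "lincomb M ?n r' e = lincomb M ?n r' e'"
        unfolding lincomb_def using r' fam
        by (intro M.M.finsum_cong') (auto simp: Pi_iff r'_def e'_def)
      then have l': "lincomb M ?n r' e \<in> H"
        using lincomb_in_submodule[OF M H(1) r' e'] by simp
      have "r i \<odot>\<^bsub>M\<^esub> e i = lincomb M ?n r e \<ominus>\<^bsub>M\<^esub> lincomb M ?n r' e"
        using lincomb_closed[OF M r' fam] ri ei(2) unfolding eq
        by (simp add: a_minus_def M.M.a_ac M.M.r_neg1 M.M.r_neg2 M.M.r_neg)
      also have "\<dots> \<in> H"
        using submodule_diff[OF M H(1) _ l'] rN H(2) by blast
      finally have "u \<odot>\<^bsub>M\<^esub> (r i \<odot>\<^bsub>M\<^esub> e i) \<in> H"
        by (rule submodule_smult[OF H(1) u(1)])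
      moreover have "u \<odot>\<^bsub>M\<^esub> (r i \<odot>\<^bsub>M\<^esub> e i) = e i"
        using u ri ei(2) by (simp add: M.smult_assoc1[symmetric])
      ultimately have "S \<subseteq> H"
        using H(3) by auto
      then show ?thesis
        using S H by (simp add: gen_def)
    qed
    then have "gen (S - {e i})"
      using S by (auto simp: gen_def)
    from min[OF this] show False
      using ei(1) S card_Diff1_less[of S "e i"] by (auto simp: gen_def)
  qed
  ultimately show ?thesis
    using fam by blast
qed

end

text \<open>The sum of \<open>n\<close> copies of R = R and \<open>m\<close> copies of 0 -> R, with
  the target coordinates numbered consecutively, so that \<open>arr\<close> pads with zeros.\<close>

definition free_mobj :: "('a, 'm) ring_scheme \<Rightarrow> nat \<Rightarrow> nat \<Rightarrow> ('a, nat \<Rightarrow> 'a, nat \<Rightarrow> 'a) mobj" where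
  "free_mobj R n m = \<lparr>src = free_mod R n, tgt = free_mod R (n + m),
     arr = (\<lambda>x. \<lambda>i\<in>{..<n + m}. if i < n then x i else \<zero>\<^bsub>R\<^esub>)\<rparr>"

lemma dual_basis_free_mobj:
  assumes "cring R"
  shows "dual_basis R (free_mobj R n m) n (unit_vec R n) (\<lambda>i y. y i)
           m (\<lambda>j. unit_vec R (n + m) (n + j)) (\<lambda>j y. y (n + j))"
proof -
  interpret cring R by fact
  let ?a = "\<lambda>x. \<lambda>i\<in>{..<n + m}. if i < n then x i else \<zero>\<^bsub>R\<^esub>"
  let ?F = "free_mod R n" and ?G = "free_mod R (n + m)"
  note F = module_free_mod[OF assms, of n] and G = module_free_mod[OF assms, of "n + m"]
  have a: "mod_hom R ?F ?G ?a"
    by (intro mod_homI) (auto simp: PiE_iff intro!: restrict_ext)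
  have uF: "unit_vec R n \<in> family ?F n" and uG: "unit_vec R (n + m) \<in> family ?G (n + m)"
      and dG: "\<And>x. x \<in> carrier ?G \<Longrightarrow> lincomb ?G (n + m) x (unit_vec R (n + m)) = x"
    using mod_dual_basis_free_mod[OF assms, of n] mod_dual_basis_free_mod[OF assms, of "n + m"]
    unfolding mod_dual_basis_def by blast+
  have ug: "(\<lambda>i. unit_vec R (n + m) i) \<in> family ?G n" "(\<lambda>j. unit_vec R (n + m) (n + j)) \<in> family ?G m"
    using uG by (auto simp del: free_mod_simps simp: Pi_iff)
  have inj: "inj_on ?a (carrier ?F)"
  proof (rule inj_onI)
    fix x x' assume x: "x \<in> carrier ?F" "x' \<in> carrier ?F" and eq: "?a x = ?a x'"
    show "x = x'"
    proof
      fix i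
      show "x i = x' i"
        using fun_cong[OF eq, of i] x by (cases "i < n") (auto simp: PiE_iff extensional_def)
    qed
  qed
  have "?a (lincomb ?F n y (unit_vec R n)) \<oplus>\<^bsub>?G\<^esub> lincomb ?G m (\<lambda>j. y (n + j)) (\<lambda>j. unit_vec R (n + m) (n + j)) = y"
    if y: "y \<in> carrier ?G" for y
  proof -
    have yc: "y \<in> coeffs R n" "(\<lambda>j. y (n + j)) \<in> coeffs R m" "y \<in> coeffs R (n + m)"
      using y by (auto simp: PiE_iff)
    have "?a (lincomb ?F n y (unit_vec R n)) = lincomb ?G n y (\<lambda>i. ?a (unit_vec R n i))"
      by (rule lincomb_hom[OF F G a yc(1) uF])
    also have "\<dots> = lincomb ?G n y (unit_vec R (n + m))"
    proof (rule lincomb_cong[OF G yc(1)])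
      show "(\<lambda>i. ?a (unit_vec R n i)) \<in> family ?G n"
        using mod_hom_closed[OF a] uF by blast
    qed (auto simp: unit_vec_def fun_eq_iff)
    \<comment> \<open>The index \<open>n + (i - n)\<close> is the form that
      \<open>lincomb_append\<close> produces; from \<open>n\<close> on it is \<open>i\<close>
      itself.\<close>
    finally have "?a (lincomb ?F n y (unit_vec R n)) \<oplus>\<^bsub>?G\<^esub>
        lincomb ?G m (\<lambda>j. y (n + j)) (\<lambda>j. unit_vec R (n + m) (n + j)) =
        lincomb ?G (n + m) (\<lambda>i. if i < n then y i else y (n + (i - n)))
          (\<lambda>i. if i < n then unit_vec R (n + m) i else unit_vec R (n + m) (n + (i - n)))"
      by (simp only: lincomb_append[OF G yc(1) ug(1) yc(2) ug(2)])
    also have "\<dots> = lincomb ?G (n + m) y (unit_vec R (n + m))"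
      by (rule arg_cong2[where f = "lincomb ?G (n + m)"]) (auto simp: fun_eq_iff)
    finally show ?thesis
      using dG[OF y] by simp
  qed
  then show ?thesis
    using F G a uF ug(2) inj functional_coord[of _ "n + m" R]
    unfolding dual_basis_def wf_mobj_def free_mobj_def by (simp del: free_mod_simps)
qed

context noetherian_local
begin

text \<open>The \<phi> half of a free object is sent to minimal generators of the source, the \<psi>
  half to minimal generators of the target modulo the image of the source. Minimality puts the
  coordinates of kernel elements into the maximal ideal, as \<open>projective_coverI\<close>
  demands.\<close>

lemma projective_cover_exists:
  fixes X :: "('a, 'c, 'd) mobj"
  assumes X: "is_mobj R X"
  shows "\<exists>(p :: ('a, nat \<Rightarrow> 'a, nat \<Rightarrow> 'a) mobj) \<pi>. projective_cover R p X \<pi>"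
proof -
  note wf = is_mobj_imp_wf[OF X]
  note X' = wf_mobjD[OF wf]
  have fg: "fg_module R (src X)" "fg_module R (tgt X)"
    using X by (auto simp: is_mobj_def)
  interpret S: module R "src X" by (rule X'(1))
  interpret T: module R "tgt X" by (rule X'(2))
  note im = submodule_image[OF X']
  obtain n e where e: "e \<in> family (src X) n"
      and e1: "\<And>y. y \<in> carrier (src X) \<Longrightarrow> \<exists>a\<in>{\<zero>\<^bsub>src X\<^esub>}. \<exists>r\<in>coeffs R n. y = a \<oplus>\<^bsub>src X\<^esub> lincomb (src X) n r e"
      and e2: "\<And>r i. r \<in> coeffs R n \<Longrightarrow> lincomb (src X) n r e \<in> {\<zero>\<^bsub>src X\<^esub>} \<Longrightarrow> i < n \<Longrightarrow> r i \<in> max_ideal"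
    using minimal_generators[OF fg(1) submodule_singleton_zero[OF X'(1)]] by blast
  obtain m d where d: "d \<in> family (tgt X) m"
      and d1: "\<And>y. y \<in> carrier (tgt X) \<Longrightarrow> \<exists>a\<in>arr X ` carrier (src X). \<exists>r\<in>coeffs R m. y = a \<oplus>\<^bsub>tgt X\<^esub> lincomb (tgt X) m r d"
      and d2: "\<And>r i. r \<in> coeffs R m \<Longrightarrow> lincomb (tgt X) m r d \<in> arr X ` carrier (src X) \<Longrightarrow> i < m \<Longrightarrow> r i \<in> max_ideal"
    using minimal_generators[OF fg(2) im] by blast
  define p where "p = free_mobj R n m"
  have ps: "src p = free_mod R n" "tgt p = free_mod R (n + m)"
    "arr p = (\<lambda>x. \<lambda>i\<in>{..<n + m}. if i < n then x i else \<zero>)"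
    by (simp_all add: p_def free_mobj_def)
  note db = dual_basis_free_mobj[OF is_cring, of n m, folded p_def]
  note D = dual_basisD[OF db]
  have ae: "(\<lambda>i. arr X (e i)) \<in> family (tgt X) n"
    using e mod_hom_closed[OF X'(3)] by auto
  let ?g = "\<lambda>i. if i < n then arr X (e i) else d (i - n)"
  have g: "?g \<in> family (tgt X) (n + m)"
    using ae d by (auto simp: Pi_iff)
  define \<pi>1 where "\<pi>1 x = lincomb (src X) n x e" for x
  define \<pi>2 where "\<pi>2 y = lincomb (tgt X) (n + m) y ?g" for y
  have \<pi>1: "mod_hom R (src p) (src X) \<pi>1" and \<pi>2: "mod_hom R (tgt p) (tgt X) \<pi>2"
    unfolding \<pi>1_def \<pi>2_def ps by (rule mod_hom_lincomb_free[OF X'(1) e], rule mod_hom_lincomb_free[OF X'(2) g])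
  have \<pi>2_split: "\<pi>2 y = arr X (\<pi>1 y) \<oplus>\<^bsub>tgt X\<^esub> lincomb (tgt X) m (\<lambda>j. y (n + j)) d"
    if y: "y \<in> coeffs R (n + m)" for y
  proof -
    have c: "y \<in> coeffs R n" "(\<lambda>j. y (n + j)) \<in> coeffs R m"
      using y by (auto simp: Pi_iff)
    have "\<pi>2 y = lincomb (tgt X) (n + m) (\<lambda>i. if i < n then y i else y (n + (i - n))) ?g"
      unfolding \<pi>2_def by (rule lincomb_cong[OF X'(2) y g]) auto
    also have "\<dots> = lincomb (tgt X) n y (\<lambda>i. arr X (e i)) \<oplus>\<^bsub>tgt X\<^esub> lincomb (tgt X) m (\<lambda>j. y (n + j)) d"
      by (rule lincomb_append[OF X'(2) c(1) ae c(2) d])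
    also have "lincomb (tgt X) n y (\<lambda>i. arr X (e i)) = arr X (\<pi>1 y)"
      unfolding \<pi>1_def by (rule lincomb_hom[OF X' c(1) e, symmetric])
    finally show ?thesis .
  qed
  have "\<pi>2 (arr p x) = arr X (\<pi>1 x)" if x: "x \<in> carrier (src p)" for x
  proof -
    have xc: "x \<in> coeffs R n"
      using x by (auto simp: ps PiE_iff)
    have ax: "arr p x \<in> coeffs R (n + m)"
      using xc by (auto simp: ps Pi_iff)
    have "\<pi>1 x = \<pi>1 (arr p x)"
      unfolding \<pi>1_def by (rule lincomb_cong[OF X'(1) xc e]) (auto simp: ps)
    moreover have "lincomb (tgt X) m (\<lambda>j. arr p x (n + j)) d = lincomb (tgt X) m (\<lambda>j. \<zero>) d"
      by (rule lincomb_cong[OF X'(2) _ d]) (auto simp: ps)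
    moreover have "arr X (\<pi>1 x) \<in> carrier (tgt X)"
      by (rule mod_hom_closed[OF mod_hom_comp[OF \<pi>1 X'(3)] x])
    ultimately show ?thesis
      unfolding \<pi>2_split[OF ax] lincomb_zero[OF X'(2) d] by (metis T.M.r_zero)
  qed
  then have hom: "mobj_hom R p X (\<pi>1, \<pi>2)"
    using \<pi>1 \<pi>2 by (simp add: mobj_hom_def)
  have r1: "\<exists>x\<in>carrier (src p). y = \<pi>1 x" if y: "y \<in> carrier (src X)" for y
  proof -
    obtain r where r: "r \<in> coeffs R n" "y = lincomb (src X) n r e"
      using e1[OF y] lincomb_closed[OF X'(1) _ e] by fastforce
    then have "y = \<pi>1 (restrict r {..<n})"
      unfolding \<pi>1_def using lincomb_cong[OF X'(1) r(1) e, of "restrict r {..<n}" e] by simp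
    then show ?thesis
      using r(1) by (intro bexI[of _ "restrict r {..<n}"]) (auto simp: ps)
  qed
  have r2: "\<exists>x\<in>carrier (tgt p). y = \<pi>2 x" if y: "y \<in> carrier (tgt X)" for y
  proof -
    obtain a s where a: "a \<in> carrier (src X)" and s: "s \<in> coeffs R m"
        and ys: "y = arr X a \<oplus>\<^bsub>tgt X\<^esub> lincomb (tgt X) m s d"
      using d1[OF y] by blast
    obtain x where x: "x \<in> carrier (src p)" "a = \<pi>1 x"
      using r1[OF a] by blast
    have xc: "x \<in> coeffs R n"
      using x by (auto simp: ps PiE_iff)
    let ?z = "\<lambda>i\<in>{..<n + m}. if i < n then x i else s (i - n)"
    have z: "?z \<in> coeffs R (n + m)"
      using xc s by (auto simp: Pi_iff)
    have "\<pi>1 x = \<pi>1 ?z"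
      unfolding \<pi>1_def by (rule lincomb_cong[OF X'(1) xc e]) auto
    moreover have "lincomb (tgt X) m s d = lincomb (tgt X) m (\<lambda>j. ?z (n + j)) d"
      by (rule lincomb_cong[OF X'(2) s d]) auto
    ultimately have "y = \<pi>2 ?z"
      using \<pi>2_split[OF z] ys x(2) by simp
    then show ?thesis
      using z by (intro bexI[of _ ?z]) (auto simp: ps Pi_iff)
  qed
  have onto: "mobj_onto p X (\<pi>1, \<pi>2)"
    using r1 r2 mod_hom_closed[OF \<pi>1] mod_hom_closed[OF \<pi>2] by (auto simp: mobj_onto_def)
  have "projective_cover R p X (\<pi>1, \<pi>2)"
  proof (rule projective_coverI[OF db wf hom onto])
    fix i x assume i: "i < n" and x: "x \<in> carrier (src p)" and k: "fst (\<pi>1, \<pi>2) x = \<zero>\<^bsub>src X\<^esub>"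
    have "x \<in> coeffs R n"
      using x by (auto simp: ps PiE_iff)
    then show "arr p x i \<in> max_ideal"
      using e2[of x i] k i by (simp add: \<pi>1_def ps)
  next
    fix j y assume j: "j < m" and y: "y \<in> carrier (tgt p)" and k: "snd (\<pi>1, \<pi>2) y = \<zero>\<^bsub>tgt X\<^esub>"
    have yc: "y \<in> coeffs R (n + m)" "y \<in> coeffs R n" "(\<lambda>j. y (n + j)) \<in> coeffs R m"
      using y by (auto simp: ps PiE_iff)
    let ?l = "lincomb (tgt X) m (\<lambda>j. y (n + j)) d"
    have l: "?l \<in> carrier (tgt X)" and p1: "\<pi>1 y \<in> carrier (src X)"
      unfolding \<pi>1_def by (rule lincomb_closed[OF X'(2) yc(3) d], rule lincomb_closed[OF X'(1) yc(2) e])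
    have ap: "arr X (\<pi>1 y) \<in> arr X ` carrier (src X)" "arr X (\<pi>1 y) \<in> carrier (tgt X)"
      using p1 mod_hom_closed[OF X'(3)] by auto
    \<comment> \<open>For \<open>y\<close> in the kernel the \<psi> part is the negative of an
      element from the source, so minimality modulo the image of \<open>arr X\<close>
      applies.\<close>
    have "?l = \<ominus>\<^bsub>tgt X\<^esub> arr X (\<pi>1 y)"
      using k \<pi>2_split[OF yc(1)] l ap(2) by (metis T.M.a_comm T.M.minus_equality snd_conv)
    then have "?l \<in> arr X ` carrier (src X)"
      using T.submoduleE(3)[OF im ap(1)] by simp
    from d2[OF yc(3) this j] show "y (n + j) \<in> max_ideal" .
  qed
  then show ?thesis
    by blast
qed

text \<open>Submodules of finitely generated modules over a noetherian ring are finitely generated.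
  Hence the kernel of a first cover has a cover of its own, and presentations exist.\<close>

lemma is_mobj_ker_mobj:
  assumes p: "is_mobj R p" and X: "wf_mobj R X" and \<pi>: "mobj_hom R p X \<pi>"
  shows "is_mobj R (ker_mobj p X \<pi>)"
proof -
  note p' = wf_mobjD[OF is_mobj_imp_wf[OF p]] and X' = wf_mobjD[OF X] and \<pi>' = mobj_homD[OF \<pi>]
  have "wf_mobj R (ker_mobj p X \<pi>)"
    by (rule wf_ker_mobj[OF is_mobj_imp_wf[OF p] X \<pi>])
  then show ?thesis
    using p fg_module_submodule[OF noetherian_ring_axioms _ submodule_kernel[OF p'(1) X'(1) \<pi>'(1)]]
      fg_module_submodule[OF noetherian_ring_axioms _ submodule_kernel[OF p'(2) X'(2) \<pi>'(2)]]
    by (simp add: is_mobj_def ker_mobj_def wf_mobj_def)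
qed

lemma minimal_presentation_exists:
  fixes X :: "('a, 'c, 'd) mobj"
  assumes X: "is_mobj R X"
  shows "\<exists>(p1 :: ('a, nat \<Rightarrow> 'a, nat \<Rightarrow> 'a) mobj) (p0 :: ('a, nat \<Rightarrow> 'a, nat \<Rightarrow> 'a) mobj) \<delta> \<pi>.
           minimal_presentation R p1 p0 X \<delta> \<pi>"
proof -
  obtain p0 :: "('a, nat \<Rightarrow> 'a, nat \<Rightarrow> 'a) mobj" and \<pi> where p0: "projective_cover R p0 X \<pi>"
    using projective_cover_exists[OF X] by blast
  have "is_mobj R (ker_mobj p0 X \<pi>)"
    by (rule is_mobj_ker_mobj[OF projective_coverD(2)[OF p0] is_mobj_imp_wf[OF X] projective_coverD(4)[OF p0]])
  then show ?thesis
    using projective_cover_exists p0 unfolding minimal_presentation_def by blast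
qed

end


section \<open>Duals of objects\<close>

lemma Hom_mobj_simps [simp]:
  "carrier (Hom_mobj R f g) = {\<phi> \<in> extensional (carrier (src f)) \<times> extensional (carrier (tgt f)). mobj_hom R f g \<phi>}"
  "\<zero>\<^bsub>Hom_mobj R f g\<^esub> = (\<lambda>x\<in>carrier (src f). \<zero>\<^bsub>src g\<^esub>, \<lambda>x\<in>carrier (tgt f). \<zero>\<^bsub>tgt g\<^esub>)"
  "\<phi> \<oplus>\<^bsub>Hom_mobj R f g\<^esub> \<phi>' = (\<lambda>x\<in>carrier (src f). fst \<phi> x \<oplus>\<^bsub>src g\<^esub> fst \<phi>' x,
     \<lambda>x\<in>carrier (tgt f). snd \<phi> x \<oplus>\<^bsub>tgt g\<^esub> snd \<phi>' x)"
  "r \<odot>\<^bsub>Hom_mobj R f g\<^esub> \<phi> = (\<lambda>x\<in>carrier (src f). r \<odot>\<^bsub>src g\<^esub> fst \<phi> x,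
     \<lambda>x\<in>carrier (tgt f). r \<odot>\<^bsub>tgt g\<^esub> snd \<phi> x)"
  by (simp_all add: Hom_mobj_def)

text \<open>The morphisms are cut out of the sum of the two Hom modules by commutativity of the
  square, a linear condition.\<close>

lemma module_Hom_mobj:
  assumes f: "wf_mobj R f" and g: "wf_mobj R g"
  shows "module R (Hom_mobj R f g)"
proof -
  note f' = wf_mobjD[OF f] and g' = wf_mobjD[OF g]
  let ?D = "dsum_mod (Hom_mod R (src f) (src g)) (Hom_mod R (tgt f) (tgt g))"
  let ?H = "carrier (Hom_mobj R f g)"
  have D: "module R ?D"
    by (intro module_dsum_mod module_Hom_mod f' g')
  interpret S: module R "src f" by (rule f'(1))
  interpret T: module R "tgt f" by (rule f'(2))
  note ac = mod_hom_closed[OF f'(3)]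
  have "submodule ?H R ?D"
  proof (rule submodule_criterion[OF D])
    show "?H \<subseteq> carrier ?D"
      by (auto simp: mobj_hom_def)
    show "\<zero>\<^bsub>?D\<^esub> \<in> ?H"
      using mod_hom_zero_map[OF f'(1) g'(1)] mod_hom_zero_map[OF f'(2) g'(2)] ac
        mod_hom_zero[OF g'] by (auto simp: mobj_hom_def)
    show "\<phi> \<oplus>\<^bsub>?D\<^esub> \<phi>' \<in> ?H" if h: "\<phi> \<in> ?H" and h': "\<phi>' \<in> ?H" for \<phi> \<phi>'
    proof -
      have m: "mobj_hom R f g \<phi>" "mobj_hom R f g \<phi>'"
        using h h' by auto
      note a = mobj_homD[OF m(1)] and b = mobj_homD[OF m(2)]
      show ?thesis
        using mod_hom_sum[OF f'(1) g'(1) a(1) b(1)] mod_hom_sum[OF f'(2) g'(2) a(2) b(2)]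
          a(3) b(3) ac mod_hom_closed[OF a(1)] mod_hom_closed[OF b(1)] mod_hom_add[OF g'(3)]
        by (simp add: mobj_hom_def)
    qed
    show "r \<odot>\<^bsub>?D\<^esub> \<phi> \<in> ?H" if r: "r \<in> carrier R" and h: "\<phi> \<in> ?H" for r \<phi>
    proof -
      have m: "mobj_hom R f g \<phi>"
        using h by auto
      note a = mobj_homD[OF m]
      show ?thesis
        using mod_hom_scale[OF f'(1) g'(1) r a(1)] mod_hom_scale[OF f'(2) g'(2) r a(2)]
          a(3) ac mod_hom_closed[OF a(1)] mod_hom_smult[OF g'(3)] r
        by (simp add: mobj_hom_def)
    qed
  qed
  from module_restrict[OF D this] show ?thesis
    by (simp add: Hom_mobj_def)
qed

lemma wf_id_mobj: "module R M \<Longrightarrow> wf_mobj R (id_mobj M)"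
  by (simp add: wf_mobj_def id_mobj_def mod_hom_id)

lemma wf_from_zero_mobj:
  assumes "module R M" shows "wf_mobj R (from_zero_mobj M)"
proof -
  interpret M: module R M by fact
  have "mod_hom R zero_mod M (\<lambda>_. \<zero>\<^bsub>M\<^esub>)"
    by (rule mod_homI) auto
  then show ?thesis
    using assms module_zero_mod[OF M.R.is_cring] by (simp add: wf_mobj_def from_zero_mobj_def)
qed

lemma mod_hom_zero_mod: "mod_hom R M zero_mod h"
  by (rule mod_homI) (simp_all add: zero_mod_def)

section \<open>Elements of the dual as functionals on the target\<close>

text \<open>The component into the zero module carries no information, so the elements amount to
  functionals on the target that kill the image of the source: the dual of the cokernel.\<close>

lemma mem_src_star:
  "\<eta> \<in> carrier (src (star_mobj R p)) \<longleftrightarrow> snd \<eta> \<in> extensional (carrier (tgt p)) \<and>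
     functional R (tgt p) (snd \<eta>) \<and> (\<forall>x\<in>carrier (src p). snd \<eta> (arr p x) = \<zero>\<^bsub>R\<^esub>)"
  by (cases \<eta>) (auto simp: star_mobj_def mobj_hom_def from_zero_mobj_def mod_hom_zero_mod extensional_def)

text \<open>The square forces the first component to be the second one composed with
  \<open>arr p\<close>, so the elements are in effect all functionals on the target.\<close>

lemma mem_tgt_star:
  "\<eta> \<in> carrier (tgt (star_mobj R p)) \<longleftrightarrow> fst \<eta> \<in> extensional (carrier (src p)) \<and>
     functional R (src p) (fst \<eta>) \<and> snd \<eta> \<in> extensional (carrier (tgt p)) \<and>
     functional R (tgt p) (snd \<eta>) \<and> (\<forall>x\<in>carrier (src p). snd \<eta> (arr p x) = fst \<eta> x)"
  by (cases \<eta>) (auto simp: star_mobj_def mobj_hom_def id_mobj_def)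

lemma src_star_eqI:
  assumes "\<eta> \<in> carrier (src (star_mobj R p))" "\<eta>' \<in> carrier (src (star_mobj R p))"
    and "\<And>y. y \<in> carrier (tgt p) \<Longrightarrow> snd \<eta> y = snd \<eta>' y"
  shows "\<eta> = \<eta>'"
  using assms by (intro prod_eqI extensionalityI[of "snd \<eta>" "carrier (tgt p)"]) (auto simp: mem_src_star)

lemma tgt_star_eqI:
  assumes "wf_mobj R p" "\<eta> \<in> carrier (tgt (star_mobj R p))" "\<eta>' \<in> carrier (tgt (star_mobj R p))"
    and "\<And>y. y \<in> carrier (tgt p) \<Longrightarrow> snd \<eta> y = snd \<eta>' y"
  shows "\<eta> = \<eta>'"
proof (rule prod_eqI)
  have a: "arr p x \<in> carrier (tgt p)" if "x \<in> carrier (src p)" for x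
    by (rule mod_hom_closed[OF wf_mobjD(3)[OF assms(1)] that])
  show "fst \<eta> = fst \<eta>'"
  proof (rule extensionalityI[of _ "carrier (src p)"])
    show "fst \<eta> x = fst \<eta>' x" if x: "x \<in> carrier (src p)" for x
      using assms(2,3) assms(4)[OF a[OF x]] x by (simp add: mem_tgt_star)
  qed (use assms(2,3) in \<open>auto simp: mem_tgt_star\<close>)
  show "snd \<eta> = snd \<eta>'"
    using assms(2-4) by (intro extensionalityI[of "snd \<eta>" "carrier (tgt p)"]) (auto simp: mem_tgt_star)
qed

lemma star_simps:
  "src (star_mobj R p) = Hom_mobj R p (from_zero_mobj (ring_mod R))"
  "tgt (star_mobj R p) = Hom_mobj R p (id_mobj (ring_mod R))"
  by (simp_all add: star_mobj_def)

lemma functional_eval_src_star: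
  "y \<in> carrier (tgt p) \<Longrightarrow> functional R (src (star_mobj R p)) (\<lambda>\<eta>. snd \<eta> y)"
  by (rule mod_homI)
    (use functional_closed in \<open>auto simp: mem_src_star simp del: Hom_mobj_simps(1)\<close>,
      auto simp: star_simps from_zero_mobj_def)

lemma functional_eval_tgt_star:
  "y \<in> carrier (tgt p) \<Longrightarrow> functional R (tgt (star_mobj R p)) (\<lambda>\<eta>. snd \<eta> y)"
  by (rule mod_homI)
    (use functional_closed in \<open>auto simp: mem_tgt_star simp del: Hom_mobj_simps(1)\<close>,
      auto simp: star_simps id_mobj_def)

lemma snd_arr_star:
  "y \<in> carrier (tgt p) \<Longrightarrow> snd (arr (star_mobj R p) \<eta>) y = snd \<eta> y"
  by (simp add: star_mobj_def compose_def)

lemma module_star: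
  assumes "wf_mobj R p"
  shows "module R (src (star_mobj R p))" "module R (tgt (star_mobj R p))"
  using module_ring_mod[OF module.axioms(1)[OF wf_mobjD(1)[OF assms]]] assms
  by (auto simp: star_simps intro!: module_Hom_mobj wf_id_mobj wf_from_zero_mobj)

lemma arr_star_closed:
  assumes "wf_mobj R p" "\<eta> \<in> carrier (src (star_mobj R p))"
  shows "arr (star_mobj R p) \<eta> \<in> carrier (tgt (star_mobj R p))"
proof -
  note p = wf_mobjD[OF assms(1)]
  interpret S: module R "src p" by (rule p(1))
  have e: "snd \<eta> \<in> extensional (carrier (tgt p))" and f: "functional R (tgt p) (snd \<eta>)"
      and k: "\<And>x. x \<in> carrier (src p) \<Longrightarrow> snd \<eta> (arr p x) = \<zero>\<^bsub>R\<^esub>"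
    using assms(2) by (auto simp: mem_src_star)
  have c: "compose (carrier (tgt p)) (\<lambda>x. x) (snd \<eta>) = snd \<eta>"
    using e by (auto simp: compose_def fun_eq_iff extensional_def restrict_def)
  have "functional R (src p) (compose (carrier (src p)) (\<lambda>_. \<zero>\<^bsub>R\<^esub>) (fst \<eta>))"
    using mod_hom_zero_map[OF p(1) module_ring_mod[OF S.R.is_cring]] by (simp add: compose_def)
  then show ?thesis
    unfolding mem_tgt_star using e f k
    by (simp add: star_mobj_def c) (simp add: compose_def)
qed

lemma wf_star_mobj:
  assumes "wf_mobj R p" shows "wf_mobj R (star_mobj R p)"
proof -
  let ?S = "src (star_mobj R p)" and ?T = "tgt (star_mobj R p)" and ?a = "arr (star_mobj R p)"
  note m = module_star[OF assms] and ac = arr_star_closed[OF assms]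
  interpret S: module R ?S by (rule m(1))
  interpret T: module R ?T by (rule m(2))
  have "mod_hom R ?S ?T ?a"
  proof (rule mod_homI)
    show "?a x \<in> carrier ?T" if "x \<in> carrier ?S" for x
      by (rule ac[OF that])
    show "?a (x \<oplus>\<^bsub>?S\<^esub> y) = ?a x \<oplus>\<^bsub>?T\<^esub> ?a y" if "x \<in> carrier ?S" "y \<in> carrier ?S" for x y
      by (rule tgt_star_eqI[OF assms])
        (use that ac in \<open>simp_all add: snd_arr_star mod_hom_add[OF functional_eval_src_star]
          mod_hom_add[OF functional_eval_tgt_star]\<close>)
    show "?a (r \<odot>\<^bsub>?S\<^esub> x) = r \<odot>\<^bsub>?T\<^esub> ?a x" if "r \<in> carrier R" "x \<in> carrier ?S" for r x
      by (rule tgt_star_eqI[OF assms])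
        (use that ac in \<open>simp_all add: snd_arr_star mod_hom_smult[OF functional_eval_src_star]
          mod_hom_smult[OF functional_eval_tgt_star]\<close>)
  qed
  then show ?thesis
    using m by (simp add: wf_mobj_def)
qed

text \<open>Values outside the carrier are discarded because elements of \<open>Hom_mobj\<close> are
  extensional; into \<open>unit\<close> there is only one map.\<close>

definition src_star_of :: "('a, 'b, 'c) mobj \<Rightarrow> ('c \<Rightarrow> 'a) \<Rightarrow> ('b \<Rightarrow> unit) \<times> ('c \<Rightarrow> 'a)" where
  "src_star_of p h = ((\<lambda>_. ()), restrict h (carrier (tgt p)))"

definition tgt_star_of :: "('a, 'b, 'c) mobj \<Rightarrow> ('c \<Rightarrow> 'a) \<Rightarrow> ('b \<Rightarrow> 'a) \<times> ('c \<Rightarrow> 'a)" where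
  "tgt_star_of p h = (\<lambda>x\<in>carrier (src p). h (arr p x), restrict h (carrier (tgt p)))"

lemma snd_src_star_of [simp]: "y \<in> carrier (tgt p) \<Longrightarrow> snd (src_star_of p h) y = h y"
  by (simp add: src_star_of_def)

lemma snd_tgt_star_of [simp]: "y \<in> carrier (tgt p) \<Longrightarrow> snd (tgt_star_of p h) y = h y"
  by (simp add: tgt_star_of_def)

lemma src_star_of_closed:
  assumes p: "wf_mobj R p" and h: "functional R (tgt p) h"
    and k: "\<And>x. x \<in> carrier (src p) \<Longrightarrow> h (arr p x) = \<zero>\<^bsub>R\<^esub>"
  shows "src_star_of p h \<in> carrier (src (star_mobj R p))"
proof -
  note p' = wf_mobjD[OF p]
  have "functional R (tgt p) (restrict h (carrier (tgt p)))"
    by (rule mod_hom_cong[OF p'(2) h]) simp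
  then show ?thesis
    using k mod_hom_closed[OF p'(3)] by (simp add: mem_src_star src_star_of_def)
qed

lemma tgt_star_of_closed:
  assumes p: "wf_mobj R p" and h: "functional R (tgt p) h"
  shows "tgt_star_of p h \<in> carrier (tgt (star_mobj R p))"
proof -
  note p' = wf_mobjD[OF p]
  have "functional R (tgt p) (restrict h (carrier (tgt p)))"
    by (rule mod_hom_cong[OF p'(2) h]) simp
  moreover have "functional R (src p) (\<lambda>x\<in>carrier (src p). h (arr p x))"
    by (rule mod_hom_cong[OF p'(1) mod_hom_comp[OF p'(3) h]]) simp
  ultimately show ?thesis
    using mod_hom_closed[OF p'(3)] by (simp add: mem_tgt_star tgt_star_of_def)
qed

text \<open>Duality exchanges the two kinds of indecomposable projectives, hence the two halves of the basis.\<close>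

lemma dual_basis_star:
  assumes db: "dual_basis R p n e \<phi> m d \<psi>"
  shows "dual_basis R (star_mobj R p) m (\<lambda>j. src_star_of p (\<psi> j)) (\<lambda>j \<eta>. snd \<eta> (d j))
           n (\<lambda>i. tgt_star_of p (\<phi> i)) (\<lambda>i \<eta>. snd \<eta> (arr p (e i)))"
proof -
  note D = dual_basisD[OF db]
  have p: "wf_mobj R p"
    using db by (simp add: dual_basis_def)
  let ?S = "src (star_mobj R p)" and ?T = "tgt (star_mobj R p)" and ?a = "arr (star_mobj R p)"
  interpret R: cring R
    using D(1) by (rule module.axioms)
  note m = module_star[OF p] and rm = module_ring_mod[OF R.is_cring]
  note wf = wf_mobjD[OF wf_star_mobj[OF p]]
  interpret T: module R ?T by (rule m(2))
  have fS: "(\<lambda>j. src_star_of p (\<psi> j)) \<in> family ?S m"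
    using src_star_of_closed[OF p D(8,9)] by auto
  have fT: "(\<lambda>i. tgt_star_of p (\<phi> i)) \<in> family ?T n"
    using tgt_star_of_closed[OF p D(7)] by auto
  have dT: "d j \<in> carrier (tgt p)" if "j < m" for j
    using D(6) that by auto
  have eS: "e i \<in> carrier (src p)" "arr p (e i) \<in> carrier (tgt p)" if "i < n" for i
    using D(5) that mod_hom_closed[OF D(3)] by auto
  show ?thesis
    unfolding dual_basis_def
  proof (intro conjI allI impI ballI)
    show "wf_mobj R (star_mobj R p)"
      by (rule wf_star_mobj[OF p])
    show "inj_on ?a (carrier ?S)"
    proof (rule inj_onI)
      fix x y assume x: "x \<in> carrier ?S" "y \<in> carrier ?S" and eq: "?a x = ?a y"
      show "x = y"
        by (rule src_star_eqI[OF x]) (metis eq snd_arr_star)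
    qed
    show "functional R ?T (\<lambda>\<eta>. snd \<eta> (d j))" if "j < m" for j
      by (rule functional_eval_tgt_star[OF dT[OF that]])
    show "functional R ?T (\<lambda>\<eta>. snd \<eta> (arr p (e i)))" if "i < n" for i
      by (rule functional_eval_tgt_star[OF eS(2)[OF that]])
    show "snd (?a \<eta>) (arr p (e i)) = \<zero>\<^bsub>R\<^esub>" if "i < n" "\<eta> \<in> carrier ?S" for i \<eta>
      using that eS by (simp add: snd_arr_star mem_src_star)
    show "?a (lincomb ?S m (\<lambda>j. snd \<eta> (d j)) (\<lambda>j. src_star_of p (\<psi> j))) \<oplus>\<^bsub>?T\<^esub>
        lincomb ?T n (\<lambda>i. snd \<eta> (arr p (e i))) (\<lambda>i. tgt_star_of p (\<phi> i)) = \<eta>"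
      if \<eta>: "\<eta> \<in> carrier ?T" for \<eta>
    proof -
      have f\<eta>: "functional R (tgt p) (snd \<eta>)"
        using \<eta> by (simp add: mem_tgt_star)
      have c1: "(\<lambda>j. snd \<eta> (d j)) \<in> coeffs R m" and c2: "(\<lambda>i. snd \<eta> (arr p (e i))) \<in> coeffs R n"
        using functional_closed[OF f\<eta>] dT eS by auto
      let ?l = "lincomb ?S m (\<lambda>j. snd \<eta> (d j)) (\<lambda>j. src_star_of p (\<psi> j))"
      let ?k = "lincomb ?T n (\<lambda>i. snd \<eta> (arr p (e i))) (\<lambda>i. tgt_star_of p (\<phi> i))"
      have l: "?l \<in> carrier ?S" and k: "?k \<in> carrier ?T"
        by (rule lincomb_closed[OF m(1) c1 fS], rule lincomb_closed[OF m(2) c2 fT])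
      have al: "?a ?l \<in> carrier ?T"
        by (rule arr_star_closed[OF p l])
      show ?thesis
      proof (rule tgt_star_eqI[OF p _ \<eta>])
        show "?a ?l \<oplus>\<^bsub>?T\<^esub> ?k \<in> carrier ?T"
          using al k by simp
        fix y assume y: "y \<in> carrier (tgt p)"
        have c\<phi>: "(\<lambda>i. \<phi> i y) \<in> coeffs R n" and c\<psi>: "(\<lambda>j. \<psi> j y) \<in> coeffs R m"
          using functional_closed[OF D(7)] functional_closed[OF D(8)] y by auto
        \<comment> \<open>Evaluated at \<open>y\<close>, the expansion of \<eta> becomes, after
          coefficients and values change places, \<eta> applied to the expansion of \<open>y\<close>
          in the original basis.\<close>
        have "snd ?l y = lincomb (ring_mod R) m (\<lambda>j. snd \<eta> (d j)) (\<lambda>j. snd (src_star_of p (\<psi> j)) y)"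
          by (rule lincomb_hom[OF m(1) rm functional_eval_src_star[OF y] c1 fS])
        also have "\<dots> = lincomb (ring_mod R) m (\<lambda>j. \<psi> j y) (\<lambda>j. snd \<eta> (d j))"
          using y c1 c\<psi> by (simp add: lincomb_ring_mod_commute[OF R.is_cring c1 c\<psi>])
        also have "\<dots> = snd \<eta> (lincomb (tgt p) m (\<lambda>j. \<psi> j y) d)"
          by (rule lincomb_hom[OF D(2) rm f\<eta> c\<psi> D(6), symmetric])
        finally have l_y: "snd ?l y = snd \<eta> (lincomb (tgt p) m (\<lambda>j. \<psi> j y) d)" .
        have "snd ?k y = lincomb (ring_mod R) n (\<lambda>i. snd \<eta> (arr p (e i))) (\<lambda>i. snd (tgt_star_of p (\<phi> i)) y)"
          by (rule lincomb_hom[OF m(2) rm functional_eval_tgt_star[OF y] c2 fT])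
        also have "\<dots> = lincomb (ring_mod R) n (\<lambda>i. \<phi> i y) (\<lambda>i. snd \<eta> (arr p (e i)))"
          using y c2 c\<phi> by (simp add: lincomb_ring_mod_commute[OF R.is_cring c2 c\<phi>])
        also have "\<dots> = snd \<eta> (arr p (lincomb (src p) n (\<lambda>i. \<phi> i y) e))"
          by (rule lincomb_hom[OF D(1) rm mod_hom_comp[OF D(3) f\<eta>] c\<phi> D(5), symmetric])
        finally have k_y: "snd ?k y = snd \<eta> (arr p (lincomb (src p) n (\<lambda>i. \<phi> i y) e))" .
        have c: "arr p (lincomb (src p) n (\<lambda>i. \<phi> i y) e) \<in> carrier (tgt p)"
          "lincomb (tgt p) m (\<lambda>j. \<psi> j y) d \<in> carrier (tgt p)"
          using mod_hom_closed[OF D(3) lincomb_closed[OF D(1) c\<phi> D(5)]] lincomb_closed[OF D(2) c\<psi> D(6)] .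
        have "snd (?a ?l \<oplus>\<^bsub>?T\<^esub> ?k) y = snd ?l y \<oplus>\<^bsub>R\<^esub> snd ?k y"
          using mod_hom_add[OF functional_eval_tgt_star[OF y] al k] by (simp add: snd_arr_star[OF y])
        also have "\<dots> = snd ?k y \<oplus>\<^bsub>R\<^esub> snd ?l y"
          unfolding l_y k_y using functional_closed[OF f\<eta>] c by (intro R.a_comm) auto
        also have "\<dots> = snd \<eta> y"
          unfolding l_y k_y using mod_hom_add[OF f\<eta> c] D(10)[OF y] by simp
        finally show "snd (?a ?l \<oplus>\<^bsub>?T\<^esub> ?k) y = snd \<eta> y" .
      qed
    qed
  qed (fact fS, fact fT)
qed

section \<open>Functoriality of the dual\<close>

lemma snd_precomp: "y \<in> carrier (tgt p) \<Longrightarrow> snd (precomp p \<delta> \<eta>) y = snd \<eta> (snd \<delta> y)"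
  by (simp add: precomp_def compose_def)

lemma precomp_src_closed:
  assumes p: "wf_mobj R p" and \<delta>: "mobj_hom R p q \<delta>" and \<eta>: "\<eta> \<in> carrier (src (star_mobj R q))"
  shows "precomp p \<delta> \<eta> \<in> carrier (src (star_mobj R p))"
proof -
  note p' = wf_mobjD[OF p] and \<delta>' = mobj_homD[OF \<delta>]
  have h: "functional R (tgt q) (snd \<eta>)" "\<And>x. x \<in> carrier (src q) \<Longrightarrow> snd \<eta> (arr q x) = \<zero>\<^bsub>R\<^esub>"
    using \<eta> by (auto simp: mem_src_star)
  have "functional R (tgt p) (snd (precomp p \<delta> \<eta>))"
    by (rule mod_hom_cong[OF p'(2) mod_hom_comp[OF \<delta>'(2) h(1)]]) (simp add: snd_precomp)
  then show ?thesis
    unfolding mem_src_star using h(2) \<delta>'(3) mod_hom_closed[OF p'(3)] mod_hom_closed[OF \<delta>'(1)]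
    by (auto simp: snd_precomp) (simp add: precomp_def compose_def)
qed

lemma precomp_tgt_closed:
  assumes p: "wf_mobj R p" and \<delta>: "mobj_hom R p q \<delta>" and \<eta>: "\<eta> \<in> carrier (tgt (star_mobj R q))"
  shows "precomp p \<delta> \<eta> \<in> carrier (tgt (star_mobj R p))"
proof -
  note p' = wf_mobjD[OF p] and \<delta>' = mobj_homD[OF \<delta>]
  have h: "functional R (tgt q) (snd \<eta>)" "functional R (src q) (fst \<eta>)"
      "\<And>x. x \<in> carrier (src q) \<Longrightarrow> snd \<eta> (arr q x) = fst \<eta> x"
    using \<eta> by (auto simp: mem_tgt_star)
  have "functional R (tgt p) (snd (precomp p \<delta> \<eta>))"
    by (rule mod_hom_cong[OF p'(2) mod_hom_comp[OF \<delta>'(2) h(1)]]) (simp add: snd_precomp)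
  moreover have "functional R (src p) (fst (precomp p \<delta> \<eta>))"
    by (rule mod_hom_cong[OF p'(1) mod_hom_comp[OF \<delta>'(1) h(2)]]) (simp add: precomp_def compose_def)
  ultimately show ?thesis
    unfolding mem_tgt_star using h(3) \<delta>'(3) mod_hom_closed[OF p'(3)] mod_hom_closed[OF \<delta>'(1)]
    by (auto simp: snd_precomp) (simp_all add: precomp_def compose_def)
qed

text \<open>Elements of a dual agree once they agree at all points of the target, where
  precomposition is substitution; every identity is checked there.\<close>

lemma mobj_hom_precomp:
  assumes p: "wf_mobj R p" and q: "wf_mobj R q" and \<delta>: "mobj_hom R p q \<delta>"
  shows "mobj_hom R (star_mobj R q) (star_mobj R p) (precomp p \<delta>, precomp p \<delta>)"
proof -
  note \<delta>' = mobj_homD[OF \<delta>]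
  note sc = precomp_src_closed[OF p \<delta>] and tc = precomp_tgt_closed[OF p \<delta>]
  note dc = mod_hom_closed[OF \<delta>'(2)]
  note mq = module_star[OF q] and mp = module_star[OF p]
  interpret Sq: module R "src (star_mobj R q)" by (rule mq)
  interpret Tq: module R "tgt (star_mobj R q)" by (rule mq)
  interpret Sp: module R "src (star_mobj R p)" by (rule mp)
  interpret Tp: module R "tgt (star_mobj R p)" by (rule mp)
  note evS = functional_eval_src_star and evT = functional_eval_tgt_star
  have "mod_hom R (src (star_mobj R q)) (src (star_mobj R p)) (precomp p \<delta>)"
  proof (rule mod_homI)
    show "precomp p \<delta> x \<in> carrier (src (star_mobj R p))" if "x \<in> carrier (src (star_mobj R q))" for x
      by (rule sc[OF that])
    show "precomp p \<delta> (x \<oplus>\<^bsub>src (star_mobj R q)\<^esub> y) = precomp p \<delta> x \<oplus>\<^bsub>src (star_mobj R p)\<^esub> precomp p \<delta> y"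
      if "x \<in> carrier (src (star_mobj R q))" "y \<in> carrier (src (star_mobj R q))" for x y
      by (rule src_star_eqI[where R = R and p = p])
        (use that sc dc in \<open>simp_all add: snd_precomp mod_hom_add[OF evS]\<close>)
    show "precomp p \<delta> (r \<odot>\<^bsub>src (star_mobj R q)\<^esub> x) = r \<odot>\<^bsub>src (star_mobj R p)\<^esub> precomp p \<delta> x"
      if "r \<in> carrier R" "x \<in> carrier (src (star_mobj R q))" for r x
      by (rule src_star_eqI[where R = R and p = p])
        (use that sc dc in \<open>simp_all add: snd_precomp mod_hom_smult[OF evS]\<close>)
  qed
  moreover have "mod_hom R (tgt (star_mobj R q)) (tgt (star_mobj R p)) (precomp p \<delta>)"
  proof (rule mod_homI)
    show "precomp p \<delta> x \<in> carrier (tgt (star_mobj R p))" if "x \<in> carrier (tgt (star_mobj R q))" for x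
      by (rule tc[OF that])
    show "precomp p \<delta> (x \<oplus>\<^bsub>tgt (star_mobj R q)\<^esub> y) = precomp p \<delta> x \<oplus>\<^bsub>tgt (star_mobj R p)\<^esub> precomp p \<delta> y"
      if "x \<in> carrier (tgt (star_mobj R q))" "y \<in> carrier (tgt (star_mobj R q))" for x y
      by (rule tgt_star_eqI[OF p])
        (use that tc dc in \<open>simp_all add: snd_precomp mod_hom_add[OF evT]\<close>)
    show "precomp p \<delta> (r \<odot>\<^bsub>tgt (star_mobj R q)\<^esub> x) = r \<odot>\<^bsub>tgt (star_mobj R p)\<^esub> precomp p \<delta> x"
      if "r \<in> carrier R" "x \<in> carrier (tgt (star_mobj R q))" for r x
      by (rule tgt_star_eqI[OF p])
        (use that tc dc in \<open>simp_all add: snd_precomp mod_hom_smult[OF evT]\<close>)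
  qed
  moreover have "precomp p \<delta> (arr (star_mobj R q) x) = arr (star_mobj R p) (precomp p \<delta> x)"
    if "x \<in> carrier (src (star_mobj R q))" for x
    by (rule tgt_star_eqI[OF p])
      (use that sc tc dc arr_star_closed[OF p] arr_star_closed[OF q]
        in \<open>simp_all add: snd_precomp snd_arr_star\<close>)
  ultimately show ?thesis
    by (simp add: mobj_hom_def)
qed


section \<open>Quotients and cokernels\<close>

lemma mod_hom_factor:
  assumes "module R M" "mod_hom R M N q" "q ` carrier M = carrier N"
    and "mod_hom R M L (\<lambda>x. h (q x))"
  shows "mod_hom R N L h"
proof -
  interpret M: module R M by fact
  show ?thesis
  proof (rule mod_homI)
    fix x assume "x \<in> carrier N"
    then obtain a where a: "a \<in> carrier M" "x = q a"
      using assms(3) by blast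
    then show "h x \<in> carrier L"
      using mod_hom_closed[OF assms(4)] by simp
    fix y assume "y \<in> carrier N"
    then obtain b where b: "b \<in> carrier M" "y = q b"
      using assms(3) by blast
    show "h (x \<oplus>\<^bsub>N\<^esub> y) = h x \<oplus>\<^bsub>L\<^esub> h y"
      using mod_hom_add[OF assms(4) a(1) b(1)] mod_hom_add[OF assms(2) a(1) b(1)] a b by simp
  next
    fix r x assume r: "r \<in> carrier R" and "x \<in> carrier N"
    then obtain a where a: "a \<in> carrier M" "x = q a"
      using assms(3) by blast
    then show "h (r \<odot>\<^bsub>N\<^esub> x) = r \<odot>\<^bsub>L\<^esub> h x"
      using mod_hom_smult[OF assms(4) r a(1)] mod_hom_smult[OF assms(2) r a(1)] by simp
  qed
qed

lemma a_r_coset_add_left: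
  fixes M :: "('a, 'b) module"
  assumes M: "module R M" and H: "submodule H R M" and h: "h \<in> H" and x: "x \<in> carrier M"
  shows "H +>\<^bsub>M\<^esub> (h \<oplus>\<^bsub>M\<^esub> x) = H +>\<^bsub>M\<^esub> x"
proof -
  interpret Q: module R "quot_mod M H"
    by (rule module_quot_mod[OF M H])
  note hom = mod_hom_quot[OF M H]
  have hM: "h \<in> carrier M"
    using submodule_subset[OF H] h by blast
  have "H +>\<^bsub>M\<^esub> h = \<zero>\<^bsub>quot_mod M H\<^esub>"
    using quot_mod_kernel[OF M H hM] h by simp
  then show ?thesis
    using mod_hom_add[OF hom hM x] mod_hom_closed[OF hom x] by simp
qed

definition cok_map ::
    "('a, 'b, 'c) mobj \<Rightarrow> ('a, 'd, 'e) mobj \<Rightarrow> ('b \<Rightarrow> 'd) \<times> ('c \<Rightarrow> 'e) \<Rightarrow>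
     ('d \<Rightarrow> 'd set) \<times> ('e \<Rightarrow> 'e set)" where
  "cok_map f g \<phi> = (\<lambda>x. (fst \<phi> ` carrier (src f)) +>\<^bsub>src g\<^esub> x, \<lambda>y. (snd \<phi> ` carrier (tgt f)) +>\<^bsub>tgt g\<^esub> y)"

lemma
  assumes f: "wf_mobj R f" and g: "wf_mobj R g" and \<phi>: "mobj_hom R f g \<phi>"
  shows wf_cok_mobj: "wf_mobj R (cok_mobj f g \<phi>)"
    and mobj_hom_cok_map: "mobj_hom R g (cok_mobj f g \<phi>) (cok_map f g \<phi>)"
    and mobj_onto_cok_map: "mobj_onto g (cok_mobj f g \<phi>) (cok_map f g \<phi>)"
    and cok_map_kernel_src: "x \<in> carrier (src g) \<Longrightarrow>
      fst (cok_map f g \<phi>) x = \<zero>\<^bsub>src (cok_mobj f g \<phi>)\<^esub> \<longleftrightarrow> x \<in> fst \<phi> ` carrier (src f)"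
    and cok_map_kernel_tgt: "y \<in> carrier (tgt g) \<Longrightarrow>
      snd (cok_map f g \<phi>) y = \<zero>\<^bsub>tgt (cok_mobj f g \<phi>)\<^esub> \<longleftrightarrow> y \<in> snd \<phi> ` carrier (tgt f)"
proof -
  note f' = wf_mobjD[OF f] and g' = wf_mobjD[OF g] and \<phi>' = mobj_homD[OF \<phi>]
  let ?H = "fst \<phi> ` carrier (src f)" and ?K = "snd \<phi> ` carrier (tgt f)"
  note H = submodule_image[OF f'(1) g'(1) \<phi>'(1)] and K = submodule_image[OF f'(2) g'(2) \<phi>'(2)]
  interpret S: module R "src g" by (rule g'(1))
  have s: "src (cok_mobj f g \<phi>) = quot_mod (src g) ?H" "tgt (cok_mobj f g \<phi>) = quot_mod (tgt g) ?K"
    by (simp_all add: cok_mobj_def cok_mod_def)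
  note h1 = mod_hom_quot[OF g'(1) H] and h2 = mod_hom_quot[OF g'(2) K]
  note o1 = quot_mod_onto[OF g'(1) H] and o2 = quot_mod_onto[OF g'(2) K]
  \<comment> \<open>\<open>cok_mobj\<close> takes a union over representatives; commutativity of the
    square shows that all of them give the same coset.\<close>
  have arr: "arr (cok_mobj f g \<phi>) (?H +>\<^bsub>src g\<^esub> x) = ?K +>\<^bsub>tgt g\<^esub> arr g x" if x: "x \<in> carrier (src g)" for x
  proof -
    have eq: "?K +>\<^bsub>tgt g\<^esub> arr g z = ?K +>\<^bsub>tgt g\<^esub> arr g x" if z: "z \<in> ?H +>\<^bsub>src g\<^esub> x" for z
    proof -
      obtain a where a: "a \<in> carrier (src f)" "z = fst \<phi> a \<oplus>\<^bsub>src g\<^esub> x"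
        using z by (auto simp: a_r_coset_def')
      have "arr g z = snd \<phi> (arr f a) \<oplus>\<^bsub>tgt g\<^esub> arr g x"
        using a(2) mod_hom_add[OF g'(3) mod_hom_closed[OF \<phi>'(1) a(1)] x] \<phi>'(3)[OF a(1)] by simp
      moreover have "snd \<phi> (arr f a) \<in> ?K"
        using mod_hom_closed[OF f'(3) a(1)] by blast
      ultimately show ?thesis
        using a_r_coset_add_left[OF g'(2) K _ mod_hom_closed[OF g'(3) x]] by simp
    qed
    have "x \<in> ?H +>\<^bsub>src g\<^esub> x"
    proof -
      have "x = \<zero>\<^bsub>src g\<^esub> \<oplus>\<^bsub>src g\<^esub> x"
        using x by simp
      then show ?thesis
        using submodule_zero[OF H] unfolding a_r_coset_def' by blast
    qed
    then have "(\<Union>z\<in>?H +>\<^bsub>src g\<^esub> x. ?K +>\<^bsub>tgt g\<^esub> arr g z) = ?K +>\<^bsub>tgt g\<^esub> arr g x"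
      by (intro SUP_eq_const eq) blast
    then show ?thesis
      by (simp add: cok_mobj_def)
  qed
  have "mod_hom R (src g) (quot_mod (tgt g) ?K) (\<lambda>x. arr (cok_mobj f g \<phi>) (?H +>\<^bsub>src g\<^esub> x))"
    by (rule mod_hom_cong[OF g'(1) mod_hom_comp[OF g'(3) h2]]) (simp add: arr)
  from mod_hom_factor[OF g'(1) h1 o1 this]
  show "wf_mobj R (cok_mobj f g \<phi>)"
    using module_quot_mod[OF g'(1) H] module_quot_mod[OF g'(2) K] by (simp add: wf_mobj_def s)
  show "mobj_hom R g (cok_mobj f g \<phi>) (cok_map f g \<phi>)"
    using h1 h2 arr by (simp add: mobj_hom_def cok_map_def s)
  show "mobj_onto g (cok_mobj f g \<phi>) (cok_map f g \<phi>)"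
    using o1 o2 by (simp add: mobj_onto_def cok_map_def s)
  show "fst (cok_map f g \<phi>) x = \<zero>\<^bsub>src (cok_mobj f g \<phi>)\<^esub> \<longleftrightarrow> x \<in> ?H" if "x \<in> carrier (src g)"
    using quot_mod_kernel[OF g'(1) H that] by (simp add: cok_map_def s)
  show "snd (cok_map f g \<phi>) y = \<zero>\<^bsub>tgt (cok_mobj f g \<phi>)\<^esub> \<longleftrightarrow> y \<in> ?K" if "y \<in> carrier (tgt g)"
    using quot_mod_kernel[OF g'(2) K that] by (simp add: cok_map_def s)
qed

section \<open>Factoring through surjections and comparing kernels\<close>

text \<open>The universal property of a quotient, for an arbitrary surjection \<open>q\<close>:
  elements with equal values under \<open>q\<close> differ by a kernel element, on which
  \<open>g\<close> vanishes.\<close>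

lemma mod_hom_factor_kernel:
  assumes M: "module R M" and N: "module R N" and L: "module R L"
    and q: "mod_hom R M N q" and onto: "q ` carrier M = carrier N" and g: "mod_hom R M L g"
    and ker: "\<And>x. x \<in> carrier M \<Longrightarrow> q x = \<zero>\<^bsub>N\<^esub> \<Longrightarrow> g x = \<zero>\<^bsub>L\<^esub>"
  shows "\<exists>h. mod_hom R N L h \<and> (\<forall>x\<in>carrier M. h (q x) = g x)"
proof -
  interpret M: module R M by fact
  have eq: "g x = g y" if x: "x \<in> carrier M" and y: "y \<in> carrier M" and e: "q x = q y" for x y
  proof -
    have "q (x \<ominus>\<^bsub>M\<^esub> y) = \<zero>\<^bsub>N\<^esub>"
      using mod_hom_diff[OF M N q x y] diff_self[OF N mod_hom_closed[OF q y]] e by simp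
    then have "g x \<ominus>\<^bsub>L\<^esub> g y = \<zero>\<^bsub>L\<^esub>"
      using ker[of "x \<ominus>\<^bsub>M\<^esub> y"] mod_hom_diff[OF M L g x y] x y by simp
    then show ?thesis
      by (rule diff_eq_zeroD[OF L mod_hom_closed[OF g x] mod_hom_closed[OF g y]])
  qed
  define h where "h z = g (SOME x. x \<in> carrier M \<and> q x = z)" for z
  have h: "h (q x) = g x" if x: "x \<in> carrier M" for x
  proof -
    have "\<exists>y. y \<in> carrier M \<and> q y = q x"
      using x by blast
    from someI_ex[OF this] show ?thesis
      unfolding h_def using eq x by blast
  qed
  have "mod_hom R M L (\<lambda>x. h (q x))"
    by (rule mod_hom_cong[OF M g]) (simp add: h)
  then have "mod_hom R N L h"
    by (rule mod_hom_factor[OF M q onto])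
  then show ?thesis
    using h by blast
qed

lemma mod_iso_of_same_kernel:
  assumes M: "module R M" and N: "module R N" and L: "module R L"
    and q: "mod_hom R M N q" and onto: "q ` carrier M = carrier N"
    and g: "mod_hom R M L g" and gonto: "g ` carrier M = carrier L"
    and ker: "\<And>x. x \<in> carrier M \<Longrightarrow> q x = \<zero>\<^bsub>N\<^esub> \<longleftrightarrow> g x = \<zero>\<^bsub>L\<^esub>"
  shows "\<exists>h. mod_hom R N L h \<and> bij_betw h (carrier N) (carrier L) \<and> (\<forall>x\<in>carrier M. h (q x) = g x)"
proof -
  obtain h where h: "mod_hom R N L h" "\<forall>x\<in>carrier M. h (q x) = g x"
    using mod_hom_factor_kernel[OF M N L q onto g] ker by blast
  obtain k where k: "\<forall>x\<in>carrier M. k (g x) = q x"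
    using mod_hom_factor_kernel[OF M L N g gonto q] ker by blast
  have "inj_on h (carrier N)"
    using h(2) k onto by (intro inj_on_inverseI[of _ k]) force
  moreover have "h ` carrier N = carrier L"
    unfolding onto[symmetric] gonto[symmetric] image_image using h(2) by simp
  ultimately show ?thesis
    using h by (auto simp: bij_betw_def)
qed

text \<open>Two objects presented as quotients of the same \<open>p\<close> are compared through
  their kernels alone. The isomorphism between \<open>f\<close> and its double image under
  \<open>lambda_M\<close> is obtained in this way.\<close>

lemma mobj_isomorphic_of_same_kernel:
  assumes p: "wf_mobj R p" and f: "wf_mobj R f" and g: "wf_mobj R g"
    and \<pi>: "mobj_hom R p f \<pi>" "mobj_onto p f \<pi>" and \<rho>: "mobj_hom R p g \<rho>" "mobj_onto p g \<rho>"
    and k1: "\<And>x. x \<in> carrier (src p) \<Longrightarrow> fst \<pi> x = \<zero>\<^bsub>src f\<^esub> \<longleftrightarrow> fst \<rho> x = \<zero>\<^bsub>src g\<^esub>"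
    and k2: "\<And>y. y \<in> carrier (tgt p) \<Longrightarrow> snd \<pi> y = \<zero>\<^bsub>tgt f\<^esub> \<longleftrightarrow> snd \<rho> y = \<zero>\<^bsub>tgt g\<^esub>"
  shows "mobj_isomorphic R f g"
proof -
  note p' = wf_mobjD[OF p] and f' = wf_mobjD[OF f] and g' = wf_mobjD[OF g]
  note \<pi>' = mobj_homD[OF \<pi>(1)] and \<rho>' = mobj_homD[OF \<rho>(1)]
  have o: "fst \<pi> ` carrier (src p) = carrier (src f)" "snd \<pi> ` carrier (tgt p) = carrier (tgt f)"
    "fst \<rho> ` carrier (src p) = carrier (src g)" "snd \<rho> ` carrier (tgt p) = carrier (tgt g)"
    using \<pi>(2) \<rho>(2) by (auto simp: mobj_onto_def)
  obtain a where a: "mod_hom R (src f) (src g) a" "bij_betw a (carrier (src f)) (carrier (src g))"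
      "\<forall>x\<in>carrier (src p). a (fst \<pi> x) = fst \<rho> x"
    using mod_iso_of_same_kernel[OF p'(1) f'(1) g'(1) \<pi>'(1) o(1) \<rho>'(1) o(3) k1] by blast
  obtain b where b: "mod_hom R (tgt f) (tgt g) b" "bij_betw b (carrier (tgt f)) (carrier (tgt g))"
      "\<forall>y\<in>carrier (tgt p). b (snd \<pi> y) = snd \<rho> y"
    using mod_iso_of_same_kernel[OF p'(2) f'(2) g'(2) \<pi>'(2) o(2) \<rho>'(2) o(4) k2] by blast
  have "b (arr f z) = arr g (a z)" if z: "z \<in> carrier (src f)" for z
  proof -
    have "z \<in> fst \<pi> ` carrier (src p)"
      using z o(1) by simp
    then obtain x where x: "x \<in> carrier (src p)" "z = fst \<pi> x"
      by blast
    have "b (arr f z) = b (snd \<pi> (arr p x))"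
      using \<pi>'(3)[OF x(1)] x(2) by simp
    also have "\<dots> = snd \<rho> (arr p x)"
      using b(3) mod_hom_closed[OF p'(3) x(1)] by blast
    also have "\<dots> = arr g (a z)"
      using \<rho>'(3)[OF x(1)] a(3) x by simp
    finally show ?thesis .
  qed
  then have "mobj_hom R f g (a, b)"
    using a(1) b(1) by (simp add: mobj_hom_def)
  then show ?thesis
    unfolding mobj_isomorphic_def using a(2) b(2) by (intro exI[of _ "(a, b)"]) simp
qed


section \<open>The transpose and its syzygy\<close>

lemma mobj_hom_from_ker_mobj:
  assumes "mobj_hom R q (ker_mobj p X \<pi>) \<delta>"
  shows "mobj_hom R q p \<delta>"
    and "\<And>x. x \<in> carrier (src q) \<Longrightarrow> fst \<pi> (fst \<delta> x) = \<zero>\<^bsub>src X\<^esub>"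
    and "\<And>y. y \<in> carrier (tgt q) \<Longrightarrow> snd \<pi> (snd \<delta> y) = \<zero>\<^bsub>tgt X\<^esub>"
proof -
  note \<delta> = mobj_homD[OF assms]
  show "mobj_hom R q p \<delta>"
    unfolding mobj_hom_def
    using mod_hom_closed[OF \<delta>(1)] mod_hom_closed[OF \<delta>(2)] mod_hom_add[OF \<delta>(1)] mod_hom_add[OF \<delta>(2)]
      mod_hom_smult[OF \<delta>(1)] mod_hom_smult[OF \<delta>(2)] \<delta>(3)
    by (auto simp: ker_mobj_def mem_a_kernel intro!: mod_homI)
  show "fst \<pi> (fst \<delta> x) = \<zero>\<^bsub>src X\<^esub>" if "x \<in> carrier (src q)" for x
    using mod_hom_closed[OF \<delta>(1) that] by (simp add: ker_mobj_def mem_a_kernel)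
  show "snd \<pi> (snd \<delta> y) = \<zero>\<^bsub>tgt X\<^esub>" if "y \<in> carrier (tgt q)" for y
    using mod_hom_closed[OF \<delta>(2) that] by (simp add: ker_mobj_def mem_a_kernel)
qed

context noetherian_local
begin

text \<open>The kernel of the cokernel map consists of the elements \<eta> composed with \<delta>.
  Their coordinates in the dual basis are values of \<eta> at elements of the kernel of \<pi>, hence
  lie in the maximal ideal because \<open>p0\<close> is a cover of \<open>f\<close>.\<close>

lemma transpose_cover:
  assumes f: "wf_mobj R f" and mp: "minimal_presentation R p1 p0 f \<delta> \<pi>"
  shows "projective_cover R (star_mobj R p1)
    (cok_mobj (star_mobj R p0) (star_mobj R p1) (precomp p1 \<delta>, precomp p1 \<delta>))
    (cok_map (star_mobj R p0) (star_mobj R p1) (precomp p1 \<delta>, precomp p1 \<delta>))"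
proof -
  have c0: "projective_cover R p0 f \<pi>" and c1: "projective_cover R p1 (ker_mobj p0 f \<pi>) \<delta>"
    using mp by (auto simp: minimal_presentation_def)
  note P0 = projective_coverD[OF c0] and P1 = projective_coverD[OF c1]
  note \<delta> = mobj_hom_from_ker_mobj[OF P1(4)] and p1 = wf_mobjD[OF P1(3)]
  note \<delta>' = mobj_homD[OF \<delta>(1)]
  obtain n e \<phi> m d \<psi> where db: "dual_basis R p1 n e \<phi> m d \<psi>"
    using P1(1) by blast
  note D = dual_basisD[OF db]
  let ?s0 = "star_mobj R p0" and ?s1 = "star_mobj R p1" and ?pc = "(precomp p1 \<delta>, precomp p1 \<delta>)"
  note w0 = wf_star_mobj[OF P0(3)] and w1 = wf_star_mobj[OF P1(3)]
  note pc = mobj_hom_precomp[OF P1(3) P0(3) \<delta>(1)]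
  show ?thesis
  proof (rule projective_coverI[OF dual_basis_star[OF db] wf_cok_mobj[OF w0 w1 pc]
        mobj_hom_cok_map[OF w0 w1 pc] mobj_onto_cok_map[OF w0 w1 pc]])
    fix j x assume j: "j < m" and x: "x \<in> carrier (src ?s1)"
      and "fst (cok_map ?s0 ?s1 ?pc) x = \<zero>\<^bsub>src (cok_mobj ?s0 ?s1 ?pc)\<^esub>"
    then obtain \<eta> where \<eta>: "\<eta> \<in> carrier (src ?s0)" "x = precomp p1 \<delta> \<eta>"
      using cok_map_kernel_src[OF w0 w1 pc x] by auto
    have dj: "d j \<in> carrier (tgt p1)"
      using D(6) j by auto
    have "snd \<eta> (snd \<delta> (d j)) \<in> max_ideal"
      using \<eta>(1) \<delta>(3)[OF dj] mod_hom_closed[OF \<delta>'(2) dj]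
      by (intro projective_cover_kernel_tgt[OF c0 f]) (auto simp: mem_src_star)
    then show "snd (arr ?s1 x) (d j) \<in> max_ideal"
      by (simp add: snd_arr_star dj \<eta>(2) snd_precomp)
  next
    fix i y assume i: "i < n" and y: "y \<in> carrier (tgt ?s1)"
      and "snd (cok_map ?s0 ?s1 ?pc) y = \<zero>\<^bsub>tgt (cok_mobj ?s0 ?s1 ?pc)\<^esub>"
    then obtain \<eta> where \<eta>: "\<eta> \<in> carrier (tgt ?s0)" "y = precomp p1 \<delta> \<eta>"
      using cok_map_kernel_tgt[OF w0 w1 pc y] by auto
    have ei: "e i \<in> carrier (src p1)"
      using D(5) i by auto
    \<comment> \<open>Duality swaps the two criteria: a source element of the dual kills the source
      of \<open>p0\<close> and falls under the target criterion, whereas here \<eta> is arbitrary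
      but the point of evaluation comes from the source.\<close>
    have "snd \<eta> (arr p0 (fst \<delta> (e i))) \<in> max_ideal"
      using \<eta>(1) \<delta>(2)[OF ei] mod_hom_closed[OF \<delta>'(1) ei]
      by (intro projective_cover_kernel_src[OF c0 f]) (auto simp: mem_tgt_star)
    then show "snd y (arr p1 (e i)) \<in> max_ideal"
      by (simp add: \<eta>(2) snd_precomp mod_hom_closed[OF p1(3) ei] \<delta>'(3)[OF ei])
  qed
qed

text \<open>
  \<open>\<lambda> f\<close> is the image of \<open>p0* \<rightarrow> p1*\<close>; since \<open>p1\<close> maps onto the kernel of \<open>\<pi>\<close>, a functional is
  killed iff it vanishes on that kernel, and \<open>p1\<close> disappears from the description.
\<close>

lemma lambda_M_quotient:
  fixes f :: "('a, 'c, 'd) mobj"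
  assumes f: "is_mobj R f"
  shows "is_mobj R (lambda_M R f)"
    and "\<exists>(p :: ('a, nat \<Rightarrow> 'a, nat \<Rightarrow> 'a) mobj) \<pi> \<kappa>. projective_cover R p f \<pi> \<and>
      mobj_hom R (star_mobj R p) (lambda_M R f) \<kappa> \<and> mobj_onto (star_mobj R p) (lambda_M R f) \<kappa> \<and>
      (\<forall>\<eta>\<in>carrier (src (star_mobj R p)). fst \<kappa> \<eta> = \<zero>\<^bsub>src (lambda_M R f)\<^esub> \<longleftrightarrow>
         (\<forall>y\<in>carrier (tgt p). snd \<pi> y = \<zero>\<^bsub>tgt f\<^esub> \<longrightarrow> snd \<eta> y = \<zero>)) \<and>
      (\<forall>\<eta>\<in>carrier (tgt (star_mobj R p)). snd \<kappa> \<eta> = \<zero>\<^bsub>tgt (lambda_M R f)\<^esub> \<longleftrightarrow>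
         (\<forall>y\<in>carrier (tgt p). snd \<pi> y = \<zero>\<^bsub>tgt f\<^esub> \<longrightarrow> snd \<eta> y = \<zero>))"
proof -
  note wf = is_mobj_imp_wf[OF f]
  obtain p1 p0 :: "('a, nat \<Rightarrow> 'a, nat \<Rightarrow> 'a) mobj" and \<delta> \<pi> where
    some: "(SOME (p1, p0 :: ('a, nat \<Rightarrow> 'a, nat \<Rightarrow> 'a) mobj, \<delta>, \<pi>). minimal_presentation R p1 p0 f \<delta> \<pi>) = (p1, p0, \<delta>, \<pi>)"
    by (metis prod_cases4)
  have "\<exists>t. case t of (p1, p0 :: ('a, nat \<Rightarrow> 'a, nat \<Rightarrow> 'a) mobj, \<delta>, \<pi>) \<Rightarrow> minimal_presentation R (p1 :: ('a, nat \<Rightarrow> 'a, nat \<Rightarrow> 'a) mobj) p0 f \<delta> \<pi>"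
    using minimal_presentation_exists[OF f] by auto
  from someI_ex[OF this] have mp: "minimal_presentation R p1 p0 f \<delta> \<pi>"
    unfolding some by simp
  let ?s0 = "star_mobj R p0" and ?s1 = "star_mobj R p1" and ?pc = "(precomp p1 \<delta>, precomp p1 \<delta>)"
  define X where "X = cok_mobj ?s0 ?s1 ?pc"
  define c where "c = cok_map ?s0 ?s1 ?pc"
  have Tr: "Tr_M R f = X"
    unfolding Tr_M_def some X_def by simp
  have c0: "projective_cover R p0 f \<pi>" and c1: "projective_cover R p1 (ker_mobj p0 f \<pi>) \<delta>"
    using mp by (auto simp: minimal_presentation_def)
  note P0 = projective_coverD[OF c0] and P1 = projective_coverD[OF c1]
  note \<delta> = mobj_hom_from_ker_mobj[OF P1(4)]
  note \<delta>' = mobj_homD[OF \<delta>(1)]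
  note w0 = wf_star_mobj[OF P0(3)] and w1 = wf_star_mobj[OF P1(3)]
  note pc = mobj_hom_precomp[OF P1(3) P0(3) \<delta>(1)]
  note pc' = mobj_homD[OF pc, simplified]
  have cov: "projective_cover R ?s1 X c"
    unfolding X_def c_def by (rule transpose_cover[OF wf mp])
  note C = projective_coverD[OF cov]
  have wX: "wf_mobj R X"
    unfolding X_def by (rule wf_cok_mobj[OF w0 w1 pc])
  note X' = wf_mobjD[OF wX] and c' = mobj_homD[OF C(4)]
  have "is_mobj R X"
    using C(2,5) fg_module_hom_image[OF _ X'(1) c'(1)] fg_module_hom_image[OF _ X'(2) c'(2)] X'(3)
    by (simp add: is_mobj_def mobj_onto_def)
  then have "\<exists>t. case t of (q :: ('a, nat \<Rightarrow> 'a, nat \<Rightarrow> 'a) mobj, \<rho>) \<Rightarrow> projective_cover R q X \<rho>"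
    using projective_cover_exists by auto
  from someI_ex[OF this] obtain q \<rho> where
    someq: "(SOME (q :: ('a, nat \<Rightarrow> 'a, nat \<Rightarrow> 'a) mobj, \<rho>). projective_cover R q X \<rho>) = (q, \<rho>)"
    and cq: "projective_cover R q X \<rho>"
    by (metis (mono_tags, lifting) case_prodE)
  have lam: "lambda_M R f = ker_mobj q X \<rho>"
    unfolding lambda_M_def Omega_M_def Tr someq by simp
  note Q = projective_coverD[OF cq]
  show "is_mobj R (lambda_M R f)"
    unfolding lam by (rule is_mobj_ker_mobj[OF Q(2) wX Q(4)])
  \<comment> \<open>\<open>Omega_M\<close> uses some cover \<open>q\<close> of the transpose;
    uniqueness identifies it with the cover by the dual of \<open>p1\<close>.\<close>
  obtain u where u: "mobj_hom R ?s1 q u"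
      and b1: "bij_betw (fst u) (carrier (src ?s1)) (carrier (src q))"
      and b2: "bij_betw (snd u) (carrier (tgt ?s1)) (carrier (tgt q))"
      and u1: "\<And>x. x \<in> carrier (src ?s1) \<Longrightarrow> fst \<rho> (fst u x) = fst c x"
      and u2: "\<And>y. y \<in> carrier (tgt ?s1) \<Longrightarrow> snd \<rho> (snd u y) = snd c y"
    using projective_cover_unique[OF cov cq wX] by blast
  note u' = mobj_homD[OF u] and q' = wf_mobjD[OF Q(3)] and w0' = wf_mobjD[OF w0] and w1' = wf_mobjD[OF w1]
  have k1: "fst c x = \<zero>\<^bsub>src X\<^esub> \<longleftrightarrow> x \<in> precomp p1 \<delta> ` carrier (src ?s0)" if "x \<in> carrier (src ?s1)" for x
    using cok_map_kernel_src[OF w0 w1 pc that] by (simp add: X_def c_def)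
  have k2: "snd c x = \<zero>\<^bsub>tgt X\<^esub> \<longleftrightarrow> x \<in> precomp p1 \<delta> ` carrier (tgt ?s0)" if "x \<in> carrier (tgt ?s1)" for x
    using cok_map_kernel_tgt[OF w0 w1 pc that] by (simp add: X_def c_def)
  note pcs = mod_hom_closed[OF pc'(1)] and pct = mod_hom_closed[OF pc'(2)]
  \<comment> \<open>Precomposition with \<delta> followed by the identification with
    \<open>q\<close>. Its image is the kernel of \<rho>, which is
    \<open>lambda_M R f\<close>.\<close>
  let ?\<kappa> = "(\<lambda>\<eta>. fst u (precomp p1 \<delta> \<eta>), \<lambda>\<eta>. snd u (precomp p1 \<delta> \<eta>))"
  have in1: "fst u (precomp p1 \<delta> \<eta>) \<in> a_kernel (src q) (src X) (fst \<rho>)" if "\<eta> \<in> carrier (src ?s0)" for \<eta>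
    using that pcs[OF that] k1[OF pcs[OF that]] u1 mod_hom_closed[OF u'(1)] by (simp add: mem_a_kernel)
  have in2: "snd u (precomp p1 \<delta> \<eta>) \<in> a_kernel (tgt q) (tgt X) (snd \<rho>)" if "\<eta> \<in> carrier (tgt ?s0)" for \<eta>
    using that pct[OF that] k2[OF pct[OF that]] u2 mod_hom_closed[OF u'(2)] by (simp add: mem_a_kernel)
  have h1: "mod_hom R (src ?s0) (src (lambda_M R f)) (fst ?\<kappa>)"
    using in1 mod_hom_add[OF mod_hom_comp[OF pc'(1) u'(1)]] mod_hom_smult[OF mod_hom_comp[OF pc'(1) u'(1)]]
    by (intro mod_homI) (simp_all add: lam ker_mobj_def)
  have h2: "mod_hom R (tgt ?s0) (tgt (lambda_M R f)) (snd ?\<kappa>)"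
    using in2 mod_hom_add[OF mod_hom_comp[OF pc'(2) u'(2)]] mod_hom_smult[OF mod_hom_comp[OF pc'(2) u'(2)]]
    by (intro mod_homI) (simp_all add: lam ker_mobj_def)
  have "mobj_hom R ?s0 (lambda_M R f) ?\<kappa>"
    using h1 h2 pc'(3) u'(3)[OF pcs] by (simp add: mobj_hom_def lam ker_mobj_def)
  moreover have "mobj_onto ?s0 (lambda_M R f) ?\<kappa>"
  proof -
    have "z \<in> fst ?\<kappa> ` carrier (src ?s0)" if z: "z \<in> a_kernel (src q) (src X) (fst \<rho>)" for z
    proof -
      have "z \<in> fst u ` carrier (src ?s1)"
        using z bij_betw_imp_surj_on[OF b1] by (simp add: mem_a_kernel)
      then obtain w where w: "w \<in> carrier (src ?s1)" "z = fst u w"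
        by blast
      then have "w \<in> precomp p1 \<delta> ` carrier (src ?s0)"
        using z u1 k1 by (simp add: mem_a_kernel)
      then show ?thesis
        using w(2) by auto
    qed
    moreover have "z \<in> snd ?\<kappa> ` carrier (tgt ?s0)" if z: "z \<in> a_kernel (tgt q) (tgt X) (snd \<rho>)" for z
    proof -
      have "z \<in> snd u ` carrier (tgt ?s1)"
        using z bij_betw_imp_surj_on[OF b2] by (simp add: mem_a_kernel)
      then obtain w where w: "w \<in> carrier (tgt ?s1)" "z = snd u w"
        by blast
      then have "w \<in> precomp p1 \<delta> ` carrier (tgt ?s0)"
        using z u2 k2 by (simp add: mem_a_kernel)
      then show ?thesis
        using w(2) by auto
    qed
    ultimately show ?thesis
      using in1 in2 unfolding mobj_onto_def lam ker_mobj_def by auto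
  qed
  moreover have kill: "(\<forall>y\<in>carrier (tgt p1). h (snd \<delta> y) = \<zero>) \<longleftrightarrow>
      (\<forall>y\<in>carrier (tgt p0). snd \<pi> y = \<zero>\<^bsub>tgt f\<^esub> \<longrightarrow> h y = \<zero>)" for h
  proof -
    have im: "snd \<delta> ` carrier (tgt p1) = {y \<in> carrier (tgt p0). snd \<pi> y = \<zero>\<^bsub>tgt f\<^esub>}"
      using P1(5) by (auto simp: mobj_onto_def ker_mobj_def a_kernel_def')
    have "(\<forall>y\<in>carrier (tgt p1). h (snd \<delta> y) = \<zero>) \<longleftrightarrow> (\<forall>z\<in>snd \<delta> ` carrier (tgt p1). h z = \<zero>)"
      by simp
    then show ?thesis
      unfolding im by auto
  qed
  moreover have "fst ?\<kappa> \<eta> = \<zero>\<^bsub>src (lambda_M R f)\<^esub> \<longleftrightarrow>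
      (\<forall>y\<in>carrier (tgt p0). snd \<pi> y = \<zero>\<^bsub>tgt f\<^esub> \<longrightarrow> snd \<eta> y = \<zero>)"
    if \<eta>: "\<eta> \<in> carrier (src ?s0)" for \<eta>
  proof -
    let ?z = "\<zero>\<^bsub>src ?s1\<^esub>"
    have z: "?z \<in> carrier (src ?s1)" "fst u ?z = \<zero>\<^bsub>src q\<^esub>"
      using abelian_group.axioms(1) abelian_monoid.zero_closed module.axioms(2) w1'(1)
        mod_hom_zero[OF w1'(1) q'(1) u'(1)] by metis+
    have ev: "snd ?z y = \<zero>" if "y \<in> carrier (tgt p1)" for y
      using mod_hom_zero[OF w1'(1) module_ring_mod[OF is_cring] functional_eval_src_star[OF that]] by simp
    have "fst u (precomp p1 \<delta> \<eta>) = fst u ?z \<longleftrightarrow> precomp p1 \<delta> \<eta> = ?z"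
      using inj_on_eq_iff[OF bij_betw_imp_inj_on[OF b1] pcs[OF \<eta>] z(1)] .
    also have "\<dots> \<longleftrightarrow> (\<forall>y\<in>carrier (tgt p1). snd (precomp p1 \<delta> \<eta>) y = \<zero>)"
      using src_star_eqI[OF pcs[OF \<eta>] z(1)] ev by (metis (full_types))
    also have "\<dots> \<longleftrightarrow> (\<forall>y\<in>carrier (tgt p1). snd \<eta> (snd \<delta> y) = \<zero>)"
      by (simp add: snd_precomp)
    also note kill
    finally show ?thesis
      by (simp add: z(2) lam ker_mobj_def)
  qed
  moreover have "snd ?\<kappa> \<eta> = \<zero>\<^bsub>tgt (lambda_M R f)\<^esub> \<longleftrightarrow>
      (\<forall>y\<in>carrier (tgt p0). snd \<pi> y = \<zero>\<^bsub>tgt f\<^esub> \<longrightarrow> snd \<eta> y = \<zero>)"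
    if \<eta>: "\<eta> \<in> carrier (tgt ?s0)" for \<eta>
  proof -
    let ?z = "\<zero>\<^bsub>tgt ?s1\<^esub>"
    have z: "?z \<in> carrier (tgt ?s1)" "snd u ?z = \<zero>\<^bsub>tgt q\<^esub>"
      using abelian_group.axioms(1) abelian_monoid.zero_closed module.axioms(2) w1'(2)
        mod_hom_zero[OF w1'(2) q'(2) u'(2)] by metis+
    have ev: "snd ?z y = \<zero>" if "y \<in> carrier (tgt p1)" for y
      using mod_hom_zero[OF w1'(2) module_ring_mod[OF is_cring] functional_eval_tgt_star[OF that]] by simp
    have "snd u (precomp p1 \<delta> \<eta>) = snd u ?z \<longleftrightarrow> precomp p1 \<delta> \<eta> = ?z"
      using inj_on_eq_iff[OF bij_betw_imp_inj_on[OF b2] pct[OF \<eta>] z(1)] .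
    also have "\<dots> \<longleftrightarrow> (\<forall>y\<in>carrier (tgt p1). snd (precomp p1 \<delta> \<eta>) y = \<zero>)"
      using tgt_star_eqI[OF P1(3) pct[OF \<eta>] z(1)] ev by (metis (full_types))
    also have "\<dots> \<longleftrightarrow> (\<forall>y\<in>carrier (tgt p1). snd \<eta> (snd \<delta> y) = \<zero>)"
      by (simp add: snd_precomp)
    also note kill
    finally show ?thesis
      by (simp add: z(2) lam ker_mobj_def)
  qed
  ultimately show "\<exists>(p :: ('a, nat \<Rightarrow> 'a, nat \<Rightarrow> 'a) mobj) \<pi> \<kappa>. projective_cover R p f \<pi> \<and>
      mobj_hom R (star_mobj R p) (lambda_M R f) \<kappa> \<and> mobj_onto (star_mobj R p) (lambda_M R f) \<kappa> \<and>
      (\<forall>\<eta>\<in>carrier (src (star_mobj R p)). fst \<kappa> \<eta> = \<zero>\<^bsub>src (lambda_M R f)\<^esub> \<longleftrightarrow>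
         (\<forall>y\<in>carrier (tgt p). snd \<pi> y = \<zero>\<^bsub>tgt f\<^esub> \<longrightarrow> snd \<eta> y = \<zero>)) \<and>
      (\<forall>\<eta>\<in>carrier (tgt (star_mobj R p)). snd \<kappa> \<eta> = \<zero>\<^bsub>tgt (lambda_M R f)\<^esub> \<longleftrightarrow>
         (\<forall>y\<in>carrier (tgt p). snd \<pi> y = \<zero>\<^bsub>tgt f\<^esub> \<longrightarrow> snd \<eta> y = \<zero>))"
    using c0 by (intro exI[of _ p0] exI[of _ \<pi>] exI[of _ ?\<kappa>]) simp
qed

end


section \<open>Double duals\<close>

text \<open>Reflexivity of projective objects: by the dual basis, \<gamma> is evaluation at the
  element whose coordinates are the values of \<gamma> on the generators of the dual. The second
  clause says that functionals vanishing on the source of the dual are evaluations at source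
  elements.\<close>

lemma functional_tgt_star_is_eval:
  assumes db: "dual_basis R p n e \<phi> m d \<psi>" and \<gamma>: "functional R (tgt (star_mobj R p)) \<gamma>"
  shows "\<exists>x\<in>carrier (src p). \<exists>y\<in>carrier (tgt p).
    (\<forall>\<eta>\<in>carrier (tgt (star_mobj R p)). \<gamma> \<eta> = snd \<eta> (arr p x \<oplus>\<^bsub>tgt p\<^esub> y)) \<and>
    ((\<forall>\<eta>\<in>carrier (src (star_mobj R p)). \<gamma> (arr (star_mobj R p) \<eta>) = \<zero>\<^bsub>R\<^esub>) \<longrightarrow> y = \<zero>\<^bsub>tgt p\<^esub>)"
proof -
  note D = dual_basisD[OF db]
  have p: "wf_mobj R p"
    using db by (simp add: dual_basis_def)
  let ?S = "src (star_mobj R p)" and ?T = "tgt (star_mobj R p)" and ?a = "arr (star_mobj R p)"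
  interpret R: cring R
    using D(1) by (rule module.axioms)
  note E = dual_basisD[OF dual_basis_star[OF db]]
  note rm = module_ring_mod[OF R.is_cring]
  define r where "r i = \<gamma> (tgt_star_of p (\<phi> i))" for i
  define s where "s j = \<gamma> (?a (src_star_of p (\<psi> j)))" for j
  have r: "r \<in> coeffs R n" and s: "s \<in> coeffs R m"
    using E(5,6) mod_hom_closed[OF E(3)] functional_closed[OF \<gamma>] unfolding r_def s_def Pi_iff by blast+
  let ?x = "lincomb (src p) n r e" and ?y = "lincomb (tgt p) m s d"
  have x: "?x \<in> carrier (src p)" and y: "?y \<in> carrier (tgt p)"
    by (rule lincomb_closed[OF D(1) r D(5)], rule lincomb_closed[OF D(2) s D(6)])
  have "\<gamma> \<eta> = snd \<eta> (arr p ?x \<oplus>\<^bsub>tgt p\<^esub> ?y)" if \<eta>: "\<eta> \<in> carrier ?T" for \<eta>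
  proof -
    have f\<eta>: "functional R (tgt p) (snd \<eta>)"
      using \<eta> by (simp add: mem_tgt_star)
    have c1: "(\<lambda>j. snd \<eta> (d j)) \<in> coeffs R m" and c2: "(\<lambda>i. snd \<eta> (arr p (e i))) \<in> coeffs R n"
      using functional_closed[OF f\<eta>] D(5,6) mod_hom_closed[OF D(3)] by auto
    let ?l = "lincomb ?S m (\<lambda>j. snd \<eta> (d j)) (\<lambda>j. src_star_of p (\<psi> j))"
    let ?k = "lincomb ?T n (\<lambda>i. snd \<eta> (arr p (e i))) (\<lambda>i. tgt_star_of p (\<phi> i))"
    have l: "?l \<in> carrier ?S" and k: "?k \<in> carrier ?T"
      by (rule lincomb_closed[OF E(1) c1 E(5)], rule lincomb_closed[OF E(2) c2 E(6)])
    have "\<gamma> (?a ?l) = lincomb (ring_mod R) m (\<lambda>j. snd \<eta> (d j)) s"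
      unfolding s_def by (rule lincomb_hom[OF E(1) rm mod_hom_comp[OF E(3) \<gamma>] c1 E(5)])
    also have "\<dots> = lincomb (ring_mod R) m s (\<lambda>j. snd \<eta> (d j))"
      by (rule lincomb_ring_mod_commute[OF R.is_cring c1 s])
    also have "\<dots> = snd \<eta> ?y"
      by (rule lincomb_hom[OF D(2) rm f\<eta> s D(6), symmetric])
    finally have 1: "\<gamma> (?a ?l) = snd \<eta> ?y" .
    have "\<gamma> ?k = lincomb (ring_mod R) n (\<lambda>i. snd \<eta> (arr p (e i))) r"
      unfolding r_def by (rule lincomb_hom[OF E(2) rm \<gamma> c2 E(6)])
    also have "\<dots> = lincomb (ring_mod R) n r (\<lambda>i. snd \<eta> (arr p (e i)))"
      by (rule lincomb_ring_mod_commute[OF R.is_cring c2 r])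
    also have "\<dots> = snd \<eta> (arr p ?x)"
      by (rule lincomb_hom[OF D(1) rm mod_hom_comp[OF D(3) f\<eta>] r D(5), symmetric])
    finally have 2: "\<gamma> ?k = snd \<eta> (arr p ?x)" .
    have "\<gamma> \<eta> = \<gamma> (?a ?l \<oplus>\<^bsub>?T\<^esub> ?k)"
      using E(10)[OF \<eta>] by simp
    also have "\<dots> = snd \<eta> ?y \<oplus>\<^bsub>R\<^esub> snd \<eta> (arr p ?x)"
      using mod_hom_add[OF \<gamma> mod_hom_closed[OF E(3) l] k] by (simp add: 1 2)
    also have "\<dots> = snd \<eta> (arr p ?x) \<oplus>\<^bsub>R\<^esub> snd \<eta> ?y"
      using functional_closed[OF f\<eta>] y mod_hom_closed[OF D(3) x] by (intro R.a_comm) auto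
    also have "\<dots> = snd \<eta> (arr p ?x \<oplus>\<^bsub>tgt p\<^esub> ?y)"
      using mod_hom_add[OF f\<eta> mod_hom_closed[OF D(3) x] y] by simp
    finally show ?thesis .
  qed
  moreover have "?y = \<zero>\<^bsub>tgt p\<^esub>" if "\<forall>\<eta>\<in>carrier ?S. \<gamma> (?a \<eta>) = \<zero>\<^bsub>R\<^esub>"
  proof -
    have "?y = lincomb (tgt p) m (\<lambda>j. \<zero>\<^bsub>R\<^esub>) d"
      using that E(5) by (intro lincomb_cong[OF D(2) s D(6)]) (auto simp: s_def)
    then show ?thesis
      by (simp add: lincomb_zero[OF D(2,6)])
  qed
  ultimately show ?thesis
    using x y by blast
qed

context noetherian_local
begin

text \<open>Both sides are exhibited as quotients of the first cover \<open>p\<close> of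
  \<open>f\<close>. The hypothesis \<open>radical\<close> makes the dual of \<open>p\<close> a cover
  of the first image under \<open>lambda_M\<close>, and \<open>torsionless\<close> makes the two
  kernels agree.\<close>

lemma mobj_isomorphic_lambda_M_lambda_M:
  fixes f :: "('a, 'c, 'd) mobj"
  assumes f: "is_mono_mobj R f"
    and torsionless: "\<And>y. y \<in> carrier (tgt f) \<Longrightarrow> y \<noteq> \<zero>\<^bsub>tgt f\<^esub> \<Longrightarrow> \<exists>h. functional R (tgt f) h \<and> h y \<noteq> \<zero>"
    and radical: "\<And>h y. functional R (tgt f) h \<Longrightarrow> y \<in> carrier (tgt f) \<Longrightarrow> h y \<in> max_ideal"
  shows "mobj_isomorphic R f (lambda_M R (lambda_M R f))"
proof -
  define g where "g = lambda_M R f"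
  have mf: "is_mobj R f" and inj: "inj_on (arr f) (carrier (src f))"
    using f by (auto simp: is_mono_mobj_def)
  note wf = is_mobj_imp_wf[OF mf]
  have mg: "is_mobj R g" and ml: "is_mobj R (lambda_M R g)"
    unfolding g_def using lambda_M_quotient(1)[OF lambda_M_quotient(1)[OF mf]] lambda_M_quotient(1)[OF mf] by auto
  note wg = is_mobj_imp_wf[OF mg] and wl = is_mobj_imp_wf[OF ml]
  obtain p :: "('a, nat \<Rightarrow> 'a, nat \<Rightarrow> 'a) mobj" and \<pi> \<kappa> where cp: "projective_cover R p f \<pi>"
      and \<kappa>: "mobj_hom R (star_mobj R p) g \<kappa>" "mobj_onto (star_mobj R p) g \<kappa>"
      and \<kappa>1: "\<And>\<eta>. \<eta> \<in> carrier (src (star_mobj R p)) \<Longrightarrow> fst \<kappa> \<eta> = \<zero>\<^bsub>src g\<^esub> \<longleftrightarrow>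
         (\<forall>y\<in>carrier (tgt p). snd \<pi> y = \<zero>\<^bsub>tgt f\<^esub> \<longrightarrow> snd \<eta> y = \<zero>)"
      and \<kappa>2: "\<And>\<eta>. \<eta> \<in> carrier (tgt (star_mobj R p)) \<Longrightarrow> snd \<kappa> \<eta> = \<zero>\<^bsub>tgt g\<^esub> \<longleftrightarrow>
         (\<forall>y\<in>carrier (tgt p). snd \<pi> y = \<zero>\<^bsub>tgt f\<^esub> \<longrightarrow> snd \<eta> y = \<zero>)"
    using lambda_M_quotient(2)[OF mf] unfolding g_def by blast
  obtain p' :: "('a, nat \<Rightarrow> 'a, nat \<Rightarrow> 'a) mobj" and \<pi>' \<kappa>' where cp': "projective_cover R p' g \<pi>'"
      and \<kappa>': "mobj_hom R (star_mobj R p') (lambda_M R g) \<kappa>'" "mobj_onto (star_mobj R p') (lambda_M R g) \<kappa>'"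
      and \<kappa>1': "\<And>\<eta>. \<eta> \<in> carrier (src (star_mobj R p')) \<Longrightarrow> fst \<kappa>' \<eta> = \<zero>\<^bsub>src (lambda_M R g)\<^esub> \<longleftrightarrow>
         (\<forall>y\<in>carrier (tgt p'). snd \<pi>' y = \<zero>\<^bsub>tgt g\<^esub> \<longrightarrow> snd \<eta> y = \<zero>)"
      and \<kappa>2': "\<And>\<eta>. \<eta> \<in> carrier (tgt (star_mobj R p')) \<Longrightarrow> snd \<kappa>' \<eta> = \<zero>\<^bsub>tgt (lambda_M R g)\<^esub> \<longleftrightarrow>
         (\<forall>y\<in>carrier (tgt p'). snd \<pi>' y = \<zero>\<^bsub>tgt g\<^esub> \<longrightarrow> snd \<eta> y = \<zero>)"
    using lambda_M_quotient(2)[OF mg] by blast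
  note P = projective_coverD[OF cp] and P' = projective_coverD[OF cp']
  note wp = wf_mobjD[OF P(3)] and wp' = wf_mobjD[OF P'(3)] and wf' = wf_mobjD[OF wf]
  note \<pi> = mobj_homD[OF P(4)]
  obtain n e \<phi> m d \<psi> where db: "dual_basis R p n e \<phi> m d \<psi>"
    using P(1) by blast
  note D = dual_basisD[OF db]
  let ?S = "src (star_mobj R p)" and ?T = "tgt (star_mobj R p)"
  let ?S' = "src (star_mobj R p')" and ?T' = "tgt (star_mobj R p')"
  \<comment> \<open>A functional on the target of \<open>p\<close> that vanishes on the kernel of
    \<pi> factors through the target of \<open>f\<close>, where \<open>radical\<close> controls its
    values.\<close>
  have in_rad: "\<eta> y \<in> max_ideal"
    if \<eta>: "functional R (tgt p) \<eta>" and k: "\<forall>y\<in>carrier (tgt p). snd \<pi> y = \<zero>\<^bsub>tgt f\<^esub> \<longrightarrow> \<eta> y = \<zero>"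
      and y: "y \<in> carrier (tgt p)" for \<eta> y
  proof -
    obtain h where h: "functional R (tgt f) h" "\<forall>y\<in>carrier (tgt p). h (snd \<pi> y) = \<eta> y"
      using mod_hom_factor_kernel[OF wp(2) wf'(2) module_ring_mod[OF is_cring] \<pi>(2) _ \<eta>] k P(5)
      by (auto simp: mobj_onto_def)
    then show ?thesis
      using radical[OF h(1) mod_hom_closed[OF \<pi>(2) y]] y by simp
  qed
  have cs: "projective_cover R (star_mobj R p) g \<kappa>"
  proof (rule projective_coverI[OF dual_basis_star[OF db] wg \<kappa>])
    fix j x assume j: "j < m" and x: "x \<in> carrier ?S" and k: "fst \<kappa> x = \<zero>\<^bsub>src g\<^esub>"
    have "d j \<in> carrier (tgt p)"
      using D(6) j by auto
    then show "snd (arr (star_mobj R p) x) (d j) \<in> max_ideal"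
      using in_rad[of "snd x" "d j"] \<kappa>1[OF x] k x by (simp add: snd_arr_star mem_src_star)
  next
    fix i y assume i: "i < n" and y: "y \<in> carrier ?T" and k: "snd \<kappa> y = \<zero>\<^bsub>tgt g\<^esub>"
    have "arr p (e i) \<in> carrier (tgt p)"
      using D(5) i mod_hom_closed[OF D(3)] by auto
    then show "snd y (arr p (e i)) \<in> max_ideal"
      using in_rad[of "snd y"] \<kappa>2[OF y] k y by (simp add: mem_tgt_star)
  qed
  \<comment> \<open>\<open>p'\<close> is only some cover of \<open>g\<close>; by uniqueness it is a
    copy of the dual of \<open>p\<close>.\<close>
  obtain v where v: "mobj_hom R p' (star_mobj R p) v"
      and v1: "bij_betw (fst v) (carrier (src p')) (carrier ?S)"
      and v2: "bij_betw (snd v) (carrier (tgt p')) (carrier ?T)"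
      and v\<kappa>: "\<And>y. y \<in> carrier (tgt p') \<Longrightarrow> snd \<kappa> (snd v y) = snd \<pi>' y"
    using projective_cover_unique[OF cp' cs wg] by blast
  note v' = mobj_homD[OF v]
  note vc = mod_hom_closed[OF v'(2)] and vc1 = mod_hom_closed[OF v'(1)]
  \<comment> \<open>The pairing between the targets of \<open>p\<close> and \<open>p'\<close>: the
    functional corresponding to \<open>y'\<close>, evaluated at \<open>y\<close>.\<close>
  define t where "t y = (\<lambda>y'. snd (snd v y') y)" for y
  have t: "functional R (tgt p') (t y)" if "y \<in> carrier (tgt p)" for y
    unfolding t_def by (rule mod_hom_comp[OF v'(2) functional_eval_tgt_star[OF that]])
  have tf: "functional R (tgt p) (\<lambda>y. t y y')" if "y' \<in> carrier (tgt p')" for y'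
    using vc[OF that] by (simp add: mem_tgt_star t_def)
  have ta: "t (arr p x) (arr p' x') = \<zero>" if "x \<in> carrier (src p)" "x' \<in> carrier (src p')" for x x'
    using vc1[OF that(2)] that mod_hom_closed[OF wp(3)] by (simp add: t_def v'(3) snd_arr_star mem_src_star)
  note ac = mod_hom_closed[OF wp(3)]
  have s1: "src_star_of p' (t (arr p x)) \<in> carrier ?S'" if "x \<in> carrier (src p)" for x
    using t[OF ac[OF that]] ta[OF that] by (intro src_star_of_closed[OF P'(3)]) auto
  have s2: "tgt_star_of p' (t y) \<in> carrier ?T'" if "y \<in> carrier (tgt p)" for y
    using t[OF that] by (intro tgt_star_of_closed[OF P'(3)]) auto
  \<comment> \<open>The evaluation map into the double dual, with the dual of \<open>p\<close>
    replaced by its copy \<open>p'\<close>.\<close>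
  define \<theta> where "\<theta> = (\<lambda>x. src_star_of p' (t (arr p x)), \<lambda>y. tgt_star_of p' (t y))"
  have \<theta>: "mobj_hom R p (star_mobj R p') \<theta>"
  proof -
    note ms = module_star[OF P'(3)]
    interpret S': module R ?S' by (rule ms(1))
    interpret T': module R ?T' by (rule ms(2))
    interpret pS: module R "src p" by (rule wp(1))
    interpret pT: module R "tgt p" by (rule wp(2))
    note st = mod_hom_add[OF functional_eval_src_star] mod_hom_add[OF functional_eval_tgt_star]
      mod_hom_smult[OF functional_eval_src_star] mod_hom_smult[OF functional_eval_tgt_star]
    have c1: "fst \<theta> x \<in> carrier ?S'" if "x \<in> carrier (src p)" for x
      using s1[OF that] by (simp add: \<theta>_def)
    have "mod_hom R (src p) ?S' (fst \<theta>)"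
    proof (rule mod_homI)
      show "fst \<theta> x \<in> carrier ?S'" if "x \<in> carrier (src p)" for x
        by (rule c1[OF that])
      show "fst \<theta> (x \<oplus>\<^bsub>src p\<^esub> y) = fst \<theta> x \<oplus>\<^bsub>?S'\<^esub> fst \<theta> y"
        if "x \<in> carrier (src p)" "y \<in> carrier (src p)" for x y
        by (rule src_star_eqI[OF c1[OF pS.M.a_closed[OF that]] S'.M.a_closed[OF c1[OF that(1)] c1[OF that(2)]]])
          (use that s1 ac in \<open>simp_all add: \<theta>_def st mod_hom_add[OF wp(3)] mod_hom_add[OF tf]\<close>)
      show "fst \<theta> (r \<odot>\<^bsub>src p\<^esub> x) = r \<odot>\<^bsub>?S'\<^esub> fst \<theta> x"
        if "r \<in> carrier R" "x \<in> carrier (src p)" for r x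
        by (rule src_star_eqI[OF c1[OF pS.smult_closed[OF that]] S'.smult_closed[OF that(1) c1[OF that(2)]]])
          (use that s1 ac in \<open>simp_all add: \<theta>_def st mod_hom_smult[OF wp(3)] mod_hom_smult[OF tf]\<close>)
    qed
    moreover have "mod_hom R (tgt p) ?T' (snd \<theta>)"
    proof (rule mod_homI)
      show "snd \<theta> x \<in> carrier ?T'" if "x \<in> carrier (tgt p)" for x
        using s2[OF that] by (simp add: \<theta>_def)
      show "snd \<theta> (x \<oplus>\<^bsub>tgt p\<^esub> y) = snd \<theta> x \<oplus>\<^bsub>?T'\<^esub> snd \<theta> y"
        if "x \<in> carrier (tgt p)" "y \<in> carrier (tgt p)" for x y
        by (rule tgt_star_eqI[OF P'(3)])
          (use that s2 in \<open>simp_all add: \<theta>_def st mod_hom_add[OF tf]\<close>)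
      show "snd \<theta> (r \<odot>\<^bsub>tgt p\<^esub> x) = r \<odot>\<^bsub>?T'\<^esub> snd \<theta> x"
        if "r \<in> carrier R" "x \<in> carrier (tgt p)" for r x
        by (rule tgt_star_eqI[OF P'(3)])
          (use that s2 in \<open>simp_all add: \<theta>_def st mod_hom_smult[OF tf]\<close>)
    qed
    moreover have "snd \<theta> (arr p x) = arr (star_mobj R p') (fst \<theta> x)" if "x \<in> carrier (src p)" for x
      by (rule tgt_star_eqI[OF P'(3)])
        (use that s1 s2 ac arr_star_closed[OF P'(3)] in \<open>simp_all add: \<theta>_def snd_arr_star\<close>)
    ultimately show ?thesis
      by (simp add: mobj_hom_def)
  qed
  \<comment> \<open>Pulling a functional on the target of \<open>p'\<close> back along
    \<open>w\<close> gives a functional on the target of the dual of \<open>p\<close>, which is an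
    evaluation by reflexivity.\<close>
  define w where "w = the_inv_into (carrier (tgt p')) (snd v)"
  have wh: "mod_hom R ?T (tgt p') w"
    unfolding w_def by (rule mod_hom_inv[OF wp'(2) v'(2) v2])
  have wv: "w (snd v y') = y'" if "y' \<in> carrier (tgt p')" for y'
    unfolding w_def by (rule the_inv_into_f_f[OF bij_betw_imp_inj_on[OF v2] that])
  have \<theta>o: "mobj_onto p (star_mobj R p') \<theta>"
  proof -
    have "\<zeta> \<in> fst \<theta> ` carrier (src p)" if \<zeta>: "\<zeta> \<in> carrier ?S'" for \<zeta>
    proof -
      have f\<zeta>: "functional R (tgt p') (snd \<zeta>)"
        and k\<zeta>: "\<And>x. x \<in> carrier (src p') \<Longrightarrow> snd \<zeta> (arr p' x) = \<zero>"
        using \<zeta> by (auto simp: mem_src_star)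
      obtain x y where x: "x \<in> carrier (src p)" and "y \<in> carrier (tgt p)"
          and ev: "\<forall>\<eta>\<in>carrier ?T. snd \<zeta> (w \<eta>) = snd \<eta> (arr p x \<oplus>\<^bsub>tgt p\<^esub> y)"
          and y0: "(\<forall>\<eta>\<in>carrier ?S. snd \<zeta> (w (arr (star_mobj R p) \<eta>)) = \<zero>) \<longrightarrow> y = \<zero>\<^bsub>tgt p\<^esub>"
        using functional_tgt_star_is_eval[OF db mod_hom_comp[OF wh f\<zeta>]] by blast
      \<comment> \<open>\<zeta> kills the source of \<open>p'\<close>, which corresponds to the
        source of the dual of \<open>p\<close>; so \<zeta> is evaluation at a source
        element.\<close>
      have "snd \<zeta> (w (arr (star_mobj R p) \<eta>)) = \<zero>" if \<eta>: "\<eta> \<in> carrier ?S" for \<eta>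
      proof -
        have "\<eta> \<in> fst v ` carrier (src p')"
          using \<eta> bij_betw_imp_surj_on[OF v1] by simp
        then obtain x' where x': "x' \<in> carrier (src p')" "\<eta> = fst v x'"
          by blast
        then have "w (arr (star_mobj R p) \<eta>) = arr p' x'"
          using wv[OF mod_hom_closed[OF wp'(3) x'(1)]] by (simp add: v'(3))
        then show ?thesis
          using k\<zeta>[OF x'(1)] by simp
      qed
      then have "y = \<zero>\<^bsub>tgt p\<^esub>"
        using y0 by blast
      then have ev': "snd \<zeta> (w \<eta>) = snd \<eta> (arr p x)" if "\<eta> \<in> carrier ?T" for \<eta>
        using ev that abelian_group.axioms(1)[OF module.axioms(2)[OF wp(2)]] abelian_monoid.r_zero ac[OF x]
        by metis
      have "\<zeta> = fst \<theta> x"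
      proof (rule src_star_eqI[OF \<zeta>])
        show "fst \<theta> x \<in> carrier ?S'"
          by (rule mod_hom_closed[OF mobj_homD(1)[OF \<theta>] x])
        show "snd \<zeta> y' = snd (fst \<theta> x) y'" if "y' \<in> carrier (tgt p')" for y'
          using ev'[OF vc[OF that]] that by (simp add: wv \<theta>_def t_def)
      qed
      then show ?thesis
        using x by blast
    qed
    moreover have "\<zeta> \<in> snd \<theta> ` carrier (tgt p)" if \<zeta>: "\<zeta> \<in> carrier ?T'" for \<zeta>
    proof -
      have f\<zeta>: "functional R (tgt p') (snd \<zeta>)"
        using \<zeta> by (auto simp: mem_tgt_star)
      obtain x y where x: "x \<in> carrier (src p)" and y: "y \<in> carrier (tgt p)"
          and ev: "\<forall>\<eta>\<in>carrier ?T. snd \<zeta> (w \<eta>) = snd \<eta> (arr p x \<oplus>\<^bsub>tgt p\<^esub> y)"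
        using functional_tgt_star_is_eval[OF db mod_hom_comp[OF wh f\<zeta>]] by blast
      let ?y = "arr p x \<oplus>\<^bsub>tgt p\<^esub> y"
      have y': "?y \<in> carrier (tgt p)"
        using ac[OF x] y abelian_group.axioms(1)[OF module.axioms(2)[OF wp(2)]] by (simp add: abelian_monoid.a_closed)
      have "\<zeta> = snd \<theta> ?y"
      proof (rule tgt_star_eqI[OF P'(3) \<zeta>])
        show "snd \<theta> ?y \<in> carrier ?T'"
          by (rule mod_hom_closed[OF mobj_homD(2)[OF \<theta>] y'])
        show "snd \<zeta> z = snd (snd \<theta> ?y) z" if "z \<in> carrier (tgt p')" for z
          using bspec[OF ev vc[OF that]] that by (simp add: wv \<theta>_def t_def)
      qed
      then show ?thesis
        using y' by blast
    qed
    ultimately show ?thesis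
      using mod_hom_closed[OF mobj_homD(1)[OF \<theta>]] mod_hom_closed[OF mobj_homD(2)[OF \<theta>]]
      unfolding mobj_onto_def by blast
  qed
  \<comment> \<open>The elements \<open>y'\<close> in question correspond to the functionals that
    vanish on the kernel of \<pi>, that is, to functionals on the target of \<open>f\<close>. All of
    them annihilate the image of \<open>y\<close> only if it is zero.\<close>
  have ker: "(\<forall>y'\<in>carrier (tgt p'). snd \<pi>' y' = \<zero>\<^bsub>tgt g\<^esub> \<longrightarrow> t y y' = \<zero>) \<longleftrightarrow> snd \<pi> y = \<zero>\<^bsub>tgt f\<^esub>"
    if y: "y \<in> carrier (tgt p)" for y
  proof
    assume "snd \<pi> y = \<zero>\<^bsub>tgt f\<^esub>"
    then have "t y y' = \<zero>" if "y' \<in> carrier (tgt p')" "snd \<pi>' y' = \<zero>\<^bsub>tgt g\<^esub>" for y'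
      using \<kappa>2[OF vc[OF that(1)]] v\<kappa>[OF that(1)] that(2) y by (simp add: t_def)
    then show "\<forall>y'\<in>carrier (tgt p'). snd \<pi>' y' = \<zero>\<^bsub>tgt g\<^esub> \<longrightarrow> t y y' = \<zero>"
      by blast
  next
    assume all: "\<forall>y'\<in>carrier (tgt p'). snd \<pi>' y' = \<zero>\<^bsub>tgt g\<^esub> \<longrightarrow> t y y' = \<zero>"
    show "snd \<pi> y = \<zero>\<^bsub>tgt f\<^esub>"
    proof (rule ccontr)
      assume "snd \<pi> y \<noteq> \<zero>\<^bsub>tgt f\<^esub>"
      then obtain h where h: "functional R (tgt f) h" "h (snd \<pi> y) \<noteq> \<zero>"
        using torsionless[OF mod_hom_closed[OF \<pi>(2) y]] by blast
      \<comment> \<open>A functional separating the image of \<open>y\<close> from zero, pulled back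
        to \<open>p\<close>. It vanishes on the kernel of \<pi>, so the corresponding
        \<open>y'\<close> falls under \<open>all\<close>.\<close>
      define \<eta> where "\<eta> = tgt_star_of p (\<lambda>y. h (snd \<pi> y))"
      have \<eta>: "\<eta> \<in> carrier ?T"
        unfolding \<eta>_def by (rule tgt_star_of_closed[OF P(3) mod_hom_comp[OF \<pi>(2) h(1)]])
      have "snd \<kappa> \<eta> = \<zero>\<^bsub>tgt g\<^esub>"
        using \<kappa>2[OF \<eta>] mod_hom_zero[OF wf'(2) module_ring_mod[OF is_cring] h(1)] by (simp add: \<eta>_def)
      moreover have "\<eta> \<in> snd v ` carrier (tgt p')"
        using \<eta> bij_betw_imp_surj_on[OF v2] by simp
      then obtain y' where y': "y' \<in> carrier (tgt p')" "\<eta> = snd v y'"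
        by blast
      ultimately have "t y y' = \<zero>"
        using all v\<kappa> by simp
      then show False
        using y'(2)[symmetric] h(2) y by (simp add: t_def \<eta>_def)
    qed
  qed
  let ?\<rho> = "(\<lambda>x. fst \<kappa>' (fst \<theta> x), \<lambda>y. snd \<kappa>' (snd \<theta> y))"
  note th = mobj_homD[OF \<theta>] and ka = mobj_homD[OF \<kappa>'(1)]
  have "mobj_hom R p (lambda_M R g) ?\<rho>"
    using mod_hom_comp[OF th(1) ka(1)] mod_hom_comp[OF th(2) ka(2)] th(3) ka(3) mod_hom_closed[OF th(1)]
    by (simp add: mobj_hom_def)
  moreover have "mobj_onto p (lambda_M R g) ?\<rho>"
    using \<theta>o \<kappa>'(2) unfolding mobj_onto_def by (simp add: image_image[symmetric])
  \<comment> \<open>Injectivity of \<open>arr f\<close> reduces the source kernel to the target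
    kernel.\<close>
  moreover have "fst \<pi> x = \<zero>\<^bsub>src f\<^esub> \<longleftrightarrow> fst ?\<rho> x = \<zero>\<^bsub>src (lambda_M R g)\<^esub>" if x: "x \<in> carrier (src p)" for x
  proof -
    have "fst ?\<rho> x = \<zero>\<^bsub>src (lambda_M R g)\<^esub> \<longleftrightarrow> snd \<pi> (arr p x) = \<zero>\<^bsub>tgt f\<^esub>"
      using \<kappa>1'[OF mod_hom_closed[OF th(1) x]] ker[OF ac[OF x]] by (simp add: \<theta>_def)
    also have "\<dots> \<longleftrightarrow> arr f (fst \<pi> x) = arr f \<zero>\<^bsub>src f\<^esub>"
      using \<pi>(3)[OF x] mod_hom_zero[OF wf'] by simp
    also have "\<dots> \<longleftrightarrow> fst \<pi> x = \<zero>\<^bsub>src f\<^esub>"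
      using inj_on_eq_iff[OF inj mod_hom_closed[OF \<pi>(1) x] submodule_zero[OF module.carrier_is_submodule[OF wf'(1)]]] .
    finally show ?thesis
      by blast
  qed
  moreover have "snd \<pi> y = \<zero>\<^bsub>tgt f\<^esub> \<longleftrightarrow> snd ?\<rho> y = \<zero>\<^bsub>tgt (lambda_M R g)\<^esub>" if y: "y \<in> carrier (tgt p)" for y
    using \<kappa>2'[OF mod_hom_closed[OF th(2) y]] ker[OF y] by (simp add: \<theta>_def)
  ultimately have "mobj_isomorphic R f (lambda_M R g)"
    by (intro mobj_isomorphic_of_same_kernel[OF P(3) wf wl P(4,5)])
  then show ?thesis
    by (simp add: g_def)
qed


section \<open>Stable and Gorenstein projective modules\<close>

text \<open>A unit value yields \<open>z\<close> with \<open>h z = \<one>\<close>; then Rz is free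
  of rank one and complemented by the kernel of \<open>h\<close>, a non-zero projective
  summand.\<close>

lemma stable_functional_in_max_ideal:
  assumes B: "module R B" and st: "stable_mod R B" and h: "functional R B h" and y: "y \<in> carrier B"
  shows "h y \<in> max_ideal"
proof (rule ccontr)
  assume no: "h y \<notin> max_ideal"
  interpret B: module R B by (rule B)
  note rm = module_ring_mod[OF is_cring]
  have hy: "h y \<in> carrier R"
    by (rule functional_closed[OF h y])
  obtain u where u: "u \<in> carrier R" "u \<otimes> h y = \<one>"
    using unit_if_notin_max_ideal[OF hy no] by blast
  define z where "z = u \<odot>\<^bsub>B\<^esub> y"
  have z: "z \<in> carrier B" and hz: "h z = \<one>"
    using u y mod_hom_smult[OF h u(1) y] by (simp_all add: z_def)
  have l: "mod_hom R (ring_mod R) B (\<lambda>r. r \<odot>\<^bsub>B\<^esub> z)"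
    using z by (intro mod_homI) (simp_all add: B.smult_l_distr B.smult_assoc1)
  let ?H = "(\<lambda>r. r \<odot>\<^bsub>B\<^esub> z) ` carrier R" and ?K = "a_kernel B (ring_mod R) h"
  have H: "submodule ?H R B"
    using submodule_image[OF rm B l] by simp
  have K: "submodule ?K R B"
    by (rule submodule_kernel[OF B rm h])
  have hH: "h (r \<odot>\<^bsub>B\<^esub> z) = r" if "r \<in> carrier R" for r
    using mod_hom_smult[OF h that z] that by (simp add: hz)
  have zH: "z \<in> ?H"
    using z by (intro image_eqI[of _ _ \<one>]) simp_all
  have "x = \<zero>\<^bsub>B\<^esub>" if x: "x \<in> ?H \<inter> ?K" for x
  proof -
    obtain r where r: "r \<in> carrier R" "x = r \<odot>\<^bsub>B\<^esub> z"
      using x by blast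
    then have "r = \<zero>"
      using x hH by (simp add: mem_a_kernel)
    then show ?thesis
      using r z by simp
  qed
  then have "?H \<inter> ?K = {\<zero>\<^bsub>B\<^esub>}"
    using submodule_zero[OF H] submodule_zero[OF K] by blast
  moreover have "?H <+>\<^bsub>B\<^esub> ?K = carrier B"
    by (rule set_add_kernel_functional[OF B h H zH]) (simp add: hz one_notin_max_ideal)
  ultimately have ds: "direct_summand ?H R B"
    using H K by (auto simp: direct_summand_def)
  let ?BH = "B\<lparr>carrier := ?H\<rparr>"
  have BH: "module R ?BH"
    by (rule module_restrict[OF B H])
  \<comment> \<open>On Rz the functional \<open>h\<close> recovers the coefficient, so the single
    vector \<open>z\<close> together with \<open>h\<close> is a dual basis.\<close>
  have "mod_dual_basis R ?BH 1 (\<lambda>_. z) (\<lambda>_. h)"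
    unfolding mod_dual_basis_def
  proof (intro conjI allI impI ballI)
    show "(\<lambda>_. z) \<in> family ?BH 1"
      using zH by simp
    show "functional R ?BH h"
      by (rule mod_hom_comp[OF mod_hom_incl[OF H] h])
    fix x assume "x \<in> carrier ?BH"
    then obtain r where r: "r \<in> carrier R" "x = r \<odot>\<^bsub>B\<^esub> z"
      by auto
    have "lincomb ?BH 1 (\<lambda>i. h x) (\<lambda>_. z) = lincomb B 1 (\<lambda>i. h x) (\<lambda>_. z)"
      using r hH zH by (intro lincomb_restrict[OF B H]) auto
    also have "\<dots> = h x \<odot>\<^bsub>B\<^esub> z \<oplus>\<^bsub>B\<^esub> lincomb B 0 (\<lambda>i. h x) (\<lambda>_. z)"
      unfolding One_nat_def using r hH z by (intro lincomb_Suc[OF B]) auto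
    also have "\<dots> = x"
      using r z by (simp add: lincomb_0[OF B] hH)
    finally show "lincomb ?BH 1 (\<lambda>i. h x) (\<lambda>_. z) = x" .
  qed
  then have "fg_projective R ?BH"
    by (rule fg_projectiveI[OF BH])
  then have "?H = {\<zero>\<^bsub>B\<^esub>}"
    using st ds by (simp add: stable_mod_def)
  then have "z = \<zero>\<^bsub>B\<^esub>"
    using zH by blast
  then have "\<one> = \<zero>"
    using hz mod_hom_zero[OF B rm h] by simp
  then show False
    using one_notin_max_ideal max.zero_closed by simp
qed

end

section \<open>Functionals on Gorenstein projective modules and their extensions\<close>

text \<open>An element at which all functionals vanish has zero coordinates in a dual basis.\<close>

lemma fg_projective_torsionless:
  assumes P: "fg_projective R P" and x: "x \<in> carrier P" "x \<noteq> \<zero>\<^bsub>P\<^esub>"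
  shows "\<exists>h. functional R P h \<and> h x \<noteq> \<zero>\<^bsub>R\<^esub>"
proof (rule ccontr)
  assume no: "\<not> ?thesis"
  have m: "module R P"
    using P by (simp add: fg_projective_def)
  obtain n e \<phi> where e: "e \<in> family P n" and \<phi>: "\<And>i. i < n \<Longrightarrow> functional R P (\<phi> i)"
      and dec: "lincomb P n (\<lambda>i. \<phi> i x) e = x"
    using fg_projective_dual_basis[OF P] x(1) unfolding mod_dual_basis_def by blast
  have "lincomb P n (\<lambda>i. \<phi> i x) e = lincomb P n (\<lambda>i. \<zero>\<^bsub>R\<^esub>) e"
    using functional_closed[OF \<phi>] \<phi> x(1) no by (intro lincomb_cong[OF m _ e]) auto
  then show False
    using dec x(2) by (simp add: lincomb_zero[OF m e])
qed

text \<open>The module sits inside a term of the complex as a kernel, and functionals on that term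
  restrict to it.\<close>

lemma gorenstein_projective_torsionless:
  assumes gp: "gorenstein_projective R M" and x: "x \<in> carrier M" "x \<noteq> \<zero>\<^bsub>M\<^esub>"
  shows "\<exists>h. functional R M h \<and> h x \<noteq> \<zero>\<^bsub>R\<^esub>"
proof -
  obtain P d i s where M: "module R M" and ta: "totally_acyclic R P d"
      and s: "mod_hom R M ((P i)\<lparr>carrier := a_kernel (P i) (P (i - 1)) (d i)\<rparr>) s"
      and bij: "bij_betw s (carrier M) (a_kernel (P i) (P (i - 1)) (d i))"
    using gp by (auto simp: gorenstein_projective_def mod_isomorphic_def)
  have fp: "\<And>i. fg_projective R (P i)" and d: "\<And>i. mod_hom R (P i) (P (i - 1)) (d i)"
    using ta by (auto simp: totally_acyclic_def)
  have m: "\<And>i. module R (P i)"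
    using fp by (simp add: fg_projective_def)
  have s': "mod_hom R M (P i) s"
    using mod_hom_comp[OF s mod_hom_incl[OF submodule_kernel[OF m m d]]] .
  have "s x \<noteq> s \<zero>\<^bsub>M\<^esub>"
    using bij_betw_imp_inj_on[OF bij] x submodule_zero[OF module.carrier_is_submodule[OF M]]
    by (auto simp: inj_on_def)
  then have "s x \<noteq> \<zero>\<^bsub>P i\<^esub>"
    using mod_hom_zero[OF M m s'] by simp
  then obtain h where h: "functional R (P i) h" "h (s x) \<noteq> \<zero>\<^bsub>R\<^esub>"
    using fg_projective_torsionless[OF fp mod_hom_closed[OF s' x(1)]] by blast
  then show ?thesis
    using mod_hom_comp[OF s' h(1)] by blast
qed

text \<open>
  This is the vanishing of \<open>Ext^1(C, R)\<close> for the Gorenstein projective cokernel \<open>C\<close>, read off from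
  the exactness of the dual of the complex.
\<close>

lemma functional_extends:
  fixes R :: "('a, 'm) ring_scheme" and A :: "('a, 'b) module" and B :: "('a, 'c) module"
  assumes A: "module R A" and B: "module R B" and f: "mod_hom R A B f" and inj: "inj_on f (carrier A)"
    and gp: "gorenstein_projective R (cok_mod A B f)" and \<phi>: "functional R A \<phi>"
  shows "\<exists>\<psi>. functional R B \<psi> \<and> (\<forall>a\<in>carrier A. \<psi> (f a) = \<phi> a)"
proof -
  interpret A: module R A by (rule A)
  interpret B: module R B by (rule B)
  have cr: "cring R"
    using A by (rule module.axioms)
  note rm = module_ring_mod[OF cr]
  let ?C = "cok_mod A B f" and ?q = "\<lambda>b. f ` carrier A +>\<^bsub>B\<^esub> b"
  note imf = submodule_image[OF A B f]
  have q: "mod_hom R B ?C ?q" and qo: "?q ` carrier B = carrier ?C"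
      and qk: "\<And>b. b \<in> carrier B \<Longrightarrow> ?q b = \<zero>\<^bsub>?C\<^esub> \<longleftrightarrow> b \<in> f ` carrier A"
    unfolding cok_mod_def
    by (rule mod_hom_quot[OF B imf], rule quot_mod_onto[OF B imf], rule quot_mod_kernel[OF B imf])
  obtain P d i s where C: "module R ?C" and ta: "totally_acyclic R P d"
      and s: "mod_hom R ?C ((P i)\<lparr>carrier := a_kernel (P i) (P (i - 1)) (d i)\<rparr>) s"
      and bij: "bij_betw s (carrier ?C) (a_kernel (P i) (P (i - 1)) (d i))"
    using gp by (auto simp: gorenstein_projective_def mod_isomorphic_def)
  have fp: "\<And>i. fg_projective R (P i)" and dh: "\<And>i. mod_hom R (P i) (P (i - 1)) (d i)"
      and ex: "\<And>i. d (i + 1) ` carrier (P (i + 1)) = a_kernel (P i) (P (i - 1)) (d i)"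
      and hex: "\<And>Q i. fg_projective R (Q :: ('a, nat \<Rightarrow> 'a) module) \<Longrightarrow>
        exact_at (Hom_mod R (P (i - 1)) Q) (Hom_mod R (P i) Q) (Hom_mod R (P (i + 1)) Q)
               (\<lambda>h. compose (carrier (P i)) h (d i))
               (\<lambda>h. compose (carrier (P (i + 1))) h (d (i + 1)))"
    using ta unfolding totally_acyclic_def exact_at_def by blast+
  have m: "\<And>i. module R (P i)"
    using fp by (simp add: fg_projective_def)
  \<comment> \<open>\<open>?P\<close> maps onto the copy of the cokernel inside \<open>P i\<close>,
    \<open>?Q\<close> onto the relations of that cover, and \<open>?N\<close> onto the relations in
    \<open>?Q\<close>.\<close>
  let ?P = "P (i + 1)" and ?Q = "P (i + 2)" and ?N = "P (i + 3)"
  have d1: "mod_hom R ?P (P i) (d (i + 1))" and d2: "mod_hom R ?Q ?P (d (i + 2))"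
      and d3: "mod_hom R ?N ?Q (d (i + 3))"
    using dh[of "i + 1"] dh[of "i + 2"] dh[of "i + 3"] by (simp_all add: algebra_simps)
  have ex2: "d (i + 2) ` carrier ?Q = a_kernel ?P (P i) (d (i + 1))"
      and ex3: "d (i + 3) ` carrier ?N = a_kernel ?Q ?P (d (i + 2))"
    using ex[of "i + 1"] ex[of "i + 2"] by (simp_all add: algebra_simps)
  have s': "mod_hom R ?C (P i) s"
    using mod_hom_comp[OF s mod_hom_incl[OF submodule_kernel[OF m m dh]]] .
  \<comment> \<open>The projection of \<open>B\<close> to the cokernel of \<open>f\<close>, read
    inside \<open>P i\<close>; its kernel is the image of \<open>A\<close>.\<close>
  define t where "t b = s (?q b)" for b
  have t: "mod_hom R B (P i) t"
    unfolding t_def by (rule mod_hom_comp[OF q s'])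
  have tk: "t b = \<zero>\<^bsub>P i\<^esub> \<longleftrightarrow> b \<in> f ` carrier A" if b: "b \<in> carrier B" for b
  proof -
    have "t b = \<zero>\<^bsub>P i\<^esub> \<longleftrightarrow> s (?q b) = s \<zero>\<^bsub>?C\<^esub>"
      using mod_hom_zero[OF C m s'] by (simp add: t_def)
    also have "\<dots> \<longleftrightarrow> ?q b = \<zero>\<^bsub>?C\<^esub>"
      by (rule inj_on_eq_iff[OF bij_betw_imp_inj_on[OF bij] mod_hom_closed[OF q b]
            submodule_zero[OF module.carrier_is_submodule[OF C]]])
    finally show ?thesis
      using qk[OF b] by simp
  qed
  have to: "t ` carrier B = d (i + 1) ` carrier ?P"
    unfolding ex[of i] bij_betw_imp_surj_on[OF bij, symmetric] qo[symmetric] image_image t_def ..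
  obtain n e \<phi>' where e: "e \<in> family ?P n" and \<phi>': "\<And>k. k < n \<Longrightarrow> functional R ?P (\<phi>' k)"
      and dec: "\<And>x. x \<in> carrier ?P \<Longrightarrow> lincomb ?P n (\<lambda>k. \<phi>' k x) e = x"
    using fg_projective_dual_basis[OF fp[of "i + 1"]] unfolding mod_dual_basis_def by blast
  \<comment> \<open>The map from \<open>?P\<close> to the cokernel is to be lifted through
    \<open>B\<close>; by projectivity it is enough to lift the vectors of a dual basis.\<close>
  have "\<exists>b\<in>carrier B. t b = d (i + 1) (e k)" if "k < n" for k
  proof -
    have "d (i + 1) (e k) \<in> t ` carrier B"
      unfolding to using e that by auto
    then show ?thesis
      by force
  qed
  then obtain b where b: "\<And>k. k < n \<Longrightarrow> b k \<in> carrier B \<and> t (b k) = d (i + 1) (e k)"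
    by metis
  have bf: "b \<in> family B n"
    using b by auto
  define u where "u x = lincomb B n (\<lambda>k. \<phi>' k x) b" for x
  have u: "mod_hom R ?P B u"
    unfolding u_def by (rule mod_hom_lincomb[OF B \<phi>' bf])
  have tu: "t (u x) = d (i + 1) x" if x: "x \<in> carrier ?P" for x
  proof -
    have c: "(\<lambda>k. \<phi>' k x) \<in> coeffs R n"
      using functional_closed[OF \<phi>'] x by auto
    have "t (u x) = lincomb (P i) n (\<lambda>k. \<phi>' k x) (\<lambda>k. t (b k))"
      unfolding u_def by (rule lincomb_hom[OF B m t c bf])
    also have "\<dots> = lincomb (P i) n (\<lambda>k. \<phi>' k x) (\<lambda>k. d (i + 1) (e k))"
      using b mod_hom_closed[OF t] by (intro lincomb_cong[OF m c]) auto
    also have "\<dots> = d (i + 1) (lincomb ?P n (\<lambda>k. \<phi>' k x) e)"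
      by (rule lincomb_hom[OF m m d1 c e, symmetric])
    finally show ?thesis
      using dec[OF x] by simp
  qed
  define f' where "f' = the_inv_into (carrier A) f"
  let ?I = "B\<lparr>carrier := f ` carrier A\<rparr>"
  have fI: "mod_hom R A ?I f"
    using mod_hom_add[OF f] mod_hom_smult[OF f] by (intro mod_homI) auto
  have f': "mod_hom R ?I A f'"
    unfolding f'_def by (rule mod_hom_inv[OF A fI]) (simp add: bij_betw_def inj)
  have f'f: "f' (f a) = a" if "a \<in> carrier A" for a
    unfolding f'_def by (rule the_inv_into_f_f[OF inj that])
  have udI: "u (d (i + 2) z) \<in> f ` carrier A" if z: "z \<in> carrier ?Q" for z
  proof -
    have "d (i + 2) z \<in> a_kernel ?P (P i) (d (i + 1))"
      using ex2 z by blast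
    then have dz: "d (i + 2) z \<in> carrier ?P" "t (u (d (i + 2) z)) = \<zero>\<^bsub>P i\<^esub>"
      using tu by (simp_all add: mem_a_kernel)
    then show ?thesis
      using tk[OF mod_hom_closed[OF u dz(1)]] by blast
  qed
  have ud: "mod_hom R ?Q ?I (\<lambda>z. u (d (i + 2) z))"
    using udI mod_hom_add[OF mod_hom_comp[OF d2 u]] mod_hom_smult[OF mod_hom_comp[OF d2 u]]
    by (intro mod_homI) auto
  \<comment> \<open>On the image of \<open>?Q\<close> the lift \<open>u\<close> lands in the image
    of \<open>A\<close>, where \<phi> can be applied: \<open>w\<close> is the cocycle whose class
    obstructs the extension of \<phi>.\<close>
  define w where "w z = \<phi> (f' (u (d (i + 2) z)))" for z
  have w: "functional R ?Q w"
    unfolding w_def by (rule mod_hom_comp[OF mod_hom_comp[OF ud f'] \<phi>])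
  have w0: "w (d (i + 3) z) = \<zero>\<^bsub>R\<^esub>" if z: "z \<in> carrier ?N" for z
  proof -
    have "d (i + 3) z \<in> a_kernel ?Q ?P (d (i + 2))"
      using ex3 z by blast
    then have "u (d (i + 2) (d (i + 3) z)) = f \<zero>\<^bsub>A\<^esub>"
      using mod_hom_zero[OF m B u] mod_hom_zero[OF A B f] by (simp add: mem_a_kernel)
    then show ?thesis
      using f'f[of "\<zero>\<^bsub>A\<^esub>"] mod_hom_zero[OF A rm \<phi>] by (simp add: w_def)
  qed
  \<comment> \<open>Exactness of the dual complex is available for projectives with elements of type
    \<open>nat \<Rightarrow> 'a\<close>, so R is replaced by its copy of rank one.\<close>
  let ?F = "free_mod R 1"
  have F: "module R ?F"
    by (rule module_free_mod[OF cr])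
  have fpF: "fg_projective R ?F"
    by (rule fg_projectiveI[OF F mod_dual_basis_free_mod[OF cr]])
  define w' where "w' = (\<lambda>z\<in>carrier ?Q. \<lambda>k\<in>{..<1::nat}. w z)"
  have zQ: "module.smult ?Q r z \<in> carrier ?Q" if "r \<in> carrier R" "z \<in> carrier ?Q" for r z
    using module.smult_closed[OF m] that by blast
  have aQ: "z \<oplus>\<^bsub>?Q\<^esub> z' \<in> carrier ?Q" if "z \<in> carrier ?Q" "z' \<in> carrier ?Q" for z z'
    using submodule_add[OF module.carrier_is_submodule[OF m]] that by blast
  have "mod_hom R ?Q ?F w'"
    unfolding w'_def using functional_closed[OF w] zQ aQ
    by (intro mod_homI) (auto simp: mod_hom_add[OF w] mod_hom_smult[OF w])
  moreover have "compose (carrier ?N) w' (d (i + 3)) = (\<lambda>z\<in>carrier ?N. \<zero>\<^bsub>?F\<^esub>)"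
    using w0 mod_hom_closed[OF d3] by (auto simp: compose_def w'_def fun_eq_iff)
  ultimately have "w' \<in> a_kernel (Hom_mod R ?Q ?F) (Hom_mod R ?N ?F) (\<lambda>h. compose (carrier ?N) h (d (i + 3)))"
    by (simp add: mem_a_kernel w'_def)
  then have "w' \<in> (\<lambda>h. compose (carrier ?Q) h (d (i + 2))) ` carrier (Hom_mod R ?P ?F)"
    using hex[OF fpF, of "i + 2"] by (simp add: exact_at_def algebra_simps)
  then obtain g where g: "mod_hom R ?P ?F g" "w' = compose (carrier ?Q) g (d (i + 2))"
    by auto
  \<comment> \<open>Exactness makes the cocycle a coboundary: \<open>w\<close> is the composite of
    \<open>v\<close> with \<open>d (i + 2)\<close>.\<close>
  define v where "v x = g x 0" for x
  have v: "functional R ?P v"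
    unfolding v_def by (rule mod_hom_comp[OF g(1) functional_coord]) simp
  have vd: "v (d (i + 2) z) = w z" if "z \<in> carrier ?Q" for z
    using fun_cong[OF fun_cong[OF g(2), of z], of 0] that by (simp add: v_def w'_def compose_def)
  let ?M = "dsum_mod ?P A"
  interpret PP: module R ?P by (rule m)
  have M: "module R ?M"
    by (rule module_dsum_mod[OF m A])
  \<comment> \<open>\<alpha> presents \<open>B\<close> as a quotient of the sum of \<open>?P\<close>
    and \<open>A\<close>. The functional \<beta>, which is \<phi> on \<open>A\<close>, descends to
    \<open>B\<close> because \<open>v\<close> was chosen to agree with \<phi> on the
    relations.\<close>
  define \<alpha> where "\<alpha> z = u (fst z) \<oplus>\<^bsub>B\<^esub> f (snd z)" for z
  define \<beta> where "\<beta> z = v (fst z) \<oplus>\<^bsub>R\<^esub> \<phi> (snd z)" for z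
  note uc = mod_hom_closed[OF u] and fc = mod_hom_closed[OF f]
  note vc = functional_closed[OF v] and \<phi>c = functional_closed[OF \<phi>]
  have \<alpha>: "mod_hom R ?M B \<alpha>"
    using uc fc unfolding \<alpha>_def
    by (intro mod_homI) (auto simp: mod_hom_add[OF u] mod_hom_add[OF f] mod_hom_smult[OF u]
        mod_hom_smult[OF f] B.smult_r_distr B.M.a_ac)
  have \<beta>: "functional R ?M \<beta>"
    using vc \<phi>c unfolding \<beta>_def
    by (intro mod_homI) (auto simp: mod_hom_add[OF v] mod_hom_add[OF \<phi>] mod_hom_smult[OF v]
        mod_hom_smult[OF \<phi>] A.R.r_distr A.R.a_ac)
  have "y \<in> \<alpha> ` carrier ?M" if y: "y \<in> carrier B" for y
  proof -
    have "t y \<in> d (i + 1) ` carrier ?P"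
      unfolding to[symmetric] using y by blast
    then obtain x where x: "x \<in> carrier ?P" "t y = d (i + 1) x"
      by blast
    have "t (y \<ominus>\<^bsub>B\<^esub> u x) = \<zero>\<^bsub>P i\<^esub>"
      using mod_hom_diff[OF B m t y uc[OF x(1)]] tu[OF x(1)] x(2)
        diff_self[OF m mod_hom_closed[OF d1 x(1)]] by simp
    then obtain a where a: "a \<in> carrier A" "y \<ominus>\<^bsub>B\<^esub> u x = f a"
      using tk[of "y \<ominus>\<^bsub>B\<^esub> u x"] y uc[OF x(1)] by auto
    have "y = \<alpha> (x, a)"
      using diff_add_cancel[OF B y uc[OF x(1)]] a(2) by (simp add: \<alpha>_def)
    then show ?thesis
      using x(1) a(1) by (intro image_eqI[of _ _ "(x, a)"]) auto
  qed
  then have \<alpha>o: "\<alpha> ` carrier ?M = carrier B"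
    using mod_hom_closed[OF \<alpha>] by blast
  have "\<beta> z = \<zero>\<^bsub>ring_mod R\<^esub>" if z: "z \<in> carrier ?M" and 0: "\<alpha> z = \<zero>\<^bsub>B\<^esub>" for z
  proof -
    obtain x a where xa: "z = (x, a)" "x \<in> carrier ?P" "a \<in> carrier A"
      using z by auto
    have ux: "u x \<oplus>\<^bsub>B\<^esub> f a = \<zero>\<^bsub>B\<^esub>"
      using 0 xa(1) by (simp add: \<alpha>_def)
    then have "u x = \<ominus>\<^bsub>B\<^esub> f a"
      using uc[OF xa(2)] fc[OF xa(3)] by (simp add: B.M.minus_equality)
    then have ux': "u x = f (\<ominus>\<^bsub>A\<^esub> a)"
      using mod_hom_minus[OF A B f xa(3)] by simp
    then have "t (u x) = \<zero>\<^bsub>P i\<^esub>"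
      using tk[OF uc[OF xa(2)]] xa(3) by blast
    then have "x \<in> a_kernel ?P (P i) (d (i + 1))"
      using tu[OF xa(2)] xa(2) by (simp add: mem_a_kernel)
    \<comment> \<open>Such an \<open>x\<close> is a boundary, where \<open>v\<close> is given by
      \<phi> at the element of \<open>A\<close> that \<open>f\<close> sends to
      \<open>u x\<close>.\<close>
    then obtain y where y: "y \<in> carrier ?Q" "x = d (i + 2) y"
      using ex2 by blast
    have "v x = \<phi> (\<ominus>\<^bsub>A\<^esub> a)"
      using vd[OF y(1)] f'f[of "\<ominus>\<^bsub>A\<^esub> a"] xa(3) ux' y(2) by (simp add: w_def)
    also have "\<dots> = \<ominus>\<^bsub>R\<^esub> \<phi> a"
      using mod_hom_zero[OF A rm \<phi>] mod_hom_add[OF \<phi> A.M.a_inv_closed[OF xa(3)] xa(3)] xa(3) \<phi>c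
      by (intro A.R.minus_equality[symmetric]) (simp_all add: A.M.l_neg)
    finally show ?thesis
      using \<phi>c[OF xa(3)] by (simp add: \<beta>_def xa(1) A.R.l_neg)
  qed
  then obtain \<psi> where \<psi>: "functional R B \<psi>" "\<forall>z\<in>carrier ?M. \<psi> (\<alpha> z) = \<beta> z"
    using mod_hom_factor_kernel[OF M B rm \<alpha> \<alpha>o \<beta>] by blast
  have "\<psi> (f a) = \<phi> a" if a: "a \<in> carrier A" for a
    using bspec[OF \<psi>(2), of "(\<zero>\<^bsub>?P\<^esub>, a)"] a mod_hom_zero[OF m B u] mod_hom_zero[OF m rm v] fc[OF a] \<phi>c[OF a]
    by (simp add: \<alpha>_def \<beta>_def)
  then show ?thesis
    using \<psi>(1) by blast
qed

text \<open>An element outside the image of \<open>A\<close> is detected on the cokernel, an element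
  of the image by extending a functional on \<open>A\<close>.\<close>

lemma torsionless_middle:
  fixes R :: "('a, 'm) ring_scheme" and A :: "('a, 'b) module" and B :: "('a, 'c) module"
  assumes A: "module R A" and B: "module R B" and f: "mod_hom R A B f" and inj: "inj_on f (carrier A)"
    and gpA: "gorenstein_projective R A" and gpC: "gorenstein_projective R (cok_mod A B f)"
    and y: "y \<in> carrier B" "y \<noteq> \<zero>\<^bsub>B\<^esub>"
  shows "\<exists>h. functional R B h \<and> h y \<noteq> \<zero>\<^bsub>R\<^esub>"
proof (cases "y \<in> f ` carrier A")
  case True
  then obtain a where a: "a \<in> carrier A" "y = f a"
    by blast
  then have "a \<noteq> \<zero>\<^bsub>A\<^esub>"
    using y(2) mod_hom_zero[OF A B f] by auto
  then obtain \<phi> where \<phi>: "functional R A \<phi>" "\<phi> a \<noteq> \<zero>\<^bsub>R\<^esub>"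
    using gorenstein_projective_torsionless[OF gpA a(1)] by blast
  then show ?thesis
    using functional_extends[OF A B f inj gpC \<phi>(1)] a by metis
next
  case False
  note imf = submodule_image[OF A B f]
  let ?q = "\<lambda>b. f ` carrier A +>\<^bsub>B\<^esub> b"
  have q: "mod_hom R B (cok_mod A B f) ?q" and "?q y \<noteq> \<zero>\<^bsub>cok_mod A B f\<^esub>"
    unfolding cok_mod_def using mod_hom_quot[OF B imf] quot_mod_kernel[OF B imf y(1)] False by auto
  then obtain h where h: "functional R (cok_mod A B f) h" "h (?q y) \<noteq> \<zero>\<^bsub>R\<^esub>"
    using gorenstein_projective_torsionless[OF gpC mod_hom_closed[OF q y(1)]] by blast
  then show ?thesis
    using mod_hom_comp[OF q h(1)] by blast
qed

section \<open>Horizontal linkage of the given monomorphism\<close>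

theorem corollary4p7:
  fixes R :: "('a, 'm) ring_scheme"
    and A :: "('a, 'b) module" and B :: "('a, 'c) module" and f :: "'b \<Rightarrow> 'c"
  assumes "noetherian_ring R" and "local_ring R" and "finite_krull_dim R"
    and "fg_module R A" and "fg_module R B"
    and "mod_hom R A B f" and "inj_on f (carrier A)"
    and "gorenstein_projective R A" and "gorenstein_projective R (cok_mod A B f)"
    and "stable_mod R A" and "stable_mod R B"
  shows "horizontally_linked R \<lparr>src = A, tgt = B, arr = f\<rparr>"
proof -
  interpret noetherian_local R
    using assms(1,2)
    by (simp add: noetherian_local_def noetherian_local_axioms_def local_ring_def)
  let ?f = "\<lparr>src = A, tgt = B, arr = f\<rparr>"
  have A: "module R A" and B: "module R B"
    using assms(4,5) by (auto simp: fg_module_def)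
  have mono: "is_mono_mobj R ?f"
    using assms(4-7) by (simp add: is_mono_mobj_def is_mobj_def)
  have "mobj_isomorphic R ?f (lambda_M R (lambda_M R ?f))"
  proof (rule mobj_isomorphic_lambda_M_lambda_M[OF mono])
    show "\<exists>h. functional R (tgt ?f) h \<and> h y \<noteq> \<zero>\<^bsub>R\<^esub>"
      if "y \<in> carrier (tgt ?f)" "y \<noteq> \<zero>\<^bsub>tgt ?f\<^esub>" for y
      using torsionless_middle[OF A B assms(6-9)] that by simp
    show "h y \<in> max_ideal" if "functional R (tgt ?f) h" "y \<in> carrier (tgt ?f)" for h y
      using stable_functional_in_max_ideal[OF B assms(11)] that by simp
  qed
  then show ?thesis
    using mono by (simp add: horizontally_linked_def)
qed

end
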